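(* The function $\mathcal{C}(\mu)$ has, near $\mu=0$, the expansion $$\mathcal{C}(\mu)=\frac{\pi}{2\mu}+\sum_{n=0}^\infty(-\mu)^n\,C_{n+1},\qquad C_n=\delta_{n,1}\ln 2+\pi\sum_{k=1}^\infty\frac{[\Psi_{2k}(\infty)]^2}{[\mu_{2k}]^n}\quad(n=1,2,\dots),$$ and the first two coefficients have the exact values $$C_1=\frac32-\ln 2,\qquad C_2=\frac{21-2\pi^2}{18\pi}.$$
   Context: $\mathbb{H}_2=\mathbb{R}\times(0,\infty)$ is the upper half-plane with points $\boldsymbol{y}=(y_1,y_2)$; $\partial_n=-\partial_{y_2}$ on $y_2=0$ is the outward normal derivative. $\mathcal{C}(\mu)$ is the constant term in $g_\mu(\boldsymbol{y})=\ln|\boldsymbol{y}|+\mathcal{C}(\mu)+o(1)$ as $|\boldsymbol{y}|\to\infty$, where $g_\mu$ (for $\mu\neq0$ near $0$) is the Robin Green's function: $\Delta g_\mu=0$ in $\mathbb{H}_2$; $\partial_n g_\mu=0$ on $y_2=0$, $|y_1|\ge1$; $\partial_n g_\mu+\mu g_\mu=0$ on $y_2=0$, $|y_1|<1$; $g_\mu\sim\ln|\boldsymbol{y}|+\mathcal{O}(1)$ as $|\boldsymbol{y}|\to\infty$. The pairs $(\mu_k,\Psi_k)$, $k=0,1,2,\dots$, are the eigenvalues and eigenfunctions of the Steklov--Neumann problem: $\Delta\Psi_k=0$ in $\mathbb{H}_2$; $\partial_n\Psi_k=\mu_k\Psi_k$ on $y_2=0$, $|y_1|<1$; $\partial_n\Psi_k=0$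 on $y_2=0$, $|y_1|\ge1$; $\Psi_k=\mathcal{O}(1)$ as $|\boldsymbol{y}|\to\infty$. It is known that $0=\mu_0\le\mu_1\le\mu_2\le\dots\nearrow\infty$ and that the (real) restrictions $\Psi_k(y_1,0)$ to $(-1,1)$ form a complete orthonormal basis of $L^2(-1,1)$, which fixes the normalization; $\Psi_0=1/\sqrt2$. Even indices label the eigenfunctions symmetric under $y_1\mapsto-y_1$, odd indices the antisymmetric ones. $\Psi_k(\infty)$ denotes the limit of $\Psi_k(\boldsymbol{y})$ as $|\boldsymbol{y}|\to\infty$. All boundary value problems are understood in the usual sense for mixed boundary conditions: solutions are continuous on $\overline{\mathbb{H}_2}$ and have locally finite Dirichlet energy (so no singularities at $(\pm1,0)$). $\delta_{n,1}$ is the Kronecker symbol. *)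

theory Defs
  imports "HOL-Analysis.Analysis" "HOL-Library.Landau_Symbols"
begin

definition half_plane :: "(real \<times> real) set" where
  "half_plane = {y. snd y > 0}"

definition closed_half_plane :: "(real \<times> real) set" where
  "closed_half_plane = {y. snd y \<ge> 0}"

definition infinity_in_half_plane :: "(real \<times> real) filter" where
  "infinity_in_half_plane = inf at_infinity (principal closed_half_plane)"

definition partial1 :: "(real \<times> real \<Rightarrow> real) \<Rightarrow> real \<times> real \<Rightarrow> real" where
  "partial1 u y = deriv (\<lambda>t. u (t, snd y)) (fst y)"

definition partial2 :: "(real \<times> real \<Rightarrow> real) \<Rightarrow> real \<times> real \<Rightarrow> real" where
  "partial2 u y = deriv (\<lambda>t. u (fst y, t)) (snd y)"

text \<open>For an open set \<open>S\<close>, the first three conditions say exactly that \<open>u\<close> is of class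
  \<open>C\<^sup>2\<close> on \<open>S\<close>.\<close>

definition harmonic_on :: "(real \<times> real \<Rightarrow> real) \<Rightarrow> (real \<times> real) set \<Rightarrow> bool" where
  "harmonic_on u S \<longleftrightarrow>
     u differentiable_on S \<and>
     partial1 u differentiable_on S \<and> partial2 u differentiable_on S \<and>
     continuous_on S (partial1 (partial1 u)) \<and> continuous_on S (partial2 (partial1 u)) \<and>
     continuous_on S (partial1 (partial2 u)) \<and> continuous_on S (partial2 (partial2 u)) \<and>
     (\<forall>y\<in>S. partial1 (partial1 u) y + partial2 (partial2 u) y = 0)"

text \<open>Outward normal derivative \<open>d = - \<partial>u/\<partial>y\<^sub>2\<close> at the boundary point \<open>(x, 0)\<close>.\<close>

definition has_normal_derivative :: "(real \<times> real \<Rightarrow> real) \<Rightarrow> real \<Rightarrow> real \<Rightarrow> bool" where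
  "has_normal_derivative u d x \<longleftrightarrow>
     ((\<lambda>t. u (x, t)) has_real_derivative - d) (at 0 within {0..})"

definition locally_finite_energy :: "(real \<times> real \<Rightarrow> real) \<Rightarrow> bool" where
  "locally_finite_energy u \<longleftrightarrow>
     (\<forall>R>0. set_integrable lborel (ball 0 R \<inter> half_plane)
        (\<lambda>y. (partial1 u y)\<^sup>2 + (partial2 u y)\<^sup>2))"

text \<open>Harmonic functions in the half-plane with \<open>\<partial>\<^sub>n u = \<mu> u\<close> on the segment \<open>\<bar>y\<^sub>1\<bar> < 1\<close> and
  \<open>\<partial>\<^sub>n u = 0\<close> on the rest of the boundary line. The boundary conditions are imposed pointwise
  except at the two points \<open>(\<plusminus>1, 0)\<close> where the type of condition changes: there the one-sided
  vertical derivative of a solution is the mean \<open>\<mu> u / 2\<close> of the values on either side, and only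
  continuity and finite energy are required, as usual for mixed problems.\<close>

definition mixed_solution :: "real \<Rightarrow> (real \<times> real \<Rightarrow> real) \<Rightarrow> bool" where
  "mixed_solution \<mu> u \<longleftrightarrow>
     harmonic_on u half_plane \<and>
     continuous_on closed_half_plane u \<and>
     locally_finite_energy u \<and>
     (\<forall>x. \<bar>x\<bar> < 1 \<longrightarrow> has_normal_derivative u (\<mu> * u (x, 0)) x) \<and>
     (\<forall>x. \<bar>x\<bar> > 1 \<longrightarrow> has_normal_derivative u 0 x)"

definition robin_green :: "real \<Rightarrow> (real \<times> real \<Rightarrow> real) \<Rightarrow> bool" where
  "robin_green \<mu> g \<longleftrightarrow>
     mixed_solution (- \<mu>) g \<and>
     (\<lambda>y. g y - ln (norm y)) \<in> O[infinity_in_half_plane](\<lambda>_. 1)"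

definition robin_constant :: "real \<Rightarrow> real" where
  "robin_constant \<mu> =
     (THE c. \<exists>g. robin_green \<mu> g \<and>
        ((\<lambda>y. g y - ln (norm y)) \<longlongrightarrow> c) infinity_in_half_plane)"

definition steklov_neumann :: "real \<Rightarrow> (real \<times> real \<Rightarrow> real) \<Rightarrow> bool" where
  "steklov_neumann \<mu> u \<longleftrightarrow>
     mixed_solution \<mu> u \<and> u \<in> O[infinity_in_half_plane](\<lambda>_. 1)"

definition value_at_infinity :: "(real \<times> real \<Rightarrow> real) \<Rightarrow> real" where
  "value_at_infinity u = Lim infinity_in_half_plane u"

definition inner_L2 :: "(real \<Rightarrow> real) \<Rightarrow> (real \<Rightarrow> real) \<Rightarrow> real" where
  "inner_L2 f h = set_lebesgue_integral lborel {-1<..<1} (\<lambda>x. f x * h x)"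

definition square_integrable :: "(real \<Rightarrow> real) \<Rightarrow> bool" where
  "square_integrable f \<longleftrightarrow>
     f \<in> borel_measurable borel \<and> set_integrable lborel {-1<..<1} (\<lambda>x. (f x)\<^sup>2)"

text \<open>Every class in \<open>L\<^sup>2(-1,1)\<close> has a Borel representative defined on the whole line, so it is
  enough to expand the functions satisfying \<open>square_integrable\<close>.\<close>

definition orthonormal_basis_L2 :: "(nat \<Rightarrow> real \<Rightarrow> real) \<Rightarrow> bool" where
  "orthonormal_basis_L2 e \<longleftrightarrow>
     (\<forall>j k. inner_L2 (e j) (e k) = (if j = k then 1 else 0)) \<and>
     (\<forall>f. square_integrable f \<longrightarrow>
        (\<lambda>N. set_lebesgue_integral lborel {-1<..<1}
               (\<lambda>x. (f x - (\<Sum>k<N. inner_L2 f (e k) * e k x))\<^sup>2)) \<longlonglongrightarrow> 0)"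

definition steklov_neumann_system ::
    "(nat \<Rightarrow> real) \<Rightarrow> (nat \<Rightarrow> real \<times> real \<Rightarrow> real) \<Rightarrow> bool" where
  "steklov_neumann_system \<mu> \<Psi> \<longleftrightarrow>
     (\<forall>k. steklov_neumann (\<mu> k) (\<Psi> k)) \<and>
     \<mu> 0 = 0 \<and> mono \<mu> \<and> filterlim \<mu> at_top sequentially \<and>
     orthonormal_basis_L2 (\<lambda>k x. \<Psi> k (x, 0)) \<and>
     (\<forall>y\<in>closed_half_plane. \<Psi> 0 y = 1 / sqrt 2) \<and>
     (\<forall>k. even k \<longrightarrow> (\<forall>y\<in>closed_half_plane. \<Psi> k (- fst y, snd y) = \<Psi> k y)) \<and>
     (\<forall>k. odd k \<longrightarrow> (\<forall>y\<in>closed_half_plane. \<Psi> k (- fst y, snd y) = - \<Psi> k y))"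

definition coeff_summand ::
    "(nat \<Rightarrow> real) \<Rightarrow> (nat \<Rightarrow> real \<times> real \<Rightarrow> real) \<Rightarrow> nat \<Rightarrow> nat \<Rightarrow> real" where
  "coeff_summand \<mu> \<Psi> n k = (value_at_infinity (\<Psi> (2 * k)))\<^sup>2 / \<mu> (2 * k) ^ n"

text \<open>The index shift \<open>Suc k\<close> makes the series start at \<open>k = 1\<close>.\<close>

definition robin_coeff ::
    "(nat \<Rightarrow> real) \<Rightarrow> (nat \<Rightarrow> real \<times> real \<Rightarrow> real) \<Rightarrow> nat \<Rightarrow> real" where
  "robin_coeff \<mu> \<Psi> n =
     (if n = 1 then ln 2 else 0) + pi * (\<Sum>k. coeff_summand \<mu> \<Psi> n (Suc k))"

end

theory Submission
  imports Defs "HOL-Complex_Analysis.Complex_Analysis"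
begin

text \<open>Everything is reduced to the logarithmic potential
  \<open>K f x = \<integral> ln \<bar>x - t\<bar> f t dt\<close> over the segment \<open>(-1, 1)\<close> (below: \<open>segpot\<close>), by
  subtracting from a solution \<open>u\<close> of the mixed problem the single layer potential of its
  normal derivative. The difference is harmonic, continuous, has vanishing normal derivative
  off \<open>\<plusminus>1\<close> and grows at most logarithmically, so a Liouville theorem makes it constant
  (\<open>mixed_solution_representation\<close>). With \<open>e\<^sub>k\<close> the boundary values of \<open>\<Psi>\<^sub>k\<close> and
  \<open>c\<^sub>k = \<Psi>\<^sub>k(\<infinity>)\<close> this reads \<open>e\<^sub>k = c\<^sub>k - (\<mu>\<^sub>k / \<pi>) K e\<^sub>k\<close>, while the boundary values \<open>f\<close> of
  \<open>g\<^sub>\<nu>\<close> satisfy \<open>f = C(\<nu>) + (\<nu> / \<pi>) K f\<close> and \<open>\<integral> f = \<pi> / \<nu>\<close>. Conversely, the second equation is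
  solved for small \<open>\<nu>\<close> by a contraction, and its solution gives a Green's function
  (\<open>robin_green_exists\<close>).

  \<open>K\<close> is symmetric, so testing with \<open>e\<^sub>k\<close>, \<open>k \<ge> 1\<close>, gives the coefficients
  \<open>\<langle>f, e\<^sub>k\<rangle> = \<pi> c\<^sub>k / (\<mu>\<^sub>k + \<nu>)\<close> and \<open>\<langle>K 1, e\<^sub>k\<rangle> = 2 \<pi> c\<^sub>k / \<mu>\<^sub>k\<close>. Integrating the equation for \<open>f\<close>
  and using Parseval's identity for \<open>\<langle>f, K 1\<rangle>\<close> yields
  \<open>C(\<nu>) = \<pi> / (2 \<nu>) - (\<integral> K 1) / 4 - \<nu> \<pi> \<Sum> c\<^sub>k\<^sup>2 / (\<mu>\<^sub>k (\<mu>\<^sub>k + \<nu>))\<close>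
  (\<open>robin_constant_formula\<close>). This determines \<open>C(\<nu>)\<close>, and expanding the fractions in
  geometric series gives the power series.

  The exact values come from two more uses of Parseval's identity. Applied to \<open>K 1\<close> it gives
  \<open>\<Sum> c\<^sub>k\<^sup>2 / \<mu>\<^sub>k\<^sup>2\<close> in terms of elementary integrals (\<open>second_sum\<close>). The sum
  \<open>\<Sum> c\<^sub>k\<^sup>2 / \<mu>\<^sub>k\<close> is \<open>1 / \<pi>\<close> times the logarithmic energy of the difference between the equilibrium (arcsine)
  distribution \<open>\<omega>\<close> and the uniform one, because \<open>K \<omega> = - ln 2\<close> is constant and hence
  \<open>c\<^sub>k = \<langle>\<omega>, e\<^sub>k\<rangle>\<close>. As \<open>\<omega>\<close> is not square integrable, Parseval's identity is applied to the
  truncations \<open>min n \<omega>\<close>, and the limit is taken in \<open>first_sum\<close>.\<close>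

section \<open>Laplacians along the axes and a maximum principle\<close>

text \<open>A pointwise Laplacian built from the two iterated axis derivatives. It is weaker than
  harmonicity, is additive for trivial reasons, and is all that the second derivative
  test in the maximum principle needs.\<close>

definition has_laplacian :: "(real \<times> real \<Rightarrow> real) \<Rightarrow> real \<Rightarrow> real \<times> real \<Rightarrow> bool" where
  "has_laplacian u c y \<longleftrightarrow> (\<exists>p q a b.
     (\<forall>\<^sub>F t in nhds (fst y). ((\<lambda>s. u (s, snd y)) has_real_derivative p t) (at t)) \<and>
     (p has_real_derivative a) (at (fst y)) \<and>
     (\<forall>\<^sub>F t in nhds (snd y). ((\<lambda>s. u (fst y, s)) has_real_derivative q t) (at t)) \<and>
     (q has_real_derivative b) (at (snd y)) \<and> c = a + b)"

lemma has_laplacian_add: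
  assumes "has_laplacian u c y" "has_laplacian v d y"
  shows "has_laplacian (\<lambda>y. u y + v y) (c + d) y"
proof -
  obtain p q a b where u: "\<forall>\<^sub>F t in nhds (fst y). ((\<lambda>s. u (s, snd y)) has_real_derivative p t) (at t)"
     "(p has_real_derivative a) (at (fst y))"
     "\<forall>\<^sub>F t in nhds (snd y). ((\<lambda>s. u (fst y, s)) has_real_derivative q t) (at t)"
     "(q has_real_derivative b) (at (snd y))" "c = a + b"
    using assms(1) unfolding has_laplacian_def by blast
  obtain p' q' a' b' where v: "\<forall>\<^sub>F t in nhds (fst y). ((\<lambda>s. v (s, snd y)) has_real_derivative p' t) (at t)"
     "(p' has_real_derivative a') (at (fst y))"
     "\<forall>\<^sub>F t in nhds (snd y). ((\<lambda>s. v (fst y, s)) has_real_derivative q' t) (at t)"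
     "(q' has_real_derivative b') (at (snd y))" "d = a' + b'"
    using assms(2) unfolding has_laplacian_def by blast
  show ?thesis unfolding has_laplacian_def
  proof (intro exI conjI)
    show "\<forall>\<^sub>F t in nhds (fst y). ((\<lambda>s. u (s, snd y) + v (s, snd y)) has_real_derivative (\<lambda>t. p t + p' t) t) (at t)"
      using eventually_conj[OF u(1) v(1)] by eventually_elim (auto intro: DERIV_add)
    show "\<forall>\<^sub>F t in nhds (snd y). ((\<lambda>s. u (fst y, s) + v (fst y, s)) has_real_derivative (\<lambda>t. q t + q' t) t) (at t)"
      using eventually_conj[OF u(3) v(3)] by eventually_elim (auto intro: DERIV_add)
    show "((\<lambda>t. p t + p' t) has_real_derivative (a + a')) (at (fst y))"
      using u v by (auto intro: DERIV_add)
    show "((\<lambda>t. q t + q' t) has_real_derivative (b + b')) (at (snd y))"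
      using u v by (auto intro: DERIV_add)
  qed (use u v in auto)
qed

lemma has_laplacian_cmult:
  assumes "has_laplacian u c y"
  shows "has_laplacian (\<lambda>y. k * u y) (k * c) y"
proof -
  obtain p q a b where u: "\<forall>\<^sub>F t in nhds (fst y). ((\<lambda>s. u (s, snd y)) has_real_derivative p t) (at t)"
     "(p has_real_derivative a) (at (fst y))"
     "\<forall>\<^sub>F t in nhds (snd y). ((\<lambda>s. u (fst y, s)) has_real_derivative q t) (at t)"
     "(q has_real_derivative b) (at (snd y))" "c = a + b"
    using assms(1) unfolding has_laplacian_def by blast
  show ?thesis unfolding has_laplacian_def
  proof (intro exI conjI)
    show "\<forall>\<^sub>F t in nhds (fst y). ((\<lambda>s. k * u (s, snd y)) has_real_derivative (\<lambda>t. k * p t) t) (at t)"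
      using u(1) by eventually_elim (auto intro: DERIV_cmult)
    show "\<forall>\<^sub>F t in nhds (snd y). ((\<lambda>s. k * u (fst y, s)) has_real_derivative (\<lambda>t. k * q t) t) (at t)"
      using u(3) by eventually_elim (auto intro: DERIV_cmult)
    show "((\<lambda>t. k * p t) has_real_derivative (k * a)) (at (fst y))"
      using u by (auto intro: DERIV_cmult)
    show "((\<lambda>t. k * q t) has_real_derivative (k * b)) (at (snd y))"
      using u by (auto intro: DERIV_cmult)
  qed (use u in \<open>auto simp: algebra_simps\<close>)
qed

lemma has_laplacian_const: "has_laplacian (\<lambda>y. k) 0 y"
  unfolding has_laplacian_def
  by (rule exI[of _ "\<lambda>_. 0"], rule exI[of _ "\<lambda>_. 0"], rule exI[of _ 0], rule exI[of _ 0]) auto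

lemma has_laplacian_vertical: "has_laplacian (\<lambda>y. snd y + (snd y)\<^sup>2) 2 y"
  unfolding has_laplacian_def
  apply (rule exI[of _ "\<lambda>_. 0"], rule exI[of _ "\<lambda>t. 1 + 2 * t"], rule exI[of _ 0], rule exI[of _ 2])
  by (auto intro!: derivative_eq_intros always_eventually)

lemma norm_minus_real_pair: "norm (y - (q, 0 :: real)) = sqrt ((fst y - q)\<^sup>2 + (snd y)\<^sup>2)" for y :: "real \<times> real"
  by (cases y) (simp add: norm_Pair)

lemma ln_norm_minus: "y \<noteq> (q, 0) \<Longrightarrow> ln (norm (y - (q, 0 :: real))) = ln ((fst y - q)\<^sup>2 + (snd y)\<^sup>2) / 2" for y :: "real \<times> real"
  by (simp add: norm_minus_real_pair ln_sqrt)

lemma has_laplacian_ln_norm: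
  assumes "snd y > 0"
  shows "has_laplacian (\<lambda>y. ln (norm (y - (q, 0)))) 0 y"
proof -
  obtain x b where y: "y = (x, b)" by (cases y)
  have b: "b > 0" using assms y by simp
  have pos: "(t - q)\<^sup>2 + s\<^sup>2 > 0" if "s > 0" for t s
    using that by (simp add: add_nonneg_pos)
  have e: "ln (norm ((t, s) - (q, 0))) = ln ((t - q)\<^sup>2 + s\<^sup>2) / 2" if "s > 0" for t s
    using ln_norm_minus[of "(t,s)" q] that by auto
  let ?p = "\<lambda>t. (t - q) / ((t - q)\<^sup>2 + b\<^sup>2)"
  let ?q = "\<lambda>s. s / ((x - q)\<^sup>2 + s\<^sup>2)"
  have ev: "\<forall>\<^sub>F t in nhds b. t > 0"
    using b by (rule eventually_nhds_in_open[OF open_greaterThan, of b 0, simplified])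
  show ?thesis unfolding has_laplacian_def y fst_conv snd_conv
  proof (intro exI conjI)
    show "\<forall>\<^sub>F t in nhds x. ((\<lambda>s. ln (norm ((s, b) - (q, 0)))) has_real_derivative ?p t) (at t)"
      unfolding e[OF b]
    proof (intro always_eventually allI)
      fix t show "((\<lambda>s. ln ((s - q)\<^sup>2 + b\<^sup>2) / 2) has_real_derivative ?p t) (at t)"
        using pos[OF b, of t] by (auto intro!: derivative_eq_intros simp: divide_simps) (auto simp: algebra_simps)
    qed
    show "(?p has_real_derivative (b\<^sup>2 - (x - q)\<^sup>2) / ((x - q)\<^sup>2 + b\<^sup>2)\<^sup>2) (at x)"
      using pos[OF b, of x]
      by (auto intro!: derivative_eq_intros simp: power2_eq_square)
    show "\<forall>\<^sub>F t in nhds b. ((\<lambda>s. ln (norm ((x, s) - (q, 0)))) has_real_derivative ?q t) (at t)"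
      using ev
    proof eventually_elim
      fix t :: real assume t: "t > 0"
      have "((\<lambda>s. ln ((x - q)\<^sup>2 + s\<^sup>2) / 2) has_real_derivative ?q t) (at t)"
        using pos[OF t, of x] by (auto intro!: derivative_eq_intros simp: divide_simps)
      then show "((\<lambda>s. ln (norm ((x, s) - (q, 0)))) has_real_derivative ?q t) (at t)"
        by (rule DERIV_cong_ev[THEN iffD1, rotated -1, OF _ refl _ refl])
           (use eventually_nhds_in_open[OF open_greaterThan, of t 0] t e in \<open>auto elim!: eventually_mono\<close>)
    qed
    show "(?q has_real_derivative ((x - q)\<^sup>2 - b\<^sup>2) / ((x - q)\<^sup>2 + b\<^sup>2)\<^sup>2) (at b)"
      using pos[OF b, of x]
      by (auto intro!: derivative_eq_intros simp: power2_eq_square)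
  qed (simp add: add_divide_distrib[symmetric])
qed

lemma vertical_derivative_ln_norm:
  fixes x q :: real
  assumes "x \<noteq> q"
  shows "((\<lambda>t. ln (norm ((x, t) - (q, 0 :: real)))) has_real_derivative 0) (at 0 within {0..})"
proof -
  have e: "ln (norm ((x, s) - (q, 0 :: real))) = ln ((x - q)\<^sup>2 + s\<^sup>2) / 2" for s :: real
    using ln_norm_minus[of "(x,s)" q] assms by auto
  have "((\<lambda>s. ln ((x - q)\<^sup>2 + s\<^sup>2) / 2) has_real_derivative 0) (at 0 within {0..})"
    using assms by (auto intro!: derivative_eq_intros)
  then show ?thesis by (simp only: e)
qed

lemma second_derivative_at_local_max:
  fixes h :: "real \<Rightarrow> real"
  assumes p: "\<forall>\<^sub>F t in nhds x. (h has_real_derivative p t) (at t)"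
    and a: "(p has_real_derivative a) (at x)"
    and max: "\<forall>\<^sub>F t in nhds x. h t \<le> h x"
  shows "a \<le> 0"
proof (rule ccontr)
  assume "\<not> a \<le> 0"
  obtain d where d: "d > 0" "\<And>t. \<bar>t - x\<bar> < d \<Longrightarrow> (h has_real_derivative p t) (at t) \<and> h t \<le> h x"
    using eventually_conj[OF p max] unfolding eventually_nhds_metric dist_real_def by blast
  have "p x = 0"
    using DERIV_local_max[of h "p x" x d] d by (simp add: abs_minus_commute)
  moreover obtain e where e: "e > 0" "\<And>k. 0 < k \<Longrightarrow> k < e \<Longrightarrow> p x < p (x + k)"
    using DERIV_pos_inc_right[OF a] \<open>\<not> a \<le> 0\<close> by force
  ultimately have pos: "p t > 0" if "x < t" "t < x + e" for t
    using e(2)[of "t - x"] that by auto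
  define k where "k = min d e / 2"
  have k: "k > 0" "k < d" "k < e" using d e by (auto simp: k_def)
  have "\<exists>z>x. z < x + k \<and> h (x + k) - h x = (x + k - x) * p z"
    by (rule MVT2) (use k d in auto)
  then obtain z where z: "z > x" "z < x + k" "h (x + k) - h x = k * p z" by auto
  have "k * p z > 0" using pos[of z] z k by simp
  then show False using d(2)[of "x + k"] k z by simp
qed

lemma no_local_max_of_positive_laplacian:
  assumes "has_laplacian u c y" "c > 0" "\<forall>\<^sub>F z in nhds y. u z \<le> u y"
  shows False
proof -
  obtain p q a b where u: "\<forall>\<^sub>F t in nhds (fst y). ((\<lambda>s. u (s, snd y)) has_real_derivative p t) (at t)"
     "(p has_real_derivative a) (at (fst y))"
     "\<forall>\<^sub>F t in nhds (snd y). ((\<lambda>s. u (fst y, s)) has_real_derivative q t) (at t)"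
     "(q has_real_derivative b) (at (snd y))" "c = a + b"
    using assms(1) unfolding has_laplacian_def by blast
  have t1: "((\<lambda>s. (s, snd y)) \<longlongrightarrow> y) (nhds (fst y))"
    using tendsto_Pair[OF filterlim_ident tendsto_const[of "snd y"], of "fst y"] by simp
  have t2: "((\<lambda>s. (fst y, s)) \<longlongrightarrow> y) (nhds (snd y))"
    using tendsto_Pair[OF tendsto_const[of "fst y"] filterlim_ident, of "snd y"] by simp
  have "a \<le> 0"
    by (rule second_derivative_at_local_max[OF u(1,2)])
       (use filterlim_iff[THEN iffD1, OF t1, rule_format, OF assms(3)] in simp)
  moreover have "b \<le> 0"
    by (rule second_derivative_at_local_max[OF u(3,4)])
       (use filterlim_iff[THEN iffD1, OF t2, rule_format, OF assms(3)] in simp)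
  ultimately show False using u assms by simp
qed

text \<open>A positive Laplacian excludes a maximum inside, and a positive upward derivative excludes
  one on the boundary line, where a step into the half-plane would increase \<open>\<phi>\<close>. So a maximum
  on \<open>K\<close> lies in the exceptional set \<open>B\<close>.\<close>

lemma mixed_weak_max_principle:
  assumes K: "compact K" "continuous_on K \<phi>"
    and int: "\<And>y. y \<in> K - B \<Longrightarrow> snd y > 0 \<Longrightarrow> \<exists>c>0. has_laplacian \<phi> c y"
    and bd: "\<And>y. y \<in> K - B \<Longrightarrow> snd y = 0 \<Longrightarrow>
      \<exists>d>0. ((\<lambda>t. \<phi> (fst y, t)) has_real_derivative d) (at 0 within {0..})"
    and nb: "\<And>y. y \<in> K - B \<Longrightarrow> snd y \<ge> 0 \<and> (\<exists>S. open S \<and> y \<in> S \<and> S \<inter> closed_half_plane \<subseteq> K)"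
    and le: "\<And>y. y \<in> K \<inter> B \<Longrightarrow> \<phi> y \<le> M"
    and y0: "y0 \<in> K"
  shows "\<phi> y0 \<le> M"
proof -
  obtain y where y: "y \<in> K" "\<And>z. z \<in> K \<Longrightarrow> \<phi> z \<le> \<phi> y"
    using continuous_attains_sup[OF K(1) _ K(2)] y0 by blast
  have "y \<in> B"
  proof (rule ccontr)
    assume "y \<notin> B"
    then have yK: "y \<in> K - B" using y by blast
    obtain S where S: "open S" "y \<in> S" "S \<inter> closed_half_plane \<subseteq> K" and "snd y \<ge> 0"
      using nb[OF yK] by blast
    show False
    proof (cases "snd y > 0")
      case True
      have "open {z :: real \<times> real. snd z > 0}"
        by (intro open_Collect_less continuous_intros)
      then have "\<forall>\<^sub>F z in nhds y. z \<in> S \<inter> {z. snd z > 0}"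
        using S True by (intro eventually_nhds_in_open) auto
      then have "\<forall>\<^sub>F z in nhds y. \<phi> z \<le> \<phi> y"
        by eventually_elim (use S y(2) in \<open>auto simp: closed_half_plane_def subset_iff\<close>)
      then show False
        using int[OF yK True] no_local_max_of_positive_laplacian by blast
    next
      case False
      then have s0: "snd y = 0" using \<open>snd y \<ge> 0\<close> by simp
      obtain d where d: "d > 0" "((\<lambda>t. \<phi> (fst y, t)) has_real_derivative d) (at 0 within {0..})"
        using bd[OF yK s0] by blast
      obtain e where e: "e > 0" "\<And>h. h > 0 \<Longrightarrow> h < e \<Longrightarrow> \<phi> (fst y, 0) < \<phi> (fst y, 0 + h)"
        using has_real_derivative_pos_inc_right[OF d(2,1)] by auto
      have t2: "((\<lambda>s. (fst y, s)) \<longlongrightarrow> y) (at_right 0)"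
        using tendsto_Pair[OF tendsto_const[of "fst y"] tendsto_ident_at[of 0 "{0<..}"]] s0
        by (cases y) simp
      have "\<forall>\<^sub>F s in at_right 0. (fst y, s) \<in> S"
        using topological_tendstoD[OF t2 S(1,2)] .
      moreover have "\<forall>\<^sub>F s in at_right 0. s \<in> {0<..<e}"
        using e by (intro eventually_at_right_real) auto
      ultimately have "\<forall>\<^sub>F s in at_right (0::real). (fst y, s) \<in> S \<and> s \<in> {0<..<e}"
        by (rule eventually_conj)
      then obtain s where "(fst y, s) \<in> S" "0 < s" "s < e"
        using eventually_happens[of _ "at_right (0::real)"] by auto
      then have "\<phi> (fst y, s) \<le> \<phi> y" "\<phi> (fst y, 0) < \<phi> (fst y, s)"
        using S(3) y(2) e(2)[of s] by (auto simp: closed_half_plane_def subset_iff)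
      then show False using s0 by (metis not_le prod.collapse)
    qed
  qed
  then show ?thesis using le[of y] y(1) y(2)[OF y0] by (meson IntI order_trans)
qed

lemma closed_closed_half_plane: "closed closed_half_plane"
  unfolding closed_half_plane_def by (intro closed_Collect_le continuous_intros)

text \<open>A Phragmen-Lindelof argument. Outside a small disc around \<open>(p, 0)\<close> the function \<open>w\<close> is perturbed
  by \<open>\<epsilon>\<close> times the harmonic function
  \<open>ln \<bar>y - 1\<bar> + ln \<bar>y + 1\<bar> - 3 ln \<bar>y - p\<bar>\<close>, which satisfies the Neumann condition and tends to
  \<open>-\<infinity>\<close> at infinity and at \<open>\<plusminus>1\<close>, where no normal derivative is known. A further term
  \<open>\<eta> (y\<^sub>2 + y\<^sub>2\<^sup>2)\<close> makes the Laplacian and the boundary derivative strictly positive. The maximum is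
  then attained on the small half circle, where \<open>w\<close> is close to its value at \<open>(p, 0)\<close>. Comparing
  with a point value on the boundary replaces the strong maximum principle and Hopf's lemma.\<close>

lemma neumann_value_le_boundary_value:
  fixes w :: "real \<times> real \<Rightarrow> real"
  assumes cont: "continuous_on closed_half_plane w"
    and harm: "\<And>y. snd y > 0 \<Longrightarrow> has_laplacian w 0 y"
    and neu: "\<And>x. \<bar>x\<bar> \<noteq> 1 \<Longrightarrow> ((\<lambda>t. w (x, t)) has_real_derivative 0) (at 0 within {0..})"
    and bound: "\<And>y. snd y \<ge> 0 \<Longrightarrow> w y \<le> M0"
    and y0: "snd y0 \<ge> 0" "y0 \<noteq> (1, 0)" "y0 \<noteq> (-1, 0)"
  shows "w y0 \<le> w (p, 0)"
proof (cases "y0 = (p, 0)")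
  case False
  show ?thesis
  proof (rule field_le_epsilon)
    fix \<kappa> :: real assume \<kappa>: "\<kappa> > 0"
    define M where "M = w (p, 0) + \<kappa>"
    have "(p, 0) \<in> closed_half_plane" by (simp add: closed_half_plane_def)
    then obtain R' where R': "R' > 0" "\<And>z. snd z \<ge> 0 \<Longrightarrow> norm (z - (p,0)) < R' \<Longrightarrow> \<bar>w z - w (p, 0)\<bar> < \<kappa>"
      using cont \<kappa> unfolding continuous_on_iff dist_norm closed_half_plane_def real_norm_def
      by blast
    define R where "R = min (R' / 2) (norm (y0 - (p, 0)))"
    have R: "R > 0" "R < R'" "R \<le> norm (y0 - (p, 0))" using R' False by (auto simp: R_def)
    \<comment> \<open>both \<open>\<plusminus>1\<close> are within \<open>1 + \<bar>p\<bar>\<close> of \<open>p\<close>, so \<open>C\<close> bounds the ratio of distances outside the disc\<close>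
    define C where "C = 1 + (1 + \<bar>p\<bar>) / R"
    have C: "C > 0" using R by (auto simp: C_def intro!: add_pos_nonneg)
    define \<beta> :: "real \<times> real \<Rightarrow> real" where
      "\<beta> y = norm (y - (1, 0)) * norm (y - (-1, 0)) / norm (y - (p, 0)) ^ 3" for y
    have near: "norm (y - (q, 0)) \<le> C * norm (y - (p, 0))" if "norm (y - (p, 0)) \<ge> R" "\<bar>q\<bar> = 1"
      for y :: "real \<times> real" and q
    proof -
      have "norm (y - (q, 0)) \<le> norm (y - (p, 0)) + norm ((p, 0) - (q, 0 :: real))"
        using norm_triangle_ineq[of "y - (p, 0)" "(p, 0) - (q, 0)"] unfolding diff_add_cancel add_diff_eq .
      also have "norm ((p, 0) - (q, 0 :: real)) \<le> 1 + \<bar>p\<bar>"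
        using that(2) by (auto simp: norm_Pair)
      also have "1 + \<bar>p\<bar> \<le> (1 + \<bar>p\<bar>) / R * norm (y - (p, 0))"
        using that(1) R by (simp add: divide_simps mult_left_mono)
      finally show ?thesis by (simp add: C_def algebra_simps)
    qed
    have \<beta>_le: "\<beta> y \<le> C\<^sup>2 / norm (y - (p, 0))" if "norm (y - (p, 0)) \<ge> R" for y
    proof -
      define r where "r = norm (y - (p, 0))"
      have r: "r > 0" using that R unfolding r_def[symmetric] by linarith
      have "norm (y - (1, 0)) * norm (y - (-1, 0)) \<le> (C * r) * (C * r)"
        unfolding r_def using near[OF that] C by (intro mult_mono) auto
      then have "\<beta> y \<le> (C * r) * (C * r) / r ^ 3"
        unfolding \<beta>_def r_def[symmetric] using r by (intro divide_right_mono) auto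
      also have "\<dots> = C\<^sup>2 / r" using r by (simp add: field_simps power2_eq_square power3_eq_cube)
      finally show ?thesis by (simp add: r_def)
    qed
    have \<beta>_pos: "\<beta> y > 0 \<longleftrightarrow> y \<noteq> (1, 0) \<and> y \<noteq> (-1, 0)" if "norm (y - (p, 0)) \<ge> R" for y
    proof -
      have "norm (y - (p, 0)) ^ 3 > 0" using that R by (intro zero_less_power) linarith
      then show ?thesis unfolding \<beta>_def by (auto simp: zero_less_divide_iff zero_less_mult_iff)
    qed
    have ln_\<beta>: "ln (\<beta> y) = ln (norm (y - (1, 0))) + ln (norm (y - (-1, 0))) + (-3) * ln (norm (y - (p, 0)))"
      if "norm (y - (p, 0)) \<ge> R" "\<beta> y > 0" for y
    proof -
      have "norm (y - (1, 0)) > 0" "norm (y - (-1, 0)) > 0" "norm (y - (p, 0)) > 0"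
        using \<beta>_pos[OF that(1)] that R by auto
      then show ?thesis unfolding \<beta>_def
        by (simp add: ln_div ln_mult ln_realpow)
    qed
    define K0 where "K0 = ln (C\<^sup>2 / R)"
    have K0: "ln (\<beta> y) \<le> K0" if "norm (y - (p, 0)) \<ge> R" "\<beta> y > 0" for y
      unfolding K0_def
    proof (rule ln_mono)
      have "\<beta> y \<le> C\<^sup>2 / norm (y - (p, 0))" by (rule \<beta>_le[OF that(1)])
      also have "\<dots> \<le> C\<^sup>2 / R" using that R
        by (intro divide_left_mono mult_pos_pos) (auto intro: less_le_trans[OF R(1)])
      finally show "\<beta> y \<le> C\<^sup>2 / R" .
    qed (use that in auto)
    have \<beta>0: "\<beta> y0 > 0" using \<beta>_pos y0 R by blast
    have step: "w y0 + \<epsilon> * (ln (\<beta> y0) - K0) \<le> M" if \<epsilon>: "\<epsilon> > 0" for \<epsilon>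
    proof -
      \<comment> \<open>\<open>N\<close> is so large that \<open>y0\<close> lies in the region and that \<open>- \<epsilon> N\<close> outweighs the bound \<open>M0\<close>\<close>
      define N where "N = max (- ln (\<beta> y0)) (- K0 + max 0 (M0 - M) / \<epsilon>)"
      have N1: "exp (- N) \<le> \<beta> y0"
      proof -
        have "exp (- N) \<le> exp (ln (\<beta> y0))" by (simp add: N_def)
        then show ?thesis using \<beta>0 by simp
      qed
      have "\<epsilon> * (max 0 (M0 - M) / \<epsilon>) \<le> \<epsilon> * (N + K0)"
        using \<epsilon> by (intro mult_left_mono) (auto simp: N_def)
      then have N2: "M0 + \<epsilon> * (- N - K0) \<le> M"
        using \<epsilon> by (simp add: algebra_simps max_def split: if_splits)
      define K where "K = closed_half_plane \<inter> {y. norm (y - (p, 0)) \<ge> R} \<inter> {y. \<beta> y \<ge> exp (- N)}"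
      define B where "B = {y. norm (y - (p, 0)) = R \<or> \<beta> y = exp (- N)}"
      have cont\<beta>: "continuous_on {y. norm (y - (p, 0)) \<ge> R} \<beta>"
        unfolding \<beta>_def using R by (intro continuous_intros) auto
      have clR: "closed {y :: real \<times> real. norm (y - (p, 0)) \<ge> R}"
        by (intro closed_Collect_le continuous_intros)
      have "closed ({y. norm (y - (p, 0)) \<ge> R} \<inter> \<beta> -` {exp (- N)..})"
        by (rule continuous_closed_preimage[OF cont\<beta> clR]) auto
      then have "closed (closed_half_plane \<inter> ({y. norm (y - (p, 0)) \<ge> R} \<inter> \<beta> -` {exp (- N)..}))"
        using closed_closed_half_plane by (rule closed_Int[rotated])
      moreover have "closed_half_plane \<inter> ({y. norm (y - (p, 0)) \<ge> R} \<inter> \<beta> -` {exp (- N)..}) = K"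
        by (auto simp: K_def)
      ultimately have clK: "closed K" by simp
      have Kle: "norm (y - (p, 0)) \<le> C\<^sup>2 * exp N" if "y \<in> K" for y
      proof -
        have r: "norm (y - (p, 0)) \<ge> R" "exp (- N) \<le> \<beta> y" using that by (auto simp: K_def)
        then have "exp (- N) \<le> C\<^sup>2 / norm (y - (p, 0))" using \<beta>_le by fastforce
        moreover have "norm (y - (p, 0)) > 0" using r R by linarith
        ultimately have "norm (y - (p, 0)) * exp (- N) \<le> C\<^sup>2" by (simp add: field_simps)
        then show ?thesis by (simp add: exp_minus divide_simps)
      qed
      have bK: "bounded K"
      proof (rule boundedI)
        fix y assume "y \<in> K"
        have "norm y \<le> norm (y - (p, 0)) + norm (p, 0 :: real)"
          by (metis diff_add_cancel norm_triangle_ineq)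
        then show "norm y \<le> C\<^sup>2 * exp N + norm (p, 0 :: real)" using Kle[OF \<open>y \<in> K\<close>] by linarith
      qed
      have cK: "compact K" using clK bK compact_eq_bounded_closed by blast
      have "bounded ((\<lambda>y. snd y + (snd y)\<^sup>2) ` K)"
        by (intro compact_imp_bounded compact_continuous_image continuous_intros cK)
      then obtain C1 where C1: "\<And>y. y \<in> K \<Longrightarrow> \<bar>snd y + (snd y)\<^sup>2\<bar> \<le> C1"
        unfolding bounded_iff by auto
      have \<beta>K: "\<beta> y > 0" if "y \<in> K" for y using that by (auto simp: K_def intro: less_le_trans[OF exp_gt_zero])
      have "w y0 + \<epsilon> * (ln (\<beta> y0) - K0) + \<eta> * (snd y0 + (snd y0)\<^sup>2) \<le> M + \<eta> * C1" if \<eta>: "\<eta> > 0" for \<eta>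
      proof -
        define \<phi> where "\<phi> y = w y + \<epsilon> * (ln (norm (y - (1, 0))) + ln (norm (y - (-1, 0))) + (-3) * ln (norm (y - (p, 0))) + (- K0)) + \<eta> * (snd y + (snd y)\<^sup>2)" for y
        have \<phi>eq: "\<phi> y = w y + \<epsilon> * (ln (\<beta> y) - K0) + \<eta> * (snd y + (snd y)\<^sup>2)" if "y \<in> K" for y
          using ln_\<beta>[of y] \<beta>K[OF that] that by (simp add: \<phi>_def K_def)
        have "\<phi> y0 \<le> M + \<eta> * C1"
        proof (rule mixed_weak_max_principle[OF cK])
          show "continuous_on K \<phi>"
            unfolding \<phi>_def
          proof (intro continuous_intros)
            show "continuous_on K w" using cont by (rule continuous_on_subset) (auto simp: K_def)
            show "\<forall>x\<in>K. norm (x - (1, 0)) \<noteq> 0" "\<forall>x\<in>K. norm (x - (- 1, 0)) \<noteq> 0" "\<forall>x\<in>K. norm (x - (p, 0)) \<noteq> 0"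
              using \<beta>K \<beta>_pos R by (auto simp: K_def)
          qed
          show "\<exists>c>0. has_laplacian \<phi> c y" if "y \<in> K - B" "snd y > 0" for y
          proof -
            have "has_laplacian \<phi> (0 + \<epsilon> * (0 + 0 + (-3) * 0 + 0) + \<eta> * 2) y"
              unfolding \<phi>_def using that
              by (intro has_laplacian_add has_laplacian_cmult has_laplacian_const has_laplacian_ln_norm
                  has_laplacian_vertical harm) auto
            then show ?thesis using \<eta> by (intro exI[of _ "\<eta> * 2"]) simp
          qed
          show "\<exists>d>0. ((\<lambda>t. \<phi> (fst y, t)) has_real_derivative d) (at 0 within {0..})"
            if "y \<in> K - B" "snd y = 0" for y
          proof -
            have ne: "y \<noteq> (1, 0)" "y \<noteq> (-1, 0)" "y \<noteq> (p, 0)"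
              using that \<beta>_pos[of y] \<beta>K[of y] R by (auto simp: K_def)
            then have ne': "fst y \<noteq> 1" "fst y \<noteq> -1" "fst y \<noteq> p" "\<bar>fst y\<bar> \<noteq> 1" using that(2)
              by (auto simp: prod_eq_iff)
            have "((\<lambda>t. \<phi> (fst y, t)) has_real_derivative 0 + \<epsilon> * (0 + 0 + (-3) * 0 + 0) + \<eta> * 1) (at 0 within {0..})"
              unfolding \<phi>_def
              apply (intro DERIV_add DERIV_cmult vertical_derivative_ln_norm neu ne' DERIV_const)
              by (auto intro!: derivative_eq_intros)
            then show ?thesis using \<eta> by (intro exI[of _ \<eta>]) simp
          qed
          show "snd y \<ge> 0 \<and> (\<exists>S. open S \<and> y \<in> S \<and> S \<inter> closed_half_plane \<subseteq> K)" if "y \<in> K - B" for y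
          proof -
            have y: "y \<in> {y. norm (y - (p, 0)) > R}" "\<beta> y > exp (- N)" using that by (auto simp: K_def B_def)
            have o: "open {y :: real \<times> real. norm (y - (p, 0)) > R}"
              by (intro open_Collect_less continuous_intros)
            have "continuous_on {y. norm (y - (p, 0)) > R} \<beta>"
              using cont\<beta> by (rule continuous_on_subset) auto
            then have "open ({y. norm (y - (p, 0)) > R} \<inter> \<beta> -` {exp (- N)<..})"
              by (rule continuous_open_preimage[OF _ o]) auto
            moreover have "({y. norm (y - (p, 0)) > R} \<inter> \<beta> -` {exp (- N)<..}) \<inter> closed_half_plane \<subseteq> K"
              by (auto simp: K_def)
            ultimately show ?thesis using y that
              by (intro conjI exI[of _ "{y. norm (y - (p, 0)) > R} \<inter> \<beta> -` {exp (- N)<..}"])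
                 (auto simp: K_def closed_half_plane_def)
          qed
          show "\<phi> y \<le> M + \<eta> * C1" if "y \<in> K \<inter> B" for y
          proof -
            have yK: "y \<in> K" "snd y \<ge> 0" using that by (auto simp: K_def closed_half_plane_def)
            have "\<eta> * (snd y + (snd y)\<^sup>2) \<le> \<eta> * C1"
              using C1[OF yK(1)] \<eta> by (intro mult_left_mono) auto
            moreover have "w y + \<epsilon> * (ln (\<beta> y) - K0) \<le> M"
            proof (cases "norm (y - (p, 0)) = R")
              case True
              have "w y \<le> M" using R'(2)[OF yK(2)] True R by (simp add: M_def)
              moreover have "\<epsilon> * (ln (\<beta> y) - K0) \<le> 0"
                using K0[of y] \<beta>K[OF yK(1)] True \<epsilon> by (simp add: mult_le_0_iff)
              ultimately show ?thesis by linarith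
            next
              case False
              then have "ln (\<beta> y) = - N" using that by (simp add: B_def)
              then show ?thesis using N2 bound[OF yK(2)] by simp
            qed
            ultimately show ?thesis using \<phi>eq[OF yK(1)] by linarith
          qed
          show "y0 \<in> K" using y0 R N1 by (auto simp: K_def closed_half_plane_def)
        qed
        then show ?thesis using \<phi>eq[of y0] y0 R N1 by (auto simp: K_def closed_half_plane_def)
      qed
      then have le: "w y0 + \<epsilon> * (ln (\<beta> y0) - K0) \<le> M + \<eta> * C1" if "\<eta> > 0" for \<eta>
        using that y0(1) by (smt (verit, best) mult_nonneg_nonneg zero_le_power2)
      have "((\<lambda>\<eta>. M + \<eta> * C1) \<longlongrightarrow> M + 0 * C1) (at_right 0)"
        by (intro tendsto_intros)
      then have "w y0 + \<epsilon> * (ln (\<beta> y0) - K0) \<le> M + 0 * C1"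
        by (rule tendsto_lowerbound)
           (auto simp: eventually_at_right_less intro!: le eventually_mono[OF eventually_at_right_less[of "0::real"]])
      then show ?thesis by simp
    qed
    have "((\<lambda>\<epsilon>. w y0 + \<epsilon> * (ln (\<beta> y0) - K0)) \<longlongrightarrow> w y0 + 0 * (ln (\<beta> y0) - K0)) (at_right 0)"
      by (intro tendsto_intros)
    then have "w y0 + 0 * (ln (\<beta> y0) - K0) \<le> M"
      by (rule tendsto_upperbound)
         (auto intro!: step eventually_mono[OF eventually_at_right_less[of "0::real"]])
    then show "w y0 \<le> w (p, 0) + \<kappa>" by (simp add: M_def)
  qed
qed simp

section \<open>A Liouville theorem for the Neumann problem\<close>

lemma eventually_infinity_in_half_plane:
  "eventually P infinity_in_half_plane \<longleftrightarrow> (\<exists>b. \<forall>y. norm y \<ge> b \<and> snd y \<ge> 0 \<longrightarrow> P y)"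
  by (auto simp: infinity_in_half_plane_def eventually_inf_principal eventually_at_infinity closed_half_plane_def)

lemma eventually_infinity_in_half_planeE:
  assumes "eventually P infinity_in_half_plane"
  obtains b where "b \<ge> k" "\<And>y. norm y \<ge> b \<Longrightarrow> snd y \<ge> 0 \<Longrightarrow> P y"
proof -
  obtain b where b: "\<And>y. norm y \<ge> b \<Longrightarrow> snd y \<ge> 0 \<Longrightarrow> P y"
    using assms unfolding eventually_infinity_in_half_plane by blast
  show ?thesis by (rule that[of "max b k"]) (use b in auto)
qed

lemma infinity_in_half_plane_neq_bot [simp]: "infinity_in_half_plane \<noteq> bot"
proof
  assume "infinity_in_half_plane = bot"
  then have "eventually (\<lambda>_. False) infinity_in_half_plane" by simp
  then obtain b where "\<forall>y :: real \<times> real. norm y \<ge> b \<and> snd y \<ge> 0 \<longrightarrow> False"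
    unfolding eventually_infinity_in_half_plane by blast
  from this[rule_format, of "(\<bar>b\<bar>, 0)"] show False by (simp add: norm_Pair abs_ge_self)
qed

lemma bigo_one_iff:
  fixes f :: "'a \<Rightarrow> real"
  shows "f \<in> O[F](\<lambda>_. 1) \<longleftrightarrow> (\<exists>C. eventually (\<lambda>y. \<bar>f y\<bar> \<le> C) F)"
proof
  assume "f \<in> O[F](\<lambda>_. 1)"
  then show "\<exists>C. eventually (\<lambda>y. \<bar>f y\<bar> \<le> C) F" by (elim landau_o.bigE) auto
next
  assume "\<exists>C. eventually (\<lambda>y. \<bar>f y\<bar> \<le> C) F"
  then obtain C where "eventually (\<lambda>y. \<bar>f y\<bar> \<le> C) F" by blast
  then show "f \<in> O[F](\<lambda>_. 1)" by (intro bigoI[of _ C]) auto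
qed

lemma tendsto_imp_bigo_one:
  fixes f :: "'a \<Rightarrow> real"
  assumes "(f \<longlongrightarrow> c) F"
  shows "f \<in> O[F](\<lambda>_. 1)"
  unfolding bigo_one_iff
proof
  have "\<forall>\<^sub>F y in F. dist (f y) c < 1" using assms by (rule tendstoD) simp
  then show "\<forall>\<^sub>F y in F. \<bar>f y\<bar> \<le> \<bar>c\<bar> + 1" 
    by eventually_elim (unfold dist_real_def, linarith)
qed

text \<open>Since any two boundary values other than those at \<open>\<plusminus>1\<close> bound each other, \<open>w\<close> is constant on the
  boundary line, which a genuine logarithmic decay would contradict.\<close>

lemma nonpositive_log_growth_imp_le:
  fixes w :: "real \<times> real \<Rightarrow> real"
  assumes cont: "continuous_on closed_half_plane w"
    and harm: "\<And>y. snd y > 0 \<Longrightarrow> has_laplacian w 0 y"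
    and neu: "\<And>x. \<bar>x\<bar> \<noteq> 1 \<Longrightarrow> ((\<lambda>t. w (x, t)) has_real_derivative 0) (at 0 within {0..})"
    and growth: "(\<lambda>y. w y - a * ln (norm y)) \<in> O[infinity_in_half_plane](\<lambda>_. 1)"
    and a: "a \<le> 0"
  shows "a = 0" and "\<And>y. snd y \<ge> 0 \<Longrightarrow> y \<noteq> (1, 0) \<Longrightarrow> y \<noteq> (-1, 0) \<Longrightarrow> w y \<le> w (0, 0)"
proof -
  obtain C where "eventually (\<lambda>y. \<bar>w y - a * ln (norm y)\<bar> \<le> C) infinity_in_half_plane"
    using growth unfolding bigo_one_iff by blast
  from eventually_infinity_in_half_planeE[OF this, of 1] obtain b
    where b: "b \<ge> 1" "\<And>y. norm y \<ge> b \<Longrightarrow> snd y \<ge> 0 \<Longrightarrow> \<bar>w y - a * ln (norm y)\<bar> \<le> C"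
    by blast
  have "compact (closed_half_plane \<inter> cball 0 b)"
    using closed_closed_half_plane by (intro closed_Int_compact) auto
  then have "bounded (w ` (closed_half_plane \<inter> cball 0 b))"
    by (intro compact_imp_bounded compact_continuous_image continuous_on_subset[OF cont]) auto
  then obtain C' where C': "\<And>y. snd y \<ge> 0 \<Longrightarrow> norm y \<le> b \<Longrightarrow> \<bar>w y\<bar> \<le> C'"
    unfolding bounded_iff by (fastforce simp: closed_half_plane_def)
  have le: "w y \<le> max C C'" if "snd y \<ge> 0" for y
  proof (cases "norm y \<le> b")
    case True then show ?thesis using C'[OF that True] by simp
  next
    case False
    then have "a * ln (norm y) \<le> 0" using b(1) a by (intro mult_nonpos_nonneg) auto
    then show ?thesis using b(2)[of y] False that by simp
  qed
  note * = neumann_value_le_boundary_value[OF cont harm neu le]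
  show "\<And>y. snd y \<ge> 0 \<Longrightarrow> y \<noteq> (1, 0) \<Longrightarrow> y \<noteq> (-1, 0) \<Longrightarrow> w y \<le> w (0, 0)"
    using * by blast
  have const: "w (x, 0) = w (0, 0)" if "\<bar>x\<bar> \<noteq> 1" for x
    using *[of "(x, 0)" 0] *[of "(0, 0)" x] that by (intro antisym) auto
  show "a = 0"
  proof (rule ccontr)
    assume "a \<noteq> 0"
    define L where "L = (C + \<bar>w (0, 0)\<bar> + 1) / \<bar>a\<bar>"
    define x where "x = max (b + 1) (exp L)"
    have x: "x > 1" "x \<ge> b" "ln x \<ge> L"
      using b(1) by (auto simp: x_def ln_ge_iff)
    have "\<bar>w (x, 0) - a * ln (norm (x, 0 :: real))\<bar> \<le> C"
      using x by (intro b(2)) (auto simp: norm_Pair)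
    then have "\<bar>w (0, 0) - a * ln x\<bar> \<le> C" using const[of x] x by (simp add: norm_Pair)
    moreover have "\<bar>a\<bar> * L \<le> \<bar>a\<bar> * ln x" using x by (intro mult_left_mono) auto
    moreover have "\<bar>a\<bar> * L = C + \<bar>w (0, 0)\<bar> + 1" using \<open>a \<noteq> 0\<close> by (simp add: L_def)
    moreover have "\<bar>a\<bar> * ln x = - (a * ln x)" using a by simp
    ultimately show False by linarith
  qed
qed

theorem neumann_liouville:
  fixes w :: "real \<times> real \<Rightarrow> real"
  assumes cont: "continuous_on closed_half_plane w"
    and harm: "\<And>y. snd y > 0 \<Longrightarrow> has_laplacian w 0 y"
    and neu: "\<And>x. \<bar>x\<bar> \<noteq> 1 \<Longrightarrow> ((\<lambda>t. w (x, t)) has_real_derivative 0) (at 0 within {0..})"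
    and growth: "(\<lambda>y. w y - a * ln (norm y)) \<in> O[infinity_in_half_plane](\<lambda>_. 1)"
  shows "a = 0" and "\<And>y. snd y \<ge> 0 \<Longrightarrow> y \<noteq> (1, 0) \<Longrightarrow> y \<noteq> (-1, 0) \<Longrightarrow> w y = w (0, 0)"
proof -
  define v where "v y = - 1 * w y" for y
  have "continuous_on closed_half_plane v"
    unfolding v_def by (intro continuous_intros cont)
  moreover have "has_laplacian v 0 y" if "snd y > 0" for y
    using has_laplacian_cmult[OF harm[OF that], of "-1"] unfolding v_def by simp
  moreover have "((\<lambda>t. v (x, t)) has_real_derivative 0) (at 0 within {0..})" if "\<bar>x\<bar> \<noteq> 1" for x
    using DERIV_cmult[OF neu[OF that], of "-1"] unfolding v_def by simp
  moreover have "(\<lambda>y. v y - (- a) * ln (norm y)) \<in> O[infinity_in_half_plane](\<lambda>_. 1)"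
    using growth unfolding v_def bigo_one_iff by (simp add: abs_minus_commute)
  ultimately have v: "- a \<le> 0 \<Longrightarrow> - a = 0"
    "\<And>y. - a \<le> 0 \<Longrightarrow> snd y \<ge> 0 \<Longrightarrow> y \<noteq> (1, 0) \<Longrightarrow> y \<noteq> (-1, 0) \<Longrightarrow> v y \<le> v (0, 0)"
    using nonpositive_log_growth_imp_le[of v "- a"] by blast+
  note w = nonpositive_log_growth_imp_le[OF cont harm neu growth]
  show a: "a = 0" using v(1) w(1) by (cases "a \<le> 0") auto
  fix y :: "real \<times> real" assume "snd y \<ge> 0" "y \<noteq> (1, 0)" "y \<noteq> (-1, 0)"
  then show "w y = w (0, 0)" using v(2)[of y] w(2)[of y] a by (simp add: v_def)
qed

lemma open_half_plane: "open half_plane"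
  unfolding half_plane_def by (intro open_Collect_less continuous_intros)

lemma slice1_has_derivative:
  fixes u :: "real \<times> real \<Rightarrow> real"
  assumes "u differentiable (at y)"
  shows "((\<lambda>t. u (t, snd y)) has_real_derivative partial1 u y) (at (fst y))"
proof -
  have "(\<lambda>t. u (t, snd y)) differentiable (at (fst y))"
    using differentiable_compose[of u "\<lambda>t. (t, snd y)" "fst y" UNIV] assms by simp
  then show ?thesis unfolding partial1_def
    using DERIV_deriv_iff_real_differentiable by blast
qed

lemma slice2_has_derivative:
  fixes u :: "real \<times> real \<Rightarrow> real"
  assumes "u differentiable (at y)"
  shows "((\<lambda>t. u (fst y, t)) has_real_derivative partial2 u y) (at (snd y))"
proof -
  have "(\<lambda>t. u (fst y, t)) differentiable (at (snd y))"
    using differentiable_compose[of u "\<lambda>t. (fst y, t)" "snd y" UNIV] assms by simp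
  then show ?thesis unfolding partial2_def
    using DERIV_deriv_iff_real_differentiable by blast
qed

lemma eventually_in_half_plane:
  assumes "y \<in> half_plane"
  shows "\<forall>\<^sub>F t in nhds (fst y). (t, snd y) \<in> half_plane"
    and "\<forall>\<^sub>F t in nhds (snd y). (fst y, t) \<in> half_plane"
  using assms eventually_nhds_in_open[OF open_greaterThan, of "snd y" 0]
  by (auto simp: half_plane_def)

lemma harmonic_on_imp_has_laplacian:
  assumes "harmonic_on u half_plane" "y \<in> half_plane"
  shows "has_laplacian u 0 y"
proof -
  have d: "u differentiable (at z)" "partial1 u differentiable (at z)" "partial2 u differentiable (at z)"
    if "z \<in> half_plane" for z
    using assms(1) that open_half_plane
    by (auto simp: harmonic_on_def differentiable_on_eq_differentiable_at)
  show ?thesis unfolding has_laplacian_def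
  proof (intro exI conjI)
    show "\<forall>\<^sub>F t in nhds (fst y). ((\<lambda>s. u (s, snd y)) has_real_derivative partial1 u (t, snd y)) (at t)"
      using eventually_in_half_plane(1)[OF assms(2)]
      by eventually_elim (use slice1_has_derivative[OF d(1)] in fastforce)
    show "\<forall>\<^sub>F t in nhds (snd y). ((\<lambda>s. u (fst y, s)) has_real_derivative partial2 u (fst y, t)) (at t)"
      using eventually_in_half_plane(2)[OF assms(2)]
      by eventually_elim (use slice2_has_derivative[OF d(1)] in fastforce)
    show "((\<lambda>t. partial1 u (t, snd y)) has_real_derivative partial1 (partial1 u) y) (at (fst y))"
      by (rule slice1_has_derivative[OF d(2)[OF assms(2)]])
    show "((\<lambda>t. partial2 u (fst y, t)) has_real_derivative partial2 (partial2 u) y) (at (snd y))"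
      by (rule slice2_has_derivative[OF d(3)[OF assms(2)]])
    show "0 = partial1 (partial1 u) y + partial2 (partial2 u) y"
      using assms by (auto simp: harmonic_on_def)
  qed
qed

abbreviation upper :: "complex set" where "upper \<equiv> {z. Im z > 0}"

definition re_part :: "(complex \<Rightarrow> complex) \<Rightarrow> real \<times> real \<Rightarrow> real" where
  "re_part F y = Re (F (Complex (fst y) (snd y)))"

lemma open_upper: "open upper" by (simp add: open_halfspace_Im_gt)

lemma Complex_pair_eq: "Complex (fst y) (snd y) = complex_of_real (fst y) + \<i> * complex_of_real (snd y)"
  by (simp add: complex_eq_iff)

text \<open>The Cauchy-Riemann equations: the vertical derivative is the real part of \<open>\<i> F'\<close>.
  Both partial derivatives are thus again real parts of holomorphic functions.\<close>

lemma re_part_differentiable: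
  assumes "F holomorphic_on upper" "y \<in> half_plane"
  shows "re_part F differentiable (at y)"
    and "partial1 (re_part F) y = re_part (deriv F) y"
    and "partial2 (re_part F) y = re_part (\<lambda>z. \<i> * deriv F z) y"
proof -
  define z where "z = Complex (fst y) (snd y)"
  have z: "z \<in> upper" using assms(2) by (simp add: z_def half_plane_def)
  have F: "(F has_field_derivative deriv F z) (at z)"
    by (rule holomorphic_derivI[OF assms(1) open_upper z])
  define c :: "real \<times> real \<Rightarrow> complex" where "c y = complex_of_real (fst y) + \<i> * complex_of_real (snd y)" for y
  have c: "c y = z" by (simp add: c_def z_def Complex_pair_eq)
  have dc: "(c has_derivative c) (at y)"
    unfolding c_def by (auto intro!: derivative_eq_intros)
  have "((\<lambda>y. F (c y)) has_derivative (\<lambda>h. deriv F z * c h)) (at y)"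
    using has_derivative_compose[OF dc, of F "\<lambda>h. deriv F z * h"] F c
    unfolding has_field_derivative_def by simp
  then have D: "(re_part F has_derivative (\<lambda>h. Re (deriv F z * c h))) (at y)"
    unfolding re_part_def Complex_pair_eq c_def[symmetric]
    by (rule has_derivative_Re)
  then show diff: "re_part F differentiable (at y)" unfolding differentiable_def by blast
  have "((\<lambda>t. (t, snd y)) has_derivative (\<lambda>h. (h, 0))) (at (fst y))"
    by (auto intro!: derivative_eq_intros)
  then have "((\<lambda>t. re_part F (t, snd y)) has_derivative (\<lambda>h. Re (deriv F z * c (h, 0)))) (at (fst y))"
    using has_derivative_compose[of "\<lambda>t. (t, snd y)" "\<lambda>h. (h, 0)" "fst y" UNIV "re_part F"] D by simp
  moreover have "(\<lambda>h. Re (deriv F z * c (h, 0))) = (*) (Re (deriv F z))"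
    by (auto simp: c_def)
  ultimately have "((\<lambda>t. re_part F (t, snd y)) has_real_derivative Re (deriv F z)) (at (fst y))"
    unfolding has_field_derivative_def by simp
  then show "partial1 (re_part F) y = re_part (deriv F) y"
    unfolding partial1_def by (simp add: DERIV_imp_deriv re_part_def z_def)
  have "((\<lambda>t. (fst y, t)) has_derivative (\<lambda>h. (0, h))) (at (snd y))"
    by (auto intro!: derivative_eq_intros)
  then have "((\<lambda>t. re_part F (fst y, t)) has_derivative (\<lambda>h. Re (deriv F z * c (0, h)))) (at (snd y))"
    using has_derivative_compose[of "\<lambda>t. (fst y, t)" "\<lambda>h. (0, h)" "snd y" UNIV "re_part F"] D by simp
  moreover have "(\<lambda>h. Re (deriv F z * c (0, h))) = (*) (Re (\<i> * deriv F z))"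
    by (auto simp: c_def)
  ultimately have "((\<lambda>t. re_part F (fst y, t)) has_real_derivative Re (\<i> * deriv F z)) (at (snd y))"
    unfolding has_field_derivative_def by simp
  then show "partial2 (re_part F) y = re_part (\<lambda>z. \<i> * deriv F z) y"
    unfolding partial2_def by (simp add: DERIV_imp_deriv re_part_def z_def)
qed

lemma partial1_cong_half_plane:
  assumes "\<And>z. z \<in> half_plane \<Longrightarrow> v z = v' z" "y \<in> half_plane"
  shows "partial1 v y = partial1 v' y"
  unfolding partial1_def
  by (rule deriv_cong_ev) (use eventually_in_half_plane(1)[OF assms(2)] assms(1) in \<open>auto elim: eventually_mono\<close>)

lemma partial2_cong_half_plane:
  assumes "\<And>z. z \<in> half_plane \<Longrightarrow> v z = v' z" "y \<in> half_plane"
  shows "partial2 v y = partial2 v' y"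
  unfolding partial2_def
  by (rule deriv_cong_ev) (use eventually_in_half_plane(2)[OF assms(2)] assms(1) in \<open>auto elim: eventually_mono\<close>)

lemma differentiable_on_cong_half_plane:
  fixes v v' :: "real \<times> real \<Rightarrow> real"
  assumes "\<And>z. z \<in> half_plane \<Longrightarrow> v z = v' z"
  shows "v differentiable_on half_plane \<longleftrightarrow> v' differentiable_on half_plane"
proof -
  have "g differentiable (at x within half_plane)"
    if "x \<in> half_plane" "f differentiable (at x within half_plane)"
      "\<And>z. z \<in> half_plane \<Longrightarrow> f z = g z" for f g :: "real \<times> real \<Rightarrow> real" and x
    by (rule differentiable_transform_within[OF that(2) zero_less_one that(1)]) (use that(3) in simp)
  from this[of _ v v'] this[of _ v' v] show ?thesis
    unfolding differentiable_on_def using assms by auto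
qed

lemma re_part_differentiable_on:
  assumes "F holomorphic_on upper"
  shows "re_part F differentiable_on half_plane"
  using re_part_differentiable(1)[OF assms] by (auto simp: differentiable_on_def intro: differentiable_at_withinI)

theorem harmonic_on_re_part:
  assumes F: "F holomorphic_on upper"
    and v: "\<And>y. y \<in> half_plane \<Longrightarrow> v y = re_part F y"
  shows "harmonic_on v half_plane"
proof -
  have F': "deriv F holomorphic_on upper" by (rule holomorphic_deriv[OF F open_upper])
  have iF': "(\<lambda>z. \<i> * deriv F z) holomorphic_on upper" by (intro holomorphic_intros F')
  have p1: "partial1 v y = re_part (deriv F) y" if "y \<in> half_plane" for y
    using partial1_cong_half_plane[of v "re_part F" y] v that re_part_differentiable(2)[OF F that] by simp
  have p2: "partial2 v y = re_part (\<lambda>z. \<i> * deriv F z) y" if "y \<in> half_plane" for y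
    using partial2_cong_half_plane[of v "re_part F" y] v that re_part_differentiable(3)[OF F that] by simp
  have d2: "deriv (\<lambda>z. \<i> * deriv F z) z = \<i> * deriv (deriv F) z" if "z \<in> upper" for z
    using holomorphic_derivI[OF F' open_upper that] by (intro DERIV_imp_deriv DERIV_cmult)
  have up: "Complex (fst y) (snd y) \<in> upper" if "y \<in> half_plane" for y
    using that by (simp add: half_plane_def)
  have p11: "partial1 (partial1 v) y = re_part (deriv (deriv F)) y" if "y \<in> half_plane" for y
    using partial1_cong_half_plane[OF p1 that] that re_part_differentiable(2)[OF F' that] by simp
  have p21: "partial2 (partial1 v) y = re_part (\<lambda>z. \<i> * deriv (deriv F) z) y" if "y \<in> half_plane" for y
    using partial2_cong_half_plane[OF p1 that] that re_part_differentiable(3)[OF F' that] by simp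
  have r: "re_part (deriv (\<lambda>z. \<i> * deriv F z)) y = re_part (\<lambda>z. \<i> * deriv (deriv F) z) y"
    if "y \<in> half_plane" for y
    by (simp add: re_part_def d2[OF up[OF that]])
  have p12: "partial1 (partial2 v) y = re_part (\<lambda>z. \<i> * deriv (deriv F) z) y" if "y \<in> half_plane" for y
    using partial1_cong_half_plane[of "partial2 v" "re_part (\<lambda>z. \<i> * deriv F z)", OF p2 that]
      re_part_differentiable(2)[OF iF' that] r[OF that] by simp
  have p22: "partial2 (partial2 v) y = re_part (\<lambda>z. - deriv (deriv F) z) y" if "y \<in> half_plane" for y
    using partial2_cong_half_plane[of "partial2 v" "re_part (\<lambda>z. \<i> * deriv F z)", OF p2 that]
      re_part_differentiable(3)[OF iF' that] d2[OF up[OF that]] by (simp add: re_part_def)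
  have F'': "deriv (deriv F) holomorphic_on upper" by (rule holomorphic_deriv[OF F' open_upper])
  have diff: "f differentiable_on half_plane"
    if "\<And>y. y \<in> half_plane \<Longrightarrow> f y = re_part G y" "G holomorphic_on upper" for f G
    using differentiable_on_cong_half_plane[of f "re_part G"] that re_part_differentiable_on[of G] by simp
  note cont = differentiable_imp_continuous_on[OF diff]
  show ?thesis unfolding harmonic_on_def
  proof (intro conjI ballI)
    show "v differentiable_on half_plane" by (rule diff[OF v F])
    show "partial1 v differentiable_on half_plane" by (rule diff[OF p1 F'])
    show "partial2 v differentiable_on half_plane" by (rule diff[OF p2 iF'])
    show "continuous_on half_plane (partial1 (partial1 v))" by (rule cont[OF p11 F''])
    show "continuous_on half_plane (partial2 (partial1 v))"
      by (rule cont[OF p21]) (assumption, intro holomorphic_intros F'')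
    show "continuous_on half_plane (partial1 (partial2 v))"
      by (rule cont[OF p12]) (assumption, intro holomorphic_intros F'')
    show "continuous_on half_plane (partial2 (partial2 v))"
      by (rule cont[OF p22]) (assumption, intro holomorphic_intros F'')
    show "partial1 (partial1 v) y + partial2 (partial2 v) y = 0" if "y \<in> half_plane" for y
      using p11[OF that] p22[OF that] by (simp add: re_part_def)
  qed
qed

section \<open>Integration over the segment\<close>

text \<open>Lebesgue measure on the open segment, as a finite measure of its own, so that bounded
  measurable functions are integrable and Fubini's theorem applies directly.\<close>

definition seg :: "real measure" where "seg = restrict_space lborel {-1<..<1}"

lemma space_seg [simp]: "space seg = {-1<..<1}"
  by (simp add: seg_def)

lemma borel_measurable_seg: "f \<in> borel_measurable borel \<Longrightarrow> f \<in> borel_measurable seg"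
  unfolding seg_def by (intro measurable_restrict_space1) simp

lemma ident_measurable_seg: "(\<lambda>x. x) \<in> borel_measurable seg"
  by (rule borel_measurable_seg) simp

lemma integrable_seg_iff: "integrable seg f \<longleftrightarrow> set_integrable lborel {-1<..<1} f"
  for f :: "real \<Rightarrow> 'a :: {banach, second_countable_topology}"
  unfolding seg_def set_integrable_def by (subst integrable_restrict_space) auto

lemma integral_seg: "integral\<^sup>L seg f = set_lebesgue_integral lborel {-1<..<1} f"
  for f :: "real \<Rightarrow> 'a :: {banach, second_countable_topology}"
  unfolding seg_def set_lebesgue_integral_def by (subst integral_restrict_space) auto

lemma emeasure_seg: "emeasure seg (space seg) = 2"
  unfolding seg_def by (subst emeasure_restrict_space) (auto simp: emeasure_lborel_Ioo)

interpretation seg: finite_measure seg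
  by (rule finite_measureI) (simp add: emeasure_seg[simplified])

interpretation seg2: pair_sigma_finite seg seg ..

lemma measure_seg [simp]: "measure seg {-1<..<1} = 2"
  using emeasure_seg by (simp add: measure_def)

lemma integral_seg_const: "integral\<^sup>L seg (\<lambda>_. c :: real) = 2 * c"
  using emeasure_seg by (simp add: measure_def)

lemma AE_seg_neq: "AE t in seg. t \<noteq> x"
  unfolding seg_def by (subst AE_restrict_space_iff) (auto intro: AE_mp[OF AE_lborel_singleton])

lemma continuous_integral_seg:
  fixes g :: "real \<Rightarrow> 'a :: euclidean_space"
  assumes "continuous_on {-1..1} g"
  shows "integrable seg g" "integral\<^sup>L seg g = integral {-1..1} g"
proof -
  have i: "set_integrable lborel {-1<..<1} g"
    by (rule set_integrable_subset[OF borel_integrable_atLeastAtMost'[OF assms]]) auto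
  then show "integrable seg g" by (simp add: integrable_seg_iff)
  show "integral\<^sup>L seg g = integral {-1..1} g"
    using set_borel_integral_eq_integral(2)[OF i] by (simp add: integral_seg integral_open_interval_real)
qed

text \<open>The exponent \<open>-3/4\<close> serves all estimates: \<open>\<bar>s\<bar> powr (-3/4)\<close> is integrable and dominates
  \<open>ln \<bar>s\<bar>\<close> near \<open>0\<close>, and its complement \<open>1/4\<close> to \<open>1\<close> is less than \<open>1/2\<close>, which makes the
  energy finite.\<close>

definition cut_power :: "real \<Rightarrow> real" where
  "cut_power s = indicator {-1<..<1} s * \<bar>s\<bar> powr (-3/4)"

lemma cut_power_integral: "integrable lborel cut_power" "integral\<^sup>L lborel cut_power = 8"
proof -
  define g where "g s = indicator {0<..<1} s * s powr (-3/4)" for s :: real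
  have t0: "((\<lambda>s::real. 4 * s powr (1/4)) \<longlongrightarrow> 4 * 0 powr (1/4)) (at_right 0)"
    by (intro tendsto_mult tendsto_const tendsto_powr' tendsto_ident_at)
       (auto intro!: eventually_mono[OF eventually_at_right_less[of "0::real"]])
  have t1: "((\<lambda>s::real. 4 * s powr (1/4)) \<longlongrightarrow> 4 * 1 powr (1/4)) (at_left 1)"
    by (intro tendsto_intros) auto
  have *: "set_integrable lborel (einterval (ereal 0) (ereal 1)) (\<lambda>s. s powr (-3/4))"
    "(LBINT s=ereal 0..ereal 1. s powr (-3/4)) = 4 - 0"
  proof -
    have d: "((\<lambda>s::real. 4 * s powr (1/4)) has_real_derivative x powr (-3/4)) (at x)" if "0 < x" for x
    proof -
      have "((\<lambda>s::real. 4 * s powr (1/4)) has_real_derivative 4 * ((1/4) * x powr (1/4 - 1))) (at x)"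
        by (intro DERIV_cmult has_real_derivative_powr that)
      then show ?thesis by simp
    qed
    have c: "isCont (\<lambda>s::real. s powr (-3/4)) x" if "0 < x" for x
      using that by (intro continuous_intros) auto
    have A: "(((\<lambda>s. 4 * s powr (1/4)) \<circ> real_of_ereal) \<longlongrightarrow> 0) (at_right (ereal 0))"
      using t0 by (simp add: ereal_tendsto_simps(2))
    have B: "(((\<lambda>s. 4 * s powr (1/4)) \<circ> real_of_ereal) \<longlongrightarrow> 4) (at_left (ereal 1))"
      using t1 by (simp add: ereal_tendsto_simps(1))
    note I = interval_integral_FTC_nonneg[of "ereal 0" "ereal 1", OF _ d c _ A B]
    show "set_integrable lborel (einterval (ereal 0) (ereal 1)) (\<lambda>s. s powr (-3/4))"
      by (rule I(1)) auto
    show "(LBINT s=ereal 0..ereal 1. s powr (-3/4)) = 4 - 0"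
      by (rule I(2)) auto
  qed
  have g: "integrable lborel g" "integral\<^sup>L lborel g = 4"
    using * unfolding g_def by (simp_all add: set_integrable_def interval_integral_to_infinity_eq
        interval_lebesgue_integral_def set_lebesgue_integral_def einterval_eq)
  have g': "integrable lborel (\<lambda>s. g (0 + (-1) * s))" "integral\<^sup>L lborel (\<lambda>s. g (0 + (-1) * s)) = 4"
    using lborel_integrable_real_affine[OF g(1), of "-1" 0] lborel_integral_real_affine[of "-1" g 0] g(2) by auto
  have k: "cut_power = (\<lambda>s. g s + g (0 + (-1) * s))"
    by (auto simp: cut_power_def g_def fun_eq_iff indicator_def)
  show "integrable lborel cut_power" unfolding k by (intro Bochner_Integration.integrable_add g g')
  show "integral\<^sup>L lborel cut_power = 8" unfolding k
    by (subst Bochner_Integration.integral_add) (use g g' in auto)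
qed

lemma power_interval:
  fixes a b x :: real
  assumes "a < b"
  shows "set_integrable lborel {a<..<b} (\<lambda>t. \<bar>x - t\<bar> powr (-3/4))"
    and "(LINT t:{a<..<b}|lborel. \<bar>x - t\<bar> powr (-3/4)) \<le> (b - a) + 8"
proof -
  have i: "integrable lborel (\<lambda>t. cut_power (x + (-1) * t))"
    by (rule lborel_integrable_real_affine[OF cut_power_integral(1)]) auto
  have v: "(\<integral>t. cut_power (x + (-1) * t) \<partial>lborel) = 8"
    using lborel_integral_real_affine[of "-1" cut_power x] cut_power_integral(2) by simp
  have le: "\<bar>x - t\<bar> powr (-3/4) \<le> 1 + cut_power (x - t)" for t
  proof (cases "\<bar>x - t\<bar> < 1")
    case True
    then show ?thesis by (simp add: cut_power_def abs_less_iff)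
  next
    case False
    then have "\<bar>x - t\<bar> powr (-3/4) \<le> \<bar>x - t\<bar> powr 0" by (intro powr_mono) auto
    also have "\<dots> \<le> 1 + cut_power (x - t)" by (auto simp: cut_power_def)
    finally show ?thesis .
  qed
  have k0: "cut_power s \<ge> 0" for s by (simp add: cut_power_def)
  have i1: "integrable lborel (\<lambda>t. indicator {a<..<b} t + cut_power (x + (-1) * t))"
    using assms by (intro Bochner_Integration.integrable_add i) (simp add: integrable_indicator_iff emeasure_lborel_Ioo)
  have pt: "indicator {a<..<b} t *\<^sub>R (\<bar>x - t\<bar> powr (-3/4)) \<le> indicator {a<..<b} t + cut_power (x + (-1) * t)" for t
    using le[of t] k0[of "x - t"] by (auto simp: indicator_def)
  show a: "set_integrable lborel {a<..<b} (\<lambda>t. \<bar>x - t\<bar> powr (-3/4))"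
    unfolding set_integrable_def
    by (rule Bochner_Integration.integrable_bound[OF i1])
       (use pt k0 in \<open>auto intro!: AE_I2 simp: abs_of_nonneg\<close>)
  have "(LINT t:{a<..<b}|lborel. \<bar>x - t\<bar> powr (-3/4)) \<le> (\<integral>t. indicator {a<..<b} t + cut_power (x + (-1) * t) \<partial>lborel)"
    unfolding set_lebesgue_integral_def
    by (intro integral_mono a[unfolded set_integrable_def] i1 pt)
  also have "\<dots> = (b - a) + 8"
    using assms by (subst Bochner_Integration.integral_add)
      (use i v in \<open>auto simp: integrable_indicator_iff emeasure_lborel_Ioo measure_lborel_Ioo\<close>)
  finally show "(LINT t:{a<..<b}|lborel. \<bar>x - t\<bar> powr (-3/4)) \<le> (b - a) + 8" .
qed

lemma power_seg:
  shows "integrable seg (\<lambda>t. \<bar>x - t\<bar> powr (-3/4))" "(\<integral>t. \<bar>x - t\<bar> powr (-3/4) \<partial>seg) \<le> 10"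
  using power_interval[of "-1" 1 x] by (auto simp: integrable_seg_iff integral_seg)

lemma abs_ln_le: "\<bar>ln s\<bar> \<le> 2 * s powr (-3/4) + s" if "s > 0" for s :: real
proof (cases "s \<ge> 1")
  case True
  then have "ln s \<le> s" using ln_le_minus_one[of s] by simp
  moreover have "s powr (-3/4) \<ge> 0" by simp
  ultimately show ?thesis using True ln_ge_zero[of s] by linarith
next
  case False
  have "ln (s powr (-3/4)) \<le> s powr (-3/4) - 1" using that by (intro ln_le_minus_one) simp
  then have "(-3/4) * ln s \<le> s powr (-3/4)" using that by (simp add: ln_powr)
  then have "- ln s \<le> 4/3 * s powr (-3/4)" by simp
  also have "\<dots> \<le> 2 * s powr (-3/4)" by simp
  finally show ?thesis using False that by simp
qed

lemma ln_add_one_le: "ln (1 + x) \<le> 3 * x powr (3/4)" if "x \<ge> 0" for x :: real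
proof (cases "x \<le> 1")
  case True
  have "ln (1 + x) \<le> x" using that by (rule ln_add_one_self_le_self)
  also have "x = x powr 1" using that by simp
  also have "\<dots> \<le> x powr (3/4)" using that True by (intro powr_mono') auto
  also have "\<dots> \<le> 3 * x powr (3/4)" by simp
  finally show ?thesis .
next
  case False
  have "(3/4) * ln (1 + x) = ln ((1 + x) powr (3/4))" using that by (simp add: ln_powr)
  also have "\<dots> \<le> (1 + x) powr (3/4)" using ln_le_minus_one[of "(1 + x) powr (3/4)"] that by simp
  also have "\<dots> \<le> (2 * x) powr (3/4)" using False by (intro powr_mono2) auto
  also have "\<dots> = 2 powr (3/4) * x powr (3/4)" using False by (simp add: powr_mult)
  also have "2 powr (3/4) \<le> (2::real) powr 1" by (intro powr_mono) auto
  finally have "(3/4) * ln (1 + x) \<le> 2 * x powr (3/4)" by (simp add: mult_right_mono)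
  moreover have "x powr (3/4) \<ge> 0" by simp
  ultimately show ?thesis by linarith
qed

lemma abs_ln_diff_le:
  fixes a b :: real
  assumes "a > 0" "b > 0"
  shows "\<bar>ln a - ln b\<bar> \<le> 3 * \<bar>a - b\<bar> powr (3/4) * (a powr (-3/4) + b powr (-3/4))"
proof -
  have *: "\<bar>ln a - ln b\<bar> \<le> 3 * \<bar>a - b\<bar> powr (3/4) * (a powr (-3/4) + b powr (-3/4))"
    if "a \<ge> b" "b > 0" for a b :: real
  proof -
    have "\<bar>ln a - ln b\<bar> = ln a - ln b" using that by simp
    also have "ln a - ln b = ln (1 + (a - b) / b)"
      using that ln_div[of a b] by (simp add: diff_divide_distrib)
    also have "\<dots> \<le> 3 * ((a - b) / b) powr (3/4)" using that by (intro ln_add_one_le) auto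
    also have "((a - b) / b) powr (3/4) = \<bar>a - b\<bar> powr (3/4) * b powr (-3/4)"
      using that powr_minus_divide[of b "3/4"] by (simp add: powr_divide)
    also have "3 * (\<bar>a - b\<bar> powr (3/4) * b powr (-3/4)) \<le> 3 * \<bar>a - b\<bar> powr (3/4) * (a powr (-3/4) + b powr (-3/4))"
      by (simp add: mult_left_mono)
    finally show ?thesis .
  qed
  show ?thesis
  proof (cases "a \<ge> b")
    case True then show ?thesis using *[of b a] assms by simp
  next
    case False
    then have "b \<ge> a" by simp
    from *[OF this assms(1)] show ?thesis by (simp add: abs_minus_commute add.commute)
  qed
qed

text \<open>The class of densities: Borel on the whole line, as \<open>square_integrable\<close> demands, but bounded
  only on the segment, which admits both continuous functions and truncations of
  the arcsine density.\<close>

definition bdd_borel :: "(real \<Rightarrow> real) \<Rightarrow> bool" where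
  "bdd_borel f \<longleftrightarrow> f \<in> borel_measurable borel \<and> (\<exists>B. \<forall>t\<in>{-1<..<1}. \<bar>f t\<bar> \<le> B)"

lemma bdd_borelI:
  "f \<in> borel_measurable borel \<Longrightarrow> (\<And>t. t \<in> {-1<..<1} \<Longrightarrow> \<bar>f t\<bar> \<le> B) \<Longrightarrow> bdd_borel f"
  unfolding bdd_borel_def by blast

lemma bdd_borelE:
  assumes "bdd_borel f"
  obtains B where "B \<ge> 0" "\<And>t. t \<in> {-1<..<1} \<Longrightarrow> \<bar>f t\<bar> \<le> B"
proof -
  obtain B where "\<forall>t\<in>{-1<..<1}. \<bar>f t\<bar> \<le> B" using assms by (auto simp: bdd_borel_def)
  then show ?thesis by (intro that[of "max B 0"]) (auto simp: le_max_iff_disj)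
qed

lemma bdd_borel_measurable [measurable_dest]: "bdd_borel f \<Longrightarrow> f \<in> borel_measurable borel"
  by (simp add: bdd_borel_def)

lemma bdd_borel_mult: "bdd_borel f \<Longrightarrow> bdd_borel g \<Longrightarrow> bdd_borel (\<lambda>x. f x * g x)"
proof -
  assume f: "bdd_borel f" and g: "bdd_borel g"
  obtain B where B: "B \<ge> 0" "\<And>t. t \<in> {-1<..<1} \<Longrightarrow> \<bar>f t\<bar> \<le> B" using bdd_borelE[OF f] by blast
  obtain C where C: "C \<ge> 0" "\<And>t. t \<in> {-1<..<1} \<Longrightarrow> \<bar>g t\<bar> \<le> C" using bdd_borelE[OF g] by blast
  have "\<bar>f t * g t\<bar> \<le> B * C" if "t \<in> {-1<..<1}" for t
    using mult_mono[OF B(2)[OF that] C(2)[OF that] B(1)] by (simp add: abs_mult)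
  then show ?thesis using f g by (intro bdd_borelI) auto
qed

lemma bdd_borel_add: "bdd_borel f \<Longrightarrow> bdd_borel g \<Longrightarrow> bdd_borel (\<lambda>x. f x + g x)"
proof -
  assume f: "bdd_borel f" and g: "bdd_borel g"
  obtain B where B: "B \<ge> 0" "\<And>t. t \<in> {-1<..<1} \<Longrightarrow> \<bar>f t\<bar> \<le> B" using bdd_borelE[OF f] by blast
  obtain C where C: "C \<ge> 0" "\<And>t. t \<in> {-1<..<1} \<Longrightarrow> \<bar>g t\<bar> \<le> C" using bdd_borelE[OF g] by blast
  have "\<bar>f t + g t\<bar> \<le> B + C" if "t \<in> {-1<..<1}" for t
    using B(2)[OF that] C(2)[OF that] by linarith
  then show ?thesis using f g by (intro bdd_borelI) auto
qed

lemma bdd_borel_const: "bdd_borel (\<lambda>_. c)"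
  unfolding bdd_borel_def by auto

lemma bdd_borel_cmult: "bdd_borel f \<Longrightarrow> bdd_borel (\<lambda>x. c * f x)"
  using bdd_borel_mult[OF bdd_borel_const] .

lemma bdd_borel_continuous:
  assumes "continuous_on UNIV f"
  shows "bdd_borel f"
proof -
  have "bounded (f ` {-1..1})"
    by (intro compact_imp_bounded compact_continuous_image continuous_on_subset[OF assms]) auto
  then obtain B where B: "\<forall>y\<in>f ` {-1..1}. \<bar>y\<bar> \<le> B" unfolding bounded_iff by auto
  have "\<forall>t\<in>{-1<..<1}. \<bar>f t\<bar> \<le> B"
  proof
    fix t :: real assume "t \<in> {-1<..<1}"
    then have "t \<in> {-1..1}" by simp
    then show "\<bar>f t\<bar> \<le> B" using B by blast
  qed
  then show ?thesis using borel_measurable_continuous_onI[OF assms] unfolding bdd_borel_def by blast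
qed

lemma bdd_borel_integrable: "bdd_borel f \<Longrightarrow> integrable seg f"
proof -
  assume f: "bdd_borel f"
  obtain B where B: "B \<ge> 0" "\<And>t. t \<in> {-1<..<1} \<Longrightarrow> \<bar>f t\<bar> \<le> B" using bdd_borelE[OF f] by blast
  show ?thesis
    by (rule seg.integrable_const_bound[of _ B]) (use B f in \<open>auto intro: borel_measurable_seg bdd_borel_measurable\<close>)
qed

lemma norm_minus_real_ge: "\<bar>fst y - t\<bar> \<le> norm (y - (t, 0 :: real))" for y :: "real \<times> real"
  unfolding norm_minus_real_pair by (rule real_sqrt_ge_abs1)

lemma norm_minus_real_le: "norm (y - (t, 0 :: real)) \<le> norm y + \<bar>t\<bar>" for y :: "real \<times> real"
  using norm_triangle_ineq4[of y "(t, 0)"] by (simp add: norm_Pair)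

lemma powr_neg_antimono: "0 < a \<Longrightarrow> a \<le> b \<Longrightarrow> b powr (-3/4) \<le> a powr (-3/4)" for a b :: real
  by (intro powr_mono2') auto

lemma abs_ln_norm_le:
  fixes y :: "real \<times> real"
  assumes "t \<in> {-1<..<1}" "t \<noteq> fst y"
  shows "\<bar>ln (norm (y - (t, 0)))\<bar> \<le> 2 * \<bar>fst y - t\<bar> powr (-3/4) + (norm y + 1)"
proof -
  have p: "\<bar>fst y - t\<bar> > 0" using assms by simp
  then have q: "norm (y - (t, 0)) > 0" using norm_minus_real_ge[of y t] by linarith
  have "\<bar>ln (norm (y - (t, 0)))\<bar> \<le> 2 * norm (y - (t, 0)) powr (-3/4) + norm (y - (t, 0))"
    by (rule abs_ln_le[OF q])
  also have "norm (y - (t, 0)) powr (-3/4) \<le> \<bar>fst y - t\<bar> powr (-3/4)"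
    by (rule powr_neg_antimono[OF p norm_minus_real_ge])
  also have "norm (y - (t, 0)) \<le> norm y + 1" using norm_minus_real_le[of y t] assms(1) by auto
  finally show ?thesis by simp
qed

definition logpot :: "(real \<Rightarrow> real) \<Rightarrow> real \<times> real \<Rightarrow> real" where
  "logpot f y = (\<integral>t. ln (norm (y - (t, 0))) * f t \<partial>seg)"

lemma ln_norm_measurable [measurable]: "(\<lambda>t. ln (norm (y - (t, 0 :: real)))) \<in> borel_measurable borel"
  for y :: "real \<times> real"
  unfolding norm_minus_real_pair by measurable

lemma logpot_integrable:
  fixes y :: "real \<times> real"
  assumes f: "bdd_borel f"
  shows "integrable seg (\<lambda>t. ln (norm (y - (t, 0))) * f t)"
proof -
  obtain B where B: "B \<ge> 0" "\<And>t. t \<in> {-1<..<1} \<Longrightarrow> \<bar>f t\<bar> \<le> B" using bdd_borelE[OF f] by blast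
  have i: "integrable seg (\<lambda>t. (2 * \<bar>fst y - t\<bar> powr (-3/4) + (norm y + 1)) * B)"
    by (intro integrable_mult_left Bochner_Integration.integrable_add integrable_mult_right power_seg) auto
  show ?thesis
  proof (rule Bochner_Integration.integrable_bound[OF i])
    show "(\<lambda>t. ln (norm (y - (t, 0))) * f t) \<in> borel_measurable seg"
      by (intro borel_measurable_seg borel_measurable_times ln_norm_measurable) (rule bdd_borel_measurable[OF f])
    show "AE t in seg. norm (ln (norm (y - (t, 0))) * f t) \<le> norm ((2 * \<bar>fst y - t\<bar> powr (-3/4) + (norm y + 1)) * B)"
      using AE_seg_neq[of "fst y"] AE_space
    proof eventually_elim
      case (elim t)
      then have "\<bar>ln (norm (y - (t, 0)))\<bar> * \<bar>f t\<bar> \<le> (2 * \<bar>fst y - t\<bar> powr (-3/4) + (norm y + 1)) * B"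
        using abs_ln_norm_le[of t y] B(2)[of t] by (intro mult_mono) auto
      then show ?case using B(1) by (simp add: abs_mult)
    qed
  qed
qed

lemma abs_seg_integral_le:
  fixes g h :: "real \<Rightarrow> real"
  assumes "integrable seg g" "integrable seg h" "AE t in seg. \<bar>g t\<bar> \<le> h t"
  shows "\<bar>integral\<^sup>L seg g\<bar> \<le> integral\<^sup>L seg h"
proof -
  have "\<bar>integral\<^sup>L seg g\<bar> \<le> (\<integral>t. \<bar>g t\<bar> \<partial>seg)" by (rule integral_abs_bound)
  also have "\<dots> \<le> integral\<^sup>L seg h" using assms by (intro integral_mono_AE) auto
  finally show ?thesis .
qed

lemma logpot_bound:
  assumes f: "bdd_borel f" and B: "B \<ge> 0" "\<And>t. t \<in> {-1<..<1} \<Longrightarrow> \<bar>f t\<bar> \<le> B"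
  shows "\<bar>logpot f y\<bar> \<le> (22 + 2 * norm y) * B"
proof -
  have i: "integrable seg (\<lambda>t. (2 * \<bar>fst y - t\<bar> powr (-3/4) + (norm y + 1)) * B)"
    by (intro integrable_mult_left Bochner_Integration.integrable_add integrable_mult_right power_seg) auto
  have "\<bar>logpot f y\<bar> \<le> (\<integral>t. (2 * \<bar>fst y - t\<bar> powr (-3/4) + (norm y + 1)) * B \<partial>seg)"
    unfolding logpot_def
  proof (rule abs_seg_integral_le[OF logpot_integrable[OF f] i])
    show "AE t in seg. \<bar>ln (norm (y - (t, 0))) * f t\<bar> \<le> (2 * \<bar>fst y - t\<bar> powr (-3/4) + (norm y + 1)) * B"
      using AE_seg_neq[of "fst y"] AE_space
    proof eventually_elim
      case (elim t)
      then show ?case unfolding abs_mult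
        using abs_ln_norm_le[of t y] B(2)[of t] by (intro mult_mono) auto
    qed
  qed
  also have "\<dots> = (2 * (\<integral>t. \<bar>fst y - t\<bar> powr (-3/4) \<partial>seg) + 2 * (norm y + 1)) * B"
    using power_seg(1)[of "fst y"] integral_seg_const[of "norm y + 1"] by simp
  also have "\<dots> \<le> (22 + 2 * norm y) * B"
    using power_seg(2)[of "fst y"] B(1) by (intro mult_right_mono) auto
  finally show ?thesis .
qed

text \<open>\<open>\<bar>ln a - ln b\<bar>\<close> is controlled by \<open>\<bar>a - b\<bar> powr (3/4)\<close> times an integrable singularity, uniformly in
  the position of the points relative to the segment.\<close>

lemma logpot_holder:
  assumes f: "bdd_borel f" and B: "B \<ge> 0" "\<And>t. t \<in> {-1<..<1} \<Longrightarrow> \<bar>f t\<bar> \<le> B"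
  shows "\<bar>logpot f y - logpot f z\<bar> \<le> 60 * B * norm (y - z) powr (3/4)"
proof -
  define D where "D = norm (y - z) powr (3/4)"
  have i: "integrable seg (\<lambda>t. 3 * D * (\<bar>fst y - t\<bar> powr (-3/4) + \<bar>fst z - t\<bar> powr (-3/4)) * B)"
    by (intro integrable_mult_left Bochner_Integration.integrable_add integrable_mult_right power_seg)
  have "\<bar>logpot f y - logpot f z\<bar> = \<bar>\<integral>t. ln (norm (y - (t, 0))) * f t - ln (norm (z - (t, 0))) * f t \<partial>seg\<bar>"
    unfolding logpot_def
    by (subst Bochner_Integration.integral_diff[OF logpot_integrable[OF f] logpot_integrable[OF f]]) simp
  also have "\<dots> \<le> (\<integral>t. 3 * D * (\<bar>fst y - t\<bar> powr (-3/4) + \<bar>fst z - t\<bar> powr (-3/4)) * B \<partial>seg)"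
  proof (rule abs_seg_integral_le[OF Bochner_Integration.integrable_diff[OF logpot_integrable[OF f] logpot_integrable[OF f]] i])
    show "AE t in seg. \<bar>ln (norm (y - (t, 0))) * f t - ln (norm (z - (t, 0))) * f t\<bar>
        \<le> 3 * D * (\<bar>fst y - t\<bar> powr (-3/4) + \<bar>fst z - t\<bar> powr (-3/4)) * B"
      using AE_seg_neq[of "fst y"] AE_seg_neq[of "fst z"] AE_space
    proof eventually_elim
      case (elim t)
      let ?a = "norm (y - (t, 0))" and ?b = "norm (z - (t, 0))"
      have p: "\<bar>fst y - t\<bar> > 0" "\<bar>fst z - t\<bar> > 0" using elim by auto
      then have q: "?a > 0" "?b > 0" using norm_minus_real_ge[of y t] norm_minus_real_ge[of z t] by linarith+
      have "\<bar>?a - ?b\<bar> \<le> norm ((y - (t, 0)) - (z - (t, 0)))" by (rule norm_triangle_ineq3)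
      also have "(y - (t, 0)) - (z - (t, 0)) = y - z" by simp
      finally have "\<bar>?a - ?b\<bar> powr (3/4) \<le> D" unfolding D_def by (intro powr_mono2) auto
      moreover have "?a powr (-3/4) + ?b powr (-3/4) \<le> \<bar>fst y - t\<bar> powr (-3/4) + \<bar>fst z - t\<bar> powr (-3/4)"
        by (intro add_mono powr_neg_antimono p norm_minus_real_ge)
      ultimately have "3 * \<bar>?a - ?b\<bar> powr (3/4) * (?a powr (-3/4) + ?b powr (-3/4))
          \<le> 3 * D * (\<bar>fst y - t\<bar> powr (-3/4) + \<bar>fst z - t\<bar> powr (-3/4))"
        by (intro mult_mono) (auto simp: D_def)
      then have "\<bar>ln ?a - ln ?b\<bar> \<le> 3 * D * (\<bar>fst y - t\<bar> powr (-3/4) + \<bar>fst z - t\<bar> powr (-3/4))"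
        using abs_ln_diff_le[OF q] by linarith
      then have "\<bar>ln ?a - ln ?b\<bar> * \<bar>f t\<bar> \<le> 3 * D * (\<bar>fst y - t\<bar> powr (-3/4) + \<bar>fst z - t\<bar> powr (-3/4)) * B"
        using B(2)[of t] elim by (intro mult_mono) auto
      then show ?case by (simp add: abs_mult[symmetric] left_diff_distrib)
    qed
  qed
  also have "\<dots> = 3 * D * ((\<integral>t. \<bar>fst y - t\<bar> powr (-3/4) \<partial>seg) + (\<integral>t. \<bar>fst z - t\<bar> powr (-3/4) \<partial>seg)) * B"
    using power_seg(1)[of "fst y"] power_seg(1)[of "fst z"] by simp
  also have "\<dots> \<le> 3 * D * (10 + 10) * B"
    by (intro mult_mono add_mono power_seg B) (auto simp: D_def)
  finally show ?thesis by (simp add: D_def mult_ac)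
qed

lemma logpot_continuous:
  assumes f: "bdd_borel f"
  shows "continuous_on UNIV (logpot f)"
proof -
  obtain B where B: "B \<ge> 0" "\<And>t. t \<in> {-1<..<1} \<Longrightarrow> \<bar>f t\<bar> \<le> B" using bdd_borelE[OF f] by blast
  have "(logpot f \<longlongrightarrow> logpot f z) (at z)" for z
  proof (rule Lim_transform_bound[THEN iffD1[OF LIM_zero_iff]])
    show "\<forall>\<^sub>F y in at z. norm (logpot f y - logpot f z) \<le> norm (60 * B * norm (y - z) powr (3/4))"
      using logpot_holder[OF f B] B(1) by (intro always_eventually) auto
    have "((\<lambda>y. 60 * B * norm (y - z) powr (3/4)) \<longlongrightarrow> 60 * B * norm (z - z) powr (3/4)) (at z)"
      by (intro tendsto_intros) auto
    then show "((\<lambda>y. 60 * B * norm (y - z) powr (3/4)) \<longlongrightarrow> 0) (at z)" by simp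
  qed
  then show ?thesis by (simp add: continuous_on_def)
qed

section \<open>The logarithmic potential\<close>

text \<open>For \<open>\<bar>y\<bar> \<ge> 2\<close> moving the pole within the segment changes \<open>ln \<bar>y - t\<bar>\<close> by at most \<open>2 / \<bar>y\<bar>\<close>.\<close>

lemma logpot_asymptotics:
  assumes f: "bdd_borel f"
  shows "((\<lambda>y. logpot f y - ln (norm y) * integral\<^sup>L seg f) \<longlongrightarrow> 0) infinity_in_half_plane"
proof -
  obtain B where B: "B \<ge> 0" "\<And>t. t \<in> {-1<..<1} \<Longrightarrow> \<bar>f t\<bar> \<le> B" using bdd_borelE[OF f] by blast
  have le: "\<bar>logpot f y - ln (norm y) * integral\<^sup>L seg f\<bar> \<le> 4 * B / norm y" if "norm y \<ge> 2" for y
  proof -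
    have "logpot f y - ln (norm y) * integral\<^sup>L seg f = (\<integral>t. ln (norm (y - (t, 0))) * f t - ln (norm y) * f t \<partial>seg)"
      unfolding logpot_def using bdd_borel_integrable[OF f]
      by (subst Bochner_Integration.integral_diff[OF logpot_integrable[OF f]]) auto
    moreover have "\<bar>\<integral>t. ln (norm (y - (t, 0))) * f t - ln (norm y) * f t \<partial>seg\<bar> \<le> (\<integral>t. 2 / norm y * B \<partial>seg)"
    proof (rule abs_seg_integral_le)
      show "integrable seg (\<lambda>t. ln (norm (y - (t, 0))) * f t - ln (norm y) * f t)"
        by (intro Bochner_Integration.integrable_diff logpot_integrable[OF f] integrable_mult_right bdd_borel_integrable[OF f])
      show "AE t in seg. \<bar>ln (norm (y - (t, 0))) * f t - ln (norm y) * f t\<bar> \<le> 2 / norm y * B"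
        using AE_space
      proof eventually_elim
        case (elim t)
        let ?r = "norm (y - (t, 0))" and ?n = "norm y"
        have "\<bar>?r - ?n\<bar> \<le> norm ((y - (t, 0)) - y)" by (rule norm_triangle_ineq3)
        moreover have "\<bar>t\<bar> \<le> 1" using elim by auto
        ultimately have d: "\<bar>?r - ?n\<bar> \<le> 1" by (simp add: norm_Pair)
        then have r: "?r \<ge> ?n / 2" "?r > 0" using that by auto
        have n: "?n > 0" using that by linarith
        have "ln ?r - ln ?n \<le> (?r - ?n) / ?n" by (rule ln_diff_le[OF r(2) n])
        also have "\<dots> \<le> 1 / ?n" using d by (intro divide_right_mono) auto
        also have "\<dots> \<le> 2 / ?n" using n by (simp add: divide_simps)
        finally have 1: "ln ?r - ln ?n \<le> 2 / ?n" .
        have "ln ?n - ln ?r \<le> (?n - ?r) / ?r" by (rule ln_diff_le[OF n r(2)])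
        also have "\<dots> \<le> 1 / ?r" using d r by (intro divide_right_mono) auto
        also have "\<dots> \<le> 1 / (?n / 2)" using r n by (intro divide_left_mono) auto
        finally have 2: "ln ?n - ln ?r \<le> 2 / ?n" by simp
        from 1 2 have "\<bar>ln ?r - ln ?n\<bar> \<le> 2 / ?n" by linarith
        then have "\<bar>ln ?r - ln ?n\<bar> * \<bar>f t\<bar> \<le> 2 / ?n * B"
          using B(2)[of t] elim n by (intro mult_mono) auto
        then show ?case by (simp add: abs_mult[symmetric] left_diff_distrib)
      qed
    qed auto
    ultimately show ?thesis by (simp add: integral_seg_const)
  qed
  show ?thesis
  proof (rule Lim_null_comparison)
    show "\<forall>\<^sub>F y in infinity_in_half_plane. norm (logpot f y - ln (norm y) * integral\<^sup>L seg f) \<le> 4 * B / norm y"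
      unfolding eventually_infinity_in_half_plane using le by (intro exI[of _ 2]) auto
    have "((\<lambda>y :: real \<times> real. 4 * B / norm y) \<longlongrightarrow> 0) at_infinity"
      by (intro tendsto_divide_0[OF tendsto_const] filterlim_at_top_imp_at_infinity filterlim_norm_at_top)
    then show "((\<lambda>y :: real \<times> real. 4 * B / norm y) \<longlongrightarrow> 0) infinity_in_half_plane"
      unfolding infinity_in_half_plane_def by (rule tendsto_mono[rotated]) simp
  qed
qed

text \<open>The potential is the real part of this function on the upper half-plane, where all
  points \<open>z - t\<close> avoid the branch cut of the logarithm.\<close>

definition complex_pot :: "(real \<Rightarrow> real) \<Rightarrow> complex \<Rightarrow> complex" where
  "complex_pot f z = integral {-1..1} (\<lambda>t. of_real (f t) * Ln (z - of_real t))"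

lemma complex_pot_derivative:
  assumes f: "continuous_on UNIV f" and z: "Im z > 0"
  shows "(complex_pot f has_field_derivative integral {-1..1} (\<lambda>t. of_real (f t) / (z - of_real t))) (at z)"
proof -
  have cf: "continuous_on S f" for S by (rule continuous_on_subset[OF f]) auto
  have nz: "w - of_real t \<notin> \<real>\<^sub>\<le>\<^sub>0" if "Im w > 0" for w t
    using that by (auto simp: complex_nonpos_Reals_iff)
  have nz': "w - of_real t \<noteq> 0" if "Im w > 0" for w t
    using that by auto
  have "((\<lambda>z. integral (cbox (-1) 1) (\<lambda>t. of_real (f t) * Ln (z - of_real t)))
      has_field_derivative integral (cbox (-1) 1) (\<lambda>t. of_real (f t) / (z - of_real t))) (at z within upper)"
  proof (rule leibniz_rule_field_derivative)
    fix w t assume w: "w \<in> upper"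
    show "((\<lambda>z. of_real (f t) * Ln (z - of_real t)) has_field_derivative of_real (f t) / (w - of_real t)) (at w within upper)"
      using nz[of w t] w by (auto intro!: derivative_eq_intros simp: field_simps)
    show "(\<lambda>t. of_real (f t) * Ln (w - of_real t)) integrable_on cbox (-1) 1"
      using nz[of w] w by (intro integrable_continuous continuous_intros cf) auto
  next
    have "continuous_on (upper \<times> cbox (-1) 1) (\<lambda>p. f (snd p))"
      by (rule continuous_on_compose2[OF f]) (auto intro: continuous_intros)
    then show "continuous_on (upper \<times> cbox (-1) 1) (\<lambda>(z, t). complex_of_real (f t) / (z - of_real t))"
      unfolding split_beta by (intro continuous_intros) (auto simp: nz')
  qed (use z convex_halfspace_Im_gt in auto)
  then show ?thesis using z open_upper by (simp add: complex_pot_def[abs_def] at_within_open[of z upper])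
qed

lemma complex_pot_holomorphic: "continuous_on UNIV f \<Longrightarrow> complex_pot f holomorphic_on upper"
  using complex_pot_derivative by (auto simp: holomorphic_on_open open_upper)

lemma logpot_eq_complex_pot:
  assumes f: "continuous_on UNIV f" and y: "y \<in> half_plane"
  shows "logpot f y = re_part (complex_pot f) y"
proof -
  have cf: "continuous_on S f" for S by (rule continuous_on_subset[OF f]) auto
  define z where "z = Complex (fst y) (snd y)"
  have z: "Im z > 0" using y by (simp add: z_def half_plane_def)
  have nz: "z - of_real t \<notin> \<real>\<^sub>\<le>\<^sub>0" for t
    using z by (auto simp: complex_nonpos_Reals_iff)
  have c: "continuous_on {-1..1} (\<lambda>t. complex_of_real (f t) * Ln (z - of_real t))"
    using nz by (intro continuous_intros cf) auto
  have e: "Re (of_real (f t) * Ln (z - of_real t)) = ln (norm (y - (t, 0))) * f t" for t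
  proof -
    have "z - of_real t \<noteq> 0" using z by auto
    moreover have "cmod (z - of_real t) = norm (y - (t, 0))"
      by (simp add: z_def cmod_def norm_minus_real_pair)
    ultimately show ?thesis by simp
  qed
  have "re_part (complex_pot f) y = Re (integral\<^sup>L seg (\<lambda>t. of_real (f t) * Ln (z - of_real t)))"
    by (simp add: re_part_def complex_pot_def z_def[symmetric] continuous_integral_seg(2)[OF c])
  also have "\<dots> = integral\<^sup>L seg (\<lambda>t. Re (of_real (f t) * Ln (z - of_real t)))"
    using continuous_integral_seg(1)[OF c] by (rule integral_Re[symmetric])
  finally show ?thesis unfolding e logpot_def ..
qed

lemma deriv_complex_pot:
  assumes f: "continuous_on UNIV f" and z: "Im z > 0"
  shows "deriv (complex_pot f) z = (\<integral>t. of_real (f t) / (z - of_real t) \<partial>seg)"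
    and "integrable seg (\<lambda>t. of_real (f t) / (z - of_real t))"
proof -
  have cf: "continuous_on S f" for S by (rule continuous_on_subset[OF f]) auto
  have "z - of_real t \<noteq> 0" for t using z by auto
  then have c: "continuous_on {-1..1} (\<lambda>t. complex_of_real (f t) / (z - of_real t))"
    by (intro continuous_intros cf) auto
  show "deriv (complex_pot f) z = (\<integral>t. of_real (f t) / (z - of_real t) \<partial>seg)"
    using DERIV_imp_deriv[OF complex_pot_derivative[OF f z]] continuous_integral_seg(2)[OF c] by simp
  show "integrable seg (\<lambda>t. of_real (f t) / (z - of_real t))" by (rule continuous_integral_seg(1)[OF c])
qed

lemma harmonic_on_logpot:
  assumes "continuous_on UNIV f"
  shows "harmonic_on (\<lambda>y. c + k * logpot f y) half_plane"
  by (rule harmonic_on_re_part[of "\<lambda>z. of_real c + of_real k * complex_pot f z"])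
     (auto intro!: holomorphic_intros complex_pot_holomorphic assms simp: re_part_def logpot_eq_complex_pot[OF assms])

text \<open>The vertical derivative of the potential is \<open>\<pi>\<close> times the Poisson integral of the density.\<close>

lemma vertical_derivative_logpot:
  assumes f: "continuous_on UNIV f" and s: "s > 0"
  shows "((\<lambda>s. logpot f (x, s)) has_real_derivative (\<integral>t. s / ((x - t)\<^sup>2 + s\<^sup>2) * f t \<partial>seg)) (at s)"
proof -
  define z where "z = Complex x s"
  have z: "Im z > 0" using s by (simp add: z_def)
  have y: "(x, s) \<in> half_plane" using s by (simp add: half_plane_def)
  have d: "logpot f differentiable (at (x, s))"
    using harmonic_on_logpot[OF f, of 0 1] y open_half_plane
    by (auto simp: harmonic_on_def differentiable_on_eq_differentiable_at)
  have "((\<lambda>s. logpot f (x, s)) has_real_derivative partial2 (logpot f) (x, s)) (at s)"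
    using slice2_has_derivative[OF d] by simp
  moreover have "partial2 (logpot f) (x, s) = Re (\<i> * deriv (complex_pot f) z)"
    using partial2_cong_half_plane[of "logpot f" "re_part (complex_pot f)", OF logpot_eq_complex_pot[OF f] y]
      re_part_differentiable(3)[OF complex_pot_holomorphic[OF f] y]
    by (simp add: re_part_def[of "\<lambda>z. \<i> * deriv (complex_pot f) z"] z_def)
  moreover have "Re (\<i> * deriv (complex_pot f) z) = (\<integral>t. - Im (of_real (f t) / (z - of_real t)) \<partial>seg)"
    using integral_Im[OF deriv_complex_pot(2)[OF f z]] by (simp add: deriv_complex_pot(1)[OF f z])
  moreover have "- Im (of_real (f t) / (z - of_real t)) = s / ((x - t)\<^sup>2 + s\<^sup>2) * f t" for t
    by (simp add: z_def Im_divide)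
  ultimately show ?thesis by simp
qed


lemma poisson_integral:
  assumes "s > 0"
  shows "integrable seg (\<lambda>t. s / ((x - t)\<^sup>2 + s\<^sup>2))"
    and "(\<integral>t. s / ((x - t)\<^sup>2 + s\<^sup>2) \<partial>seg) = arctan ((1 - x) / s) + arctan ((1 + x) / s)"
proof -
  have pos: "(x - t)\<^sup>2 + s\<^sup>2 > 0" for t using assms by (simp add: add_nonneg_pos)
  have c: "continuous_on {-1..1} (\<lambda>t. s / ((x - t)\<^sup>2 + s\<^sup>2))"
    by (intro continuous_intros) (use assms in auto)
  show "integrable seg (\<lambda>t. s / ((x - t)\<^sup>2 + s\<^sup>2))" by (rule continuous_integral_seg(1)[OF c])
  have d: "((\<lambda>t. arctan ((t - x) / s)) has_real_derivative s / ((x - t)\<^sup>2 + s\<^sup>2)) (at t)" for t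
  proof -
    have "((\<lambda>t. arctan ((t - x) / s)) has_real_derivative inverse (1 + ((t - x) / s)\<^sup>2) * (1 / s)) (at t)"
      using assms by (auto intro!: derivative_eq_intros)
    also have "inverse (1 + ((t - x) / s)\<^sup>2) * (1 / s) = s / ((x - t)\<^sup>2 + s\<^sup>2)"
      using assms pos[of t] by (simp add: divide_simps power2_eq_square) (simp add: algebra_simps)
    finally show ?thesis .
  qed
  have "((\<lambda>t. s / ((x - t)\<^sup>2 + s\<^sup>2)) has_integral (arctan ((1 - x) / s) - arctan ((-1 - x) / s))) {-1..1}"
    by (rule fundamental_theorem_of_calculus)
       (auto intro!: has_field_derivative_at_within d simp: has_real_derivative_iff_has_vector_derivative[symmetric])
  then have "(\<integral>t. s / ((x - t)\<^sup>2 + s\<^sup>2) \<partial>seg) = arctan ((1 - x) / s) - arctan ((-1 - x) / s)"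
    using continuous_integral_seg(2)[OF c] by (simp add: integral_unique)
  also have "(-1 - x) / s = - ((1 + x) / s)" unfolding minus_divide_left by simp
  finally show "(\<integral>t. s / ((x - t)\<^sup>2 + s\<^sup>2) \<partial>seg) = arctan ((1 - x) / s) + arctan ((1 + x) / s)"
    by (simp add: arctan_minus)
qed

lemma poisson_integral_limit:
  assumes "\<bar>x\<bar> < 1"
  shows "((\<lambda>s. arctan ((1 - x) / s) + arctan ((1 + x) / s)) \<longlongrightarrow> pi) (at_right 0)"
proof -
  have *: "((\<lambda>s. arctan (a / s)) \<longlongrightarrow> pi / 2) (at_right 0)" if "a > 0" for a :: real
  proof (rule filterlim_compose[OF tendsto_arctan_at_top])
    have "filterlim (\<lambda>s. a * inverse s) at_top (at_right 0)"
      by (rule filterlim_tendsto_pos_mult_at_top[OF tendsto_const that filterlim_inverse_at_top_right])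
    then show "filterlim (\<lambda>s. a / s) at_top (at_right 0)" by (simp add: divide_inverse)
  qed
  have "((\<lambda>s. arctan ((1 - x) / s) + arctan ((1 + x) / s)) \<longlongrightarrow> pi / 2 + pi / 2) (at_right 0)"
    using assms by (intro tendsto_add *) auto
  then show ?thesis by simp
qed

lemma poisson_kernel_le: "s / ((x - t)\<^sup>2 + s\<^sup>2) \<le> s / d\<^sup>2" if "s > 0" "d > 0" "\<bar>t - x\<bar> \<ge> d" for s d x t :: real
proof (rule divide_left_mono)
  have "d\<^sup>2 \<le> \<bar>t - x\<bar>\<^sup>2" using that by (intro power_mono) auto
  then show "d\<^sup>2 \<le> (x - t)\<^sup>2 + s\<^sup>2" by (simp add: power2_commute add_increasing2)
  then show "0 < ((x - t)\<^sup>2 + s\<^sup>2) * d\<^sup>2" using that by (intro mult_pos_pos) (auto simp: add_nonneg_pos)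
qed (use that in auto)

text \<open>The Poisson kernel has total mass tending to \<open>\<pi>\<close> and concentrates at \<open>x\<close>. The mass away from \<open>x\<close>
  is of order \<open>s\<close>.\<close>

lemma poisson_limit_inside:
  assumes f: "continuous_on UNIV f" and x: "\<bar>x\<bar> < 1"
  shows "((\<lambda>s. \<integral>t. s / ((x - t)\<^sup>2 + s\<^sup>2) * f t \<partial>seg) \<longlongrightarrow> pi * f x) (at_right 0)"
proof -
  have bf: "bdd_borel f" by (rule bdd_borel_continuous[OF f])
  obtain B where B: "B \<ge> 0" "\<And>t. t \<in> {-1<..<1} \<Longrightarrow> \<bar>f t\<bar> \<le> B" using bdd_borelE[OF bf] by blast
  let ?P = "\<lambda>s t. s / ((x - t)\<^sup>2 + s\<^sup>2)"
  have cP: "integrable seg (\<lambda>t. ?P s t * f t)" if "s > 0" for s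
  proof -
    show ?thesis
      by (intro continuous_integral_seg(1) continuous_intros continuous_on_subset[OF f])
         (use that in auto)
  qed
  have "((\<lambda>s. (\<integral>t. ?P s t * f t \<partial>seg) - f x * (arctan ((1 - x) / s) + arctan ((1 + x) / s))) \<longlongrightarrow> 0) (at_right 0)"
  proof (rule tendstoI)
    fix e :: real assume e: "e > 0"
    define \<epsilon> where "\<epsilon> = e / (2 * pi)"
    have \<epsilon>: "\<epsilon> > 0" using e by (simp add: \<epsilon>_def)
    have "isCont f x" using f by (simp add: continuous_on_eq_continuous_at)
    then obtain d where d: "d > 0" "\<And>t. \<bar>t - x\<bar> < d \<Longrightarrow> \<bar>f t - f x\<bar> < \<epsilon>"
      using \<epsilon> unfolding continuous_at_eps_delta dist_real_def by blast
    define D where "D = 2 * (2 * B / d\<^sup>2) + 1"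
    have D: "D > 0" using B(1) by (auto simp: D_def intro!: add_nonneg_pos)
    have "\<forall>\<^sub>F s in at_right 0. s \<in> {0<..<e / (2 * D)}"
      using e D by (intro eventually_at_right_real) auto
    then show "\<forall>\<^sub>F s in at_right 0. dist ((\<integral>t. ?P s t * f t \<partial>seg) - f x * (arctan ((1 - x) / s) + arctan ((1 + x) / s))) 0 < e"
    proof eventually_elim
      case (elim s)
      then have s: "s > 0" "s * D < e / 2" using D by (auto simp: field_simps)
      have pos: "(x - t)\<^sup>2 + s\<^sup>2 > 0" for t using s by (simp add: add_nonneg_pos)
      have "(\<integral>t. ?P s t * f t \<partial>seg) - f x * (arctan ((1 - x) / s) + arctan ((1 + x) / s))
          = (\<integral>t. ?P s t * f t - ?P s t * f x \<partial>seg)"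
        unfolding Bochner_Integration.integral_diff[OF cP[OF s(1)] integrable_mult_left[OF poisson_integral(1)[OF s(1)]]]
        by (simp only: integral_mult_left_zero poisson_integral(2)[OF s(1)]) (simp only: mult.commute)
      moreover have "\<bar>\<integral>t. ?P s t * f t - ?P s t * f x \<partial>seg\<bar> \<le> (\<integral>t. \<epsilon> * ?P s t + 2 * B * s / d\<^sup>2 \<partial>seg)"
      proof (rule abs_seg_integral_le)
        show "integrable seg (\<lambda>t. ?P s t * f t - ?P s t * f x)"
          by (intro Bochner_Integration.integrable_diff cP[OF s(1)] integrable_mult_left poisson_integral(1)[OF s(1)])
        show "integrable seg (\<lambda>t. \<epsilon> * ?P s t + 2 * B * s / d\<^sup>2)"
          by (intro Bochner_Integration.integrable_add integrable_mult_right poisson_integral(1)[OF s(1)]) auto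
        show "AE t in seg. \<bar>?P s t * f t - ?P s t * f x\<bar> \<le> \<epsilon> * ?P s t + 2 * B * s / d\<^sup>2"
          using AE_space
        proof eventually_elim
          case (elim t)
          have P0: "?P s t \<ge> 0" using s pos[of t] by simp
          have eq: "\<bar>?P s t * f t - ?P s t * f x\<bar> = ?P s t * \<bar>f t - f x\<bar>"
            using P0 by (simp only: right_diff_distrib[symmetric] abs_mult abs_of_nonneg)
          show ?case
          proof (cases "\<bar>t - x\<bar> < d")
            case True
            then have "?P s t * \<bar>f t - f x\<bar> \<le> ?P s t * \<epsilon>"
              using d(2)[OF True] P0 by (intro mult_left_mono) auto
            moreover have "2 * B * s / d\<^sup>2 \<ge> 0" using B(1) s by simp
            ultimately show ?thesis unfolding eq by (simp add: mult.commute)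
          next
            case False
            have "x \<in> {-1<..<1}" "t \<in> {-1<..<1}" using x elim by (auto simp: abs_less_iff)
            from B(2)[OF this(1)] B(2)[OF this(2)] have "\<bar>f t - f x\<bar> \<le> 2 * B" by linarith
            then have "?P s t * \<bar>f t - f x\<bar> \<le> s / d\<^sup>2 * (2 * B)"
              using poisson_kernel_le[OF s(1) d(1), of t x] False P0 by (intro mult_mono) auto
            moreover have "\<epsilon> * ?P s t \<ge> 0" using P0 \<epsilon> by (intro mult_nonneg_nonneg) auto
            ultimately show ?thesis unfolding eq by (simp add: mult.commute)
          qed
        qed
      qed
      moreover have "(\<integral>t. \<epsilon> * ?P s t + 2 * B * s / d\<^sup>2 \<partial>seg) = \<epsilon> * (arctan ((1 - x) / s) + arctan ((1 + x) / s)) + 2 * (2 * B * s / d\<^sup>2)"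
        unfolding Bochner_Integration.integral_add[OF integrable_mult_right[OF poisson_integral(1)[OF s(1)]] seg.integrable_const]
        by (simp only: integral_mult_right_zero poisson_integral(2)[OF s(1)] integral_seg_const)
      moreover have "\<epsilon> * (arctan ((1 - x) / s) + arctan ((1 + x) / s)) \<le> \<epsilon> * pi"
        using \<epsilon> arctan_ubound[of "(1 - x) / s"] arctan_ubound[of "(1 + x) / s"] by (intro mult_left_mono) auto
      moreover have "\<epsilon> * pi = e / 2" by (simp add: \<epsilon>_def)
      moreover have "2 * (2 * B * s / d\<^sup>2) \<le> s * D" using s by (simp add: D_def algebra_simps)
      ultimately show ?case using s(2) by simp
    qed
  qed
  from tendsto_add[OF this tendsto_mult[OF tendsto_const[of "f x"] poisson_integral_limit[OF x]]]
  show ?thesis by (simp add: mult.commute)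
qed

lemma poisson_limit_outside:
  assumes f: "continuous_on UNIV f" and x: "\<bar>x\<bar> > 1"
  shows "((\<lambda>s. \<integral>t. s / ((x - t)\<^sup>2 + s\<^sup>2) * f t \<partial>seg) \<longlongrightarrow> 0) (at_right 0)"
proof -
  have bf: "bdd_borel f" by (rule bdd_borel_continuous[OF f])
  obtain B where B: "B \<ge> 0" "\<And>t. t \<in> {-1<..<1} \<Longrightarrow> \<bar>f t\<bar> \<le> B" using bdd_borelE[OF bf] by blast
  let ?P = "\<lambda>s t. s / ((x - t)\<^sup>2 + s\<^sup>2)"
  define d where "d = \<bar>x\<bar> - 1"
  have d: "d > 0" using x by (simp add: d_def)
  show ?thesis
  proof (rule Lim_null_comparison)
    show "\<forall>\<^sub>F s in at_right 0. norm (\<integral>t. ?P s t * f t \<partial>seg) \<le> 2 * (s / d\<^sup>2 * B)"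
      using eventually_at_right_less[of "0::real"]
    proof eventually_elim
      fix s :: real assume s: "s > 0"
      have pos: "(x - t)\<^sup>2 + s\<^sup>2 > 0" for t using s by (simp add: add_nonneg_pos)
      have i: "integrable seg (\<lambda>t. ?P s t * f t)"
        by (intro continuous_integral_seg(1) continuous_intros continuous_on_subset[OF f])
           (use s in auto)
      have "\<bar>\<integral>t. ?P s t * f t \<partial>seg\<bar> \<le> (\<integral>t. s / d\<^sup>2 * B \<partial>seg)"
      proof (rule abs_seg_integral_le[OF i])
        show "AE t in seg. \<bar>?P s t * f t\<bar> \<le> s / d\<^sup>2 * B"
          using AE_space
        proof eventually_elim
          case (elim t)
          then have "\<bar>t - x\<bar> \<ge> d" by (auto simp: d_def)
          then show ?case unfolding abs_mult
            using poisson_kernel_le[OF s d, of t x] B(2)[of t] elim s pos[of t] by (intro mult_mono) auto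
        qed
      qed auto
      then show "norm (\<integral>t. ?P s t * f t \<partial>seg) \<le> 2 * (s / d\<^sup>2 * B)" by (simp add: integral_seg_const)
    qed
    have "((\<lambda>s. 2 * (s / d\<^sup>2 * B)) \<longlongrightarrow> 2 * (0 / d\<^sup>2 * B)) (at_right 0)"
      using d by (intro tendsto_intros) auto
    then show "((\<lambda>s. 2 * (s / d\<^sup>2 * B)) \<longlongrightarrow> 0) (at_right 0)" by simp
  qed
qed

text \<open>By the mean value theorem the difference quotient at \<open>0\<close> is a value of the derivative nearby.\<close>

lemma one_sided_derivative_from_limit:
  fixes h :: "real \<Rightarrow> real"
  assumes cont: "continuous_on {0..} h"
    and d: "\<And>s. s > 0 \<Longrightarrow> (h has_real_derivative P s) (at s)"
    and lim: "(P \<longlongrightarrow> l) (at_right 0)"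
  shows "(h has_real_derivative l) (at 0 within {0..})"
proof -
  have "((\<lambda>s. (h s - h 0) / (s - 0)) \<longlongrightarrow> l) (at_right 0)"
  proof (rule tendstoI)
    fix e :: real assume "e > 0"
    then have "\<forall>\<^sub>F s in at_right 0. dist (P s) l < e" by (rule tendstoD[OF lim])
    then obtain b where b: "b > 0" "\<And>s. 0 < s \<Longrightarrow> s < b \<Longrightarrow> dist (P s) l < e"
      unfolding eventually_at_right_field by auto
    have "\<forall>\<^sub>F s in at_right 0. s \<in> {0<..<b}" using b by (intro eventually_at_right_real) auto
    then show "\<forall>\<^sub>F s in at_right 0. dist ((h s - h 0) / (s - 0)) l < e"
    proof eventually_elim
      case (elim s)
      then have s: "0 < s" "s < b" by auto
      have "\<exists>l z. 0 < z \<and> z < s \<and> DERIV h z :> l \<and> h s - h 0 = (s - 0) * l"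
        using s d by (intro MVT continuous_on_subset[OF cont]) (auto simp: real_differentiable_def)
      then obtain k z where z: "0 < z" "z < s" "DERIV h z :> k" "h s - h 0 = s * k" by auto
      have "k = P z" using DERIV_unique[OF z(3) d[OF z(1)]] .
      then show ?case using b(2)[of z] z s by simp
    qed
  qed
  then show ?thesis by (simp add: has_field_derivative_iff at_within_Ici_at_right)
qed

text \<open>The jump relation of the single layer potential.\<close>

lemma vertical_derivative_logpot_boundary:
  assumes f: "continuous_on UNIV f" and x: "\<bar>x\<bar> \<noteq> 1"
  shows "((\<lambda>t. logpot f (x, t)) has_real_derivative (if \<bar>x\<bar> < 1 then pi * f x else 0)) (at 0 within {0..})"
proof (rule one_sided_derivative_from_limit)
  show "continuous_on {0..} (\<lambda>t. logpot f (x, t))"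
    by (rule continuous_on_compose2[OF logpot_continuous[OF bdd_borel_continuous[OF f]]])
       (auto intro!: continuous_intros)
  show "((\<lambda>t. logpot f (x, t)) has_real_derivative (\<integral>t. s / ((x - t)\<^sup>2 + s\<^sup>2) * f t \<partial>seg)) (at s)" if "s > 0" for s
    by (rule vertical_derivative_logpot[OF f that])
  show "((\<lambda>s. \<integral>t. s / ((x - t)\<^sup>2 + s\<^sup>2) * f t \<partial>seg) \<longlongrightarrow> (if \<bar>x\<bar> < 1 then pi * f x else 0)) (at_right 0)"
    using poisson_limit_inside[OF f] poisson_limit_outside[OF f] x by auto
qed

section \<open>Representation and existence of solutions\<close>

text \<open>Adding the single layer potential with density \<open>\<mu> / \<pi>\<close> times the boundary values cancels the normal
  derivative, so Liouville's theorem applies to the sum. The vanishing of its logarithmic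
  coefficient is the relation between the growth \<open>a\<close> and the mass.\<close>

theorem mixed_solution_representation:
  assumes sol: "mixed_solution \<mu> u"
    and growth: "(\<lambda>y. u y - a * ln (norm y)) \<in> O[infinity_in_half_plane](\<lambda>_. 1)"
  obtains c where "continuous_on UNIV (\<lambda>x. u (x, 0))"
    and "\<mu> / pi * integral\<^sup>L seg (\<lambda>x. u (x, 0)) = - a"
    and "\<And>x. \<bar>x\<bar> < 1 \<Longrightarrow> u (x, 0) = c - \<mu> / pi * logpot (\<lambda>x. u (x, 0)) (x, 0)"
    and "((\<lambda>y. u y - a * ln (norm y)) \<longlongrightarrow> c) infinity_in_half_plane"
proof -
  define f where "f x = u (x, 0)" for x
  define k where "k = \<mu> / pi"
  have cu: "continuous_on closed_half_plane u" using sol by (simp add: mixed_solution_def)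
  have cf: "continuous_on UNIV f"
    unfolding f_def by (rule continuous_on_compose2[OF cu]) (auto intro!: continuous_intros simp: closed_half_plane_def)
  have bf: "bdd_borel f" by (rule bdd_borel_continuous[OF cf])
  define w where "w y = u y + k * logpot f y" for y
  define m where "m = integral\<^sup>L seg f"
  have cw: "continuous_on closed_half_plane w"
    unfolding w_def by (intro continuous_intros cu continuous_on_subset[OF logpot_continuous[OF bf]]) auto
  have hw: "has_laplacian w 0 y" if "snd y > 0" for y
  proof -
    have "has_laplacian u 0 y" "has_laplacian (\<lambda>y. 0 + k * logpot f y) 0 y"
      using that sol harmonic_on_logpot[OF cf, of 0 k]
      by (auto intro!: harmonic_on_imp_has_laplacian simp: mixed_solution_def half_plane_def)
    from has_laplacian_add[OF this] show ?thesis by (simp add: w_def[abs_def])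
  qed
  have nw: "((\<lambda>t. w (x, t)) has_real_derivative 0) (at 0 within {0..})" if "\<bar>x\<bar> \<noteq> 1" for x
  proof -
    have "((\<lambda>t. u (x, t)) has_real_derivative (if \<bar>x\<bar> < 1 then - (\<mu> * f x) else 0)) (at 0 within {0..})"
      using sol that by (auto simp: mixed_solution_def has_normal_derivative_def f_def)
    from DERIV_add[OF this DERIV_cmult[OF vertical_derivative_logpot_boundary[OF cf that], of k]]
    show ?thesis by (auto simp: w_def k_def split: if_splits)
  qed
  have asy: "((\<lambda>y. logpot f y - ln (norm y) * m) \<longlongrightarrow> 0) infinity_in_half_plane"
    unfolding m_def by (rule logpot_asymptotics[OF bf])
  have "(\<lambda>y. (u y - a * ln (norm y)) + k * (logpot f y - ln (norm y) * m)) \<in> O[infinity_in_half_plane](\<lambda>_. 1)"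
    using tendsto_imp_bigo_one[OF tendsto_mult[OF tendsto_const[of k] asy]] by (intro sum_in_bigo growth)
  then have gw: "(\<lambda>y. w y - (a + k * m) * ln (norm y)) \<in> O[infinity_in_half_plane](\<lambda>_. 1)"
    by (simp add: w_def algebra_simps)
  define c where "c = w (0, 0)"
  have "a + k * m = 0" by (rule neumann_liouville(1)[OF cw hw nw gw])
  then have a: "a = - k * m" by simp
  have u: "u y = c - k * logpot f y" if "snd y \<ge> 0" "y \<noteq> (1, 0)" "y \<noteq> (-1, 0)" for y
  proof -
    have "w y = w (0, 0)" by (rule neumann_liouville(2)[OF cw hw nw gw that])
    then show ?thesis by (simp add: w_def c_def)
  qed
  have "((\<lambda>y. c - k * (logpot f y - ln (norm y) * m)) \<longlongrightarrow> c - k * 0) infinity_in_half_plane"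
    by (intro tendsto_intros asy)
  moreover have "\<forall>\<^sub>F y in infinity_in_half_plane. c - k * (logpot f y - ln (norm y) * m) = u y - a * ln (norm y)"
    unfolding eventually_infinity_in_half_plane
  proof (intro exI[of _ 2] allI impI)
    fix y :: "real \<times> real" assume y: "2 \<le> norm y \<and> 0 \<le> snd y"
    then have "y \<noteq> (1, 0)" "y \<noteq> (-1, 0)" by (auto simp: norm_Pair)
    then show "c - k * (logpot f y - ln (norm y) * m) = u y - a * ln (norm y)"
      using u[of y] y by (simp add: a algebra_simps)
  qed
  ultimately have lim: "((\<lambda>y. u y - a * ln (norm y)) \<longlongrightarrow> c) infinity_in_half_plane"
    using tendsto_cong by fastforce
  show ?thesis
    by (rule that[of c]) (use cf a u lim in \<open>auto simp: f_def[abs_def] k_def m_def\<close>)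
qed

lemma logpot_cmult: "logpot (\<lambda>x. c * f x) y = c * logpot f y"
  unfolding logpot_def by (subst integral_mult_right_zero[symmetric]) (simp add: mult_ac)

lemma logpot_diff:
  assumes "bdd_borel f" "bdd_borel g"
  shows "logpot (\<lambda>x. f x - g x) y = logpot f y - logpot g y"
  unfolding logpot_def right_diff_distrib
  by (rule Bochner_Integration.integral_diff[OF logpot_integrable[OF assms(1)] logpot_integrable[OF assms(2)]])

text \<open>\<open>\<bar>z - t\<bar>\<close> is at least both \<open>\<bar>Re z - t\<bar>\<close> and \<open>Im z\<close>; the exponents \<open>3/4\<close> and \<open>1/4\<close> share the factor
  between them. The square of the bound is integrable in \<open>Im z\<close> near \<open>0\<close>.\<close>

lemma deriv_complex_pot_bound:
  assumes f: "continuous_on UNIV f" and z: "Im z > 0"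
    and B: "B \<ge> 0" "\<And>t. t \<in> {-1<..<1} \<Longrightarrow> \<bar>f t\<bar> \<le> B"
  shows "cmod (deriv (complex_pot f) z) \<le> 10 * B * Im z powr (-1/4)"
proof -
  have i: "integrable seg (\<lambda>t. B * Im z powr (-1/4) * \<bar>Re z - t\<bar> powr (-3/4))"
    by (intro integrable_mult_right power_seg(1))
  have "cmod (deriv (complex_pot f) z) \<le> (\<integral>t. cmod (of_real (f t) / (z - of_real t)) \<partial>seg)"
    unfolding deriv_complex_pot(1)[OF f z] by (rule integral_norm_bound)
  also have "\<dots> \<le> (\<integral>t. B * Im z powr (-1/4) * \<bar>Re z - t\<bar> powr (-3/4) \<partial>seg)"
  proof (rule integral_mono_AE[OF integrable_norm[OF deriv_complex_pot(2)[OF f z]] i])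
    show "AE t in seg. cmod (of_real (f t) / (z - of_real t)) \<le> B * Im z powr (-1/4) * \<bar>Re z - t\<bar> powr (-3/4)"
      using AE_space AE_seg_neq[of "Re z"]
    proof eventually_elim
      case (elim t)
      define r where "r = cmod (z - of_real t)"
      have r: "\<bar>Re z - t\<bar> \<le> r" "Im z \<le> r" "\<bar>Re z - t\<bar> > 0"
        using abs_Re_le_cmod[of "z - of_real t"] abs_Im_le_cmod[of "z - of_real t"] elim by (auto simp: r_def)
      have "1 / r = r powr (-1)" using r by (simp add: powr_minus_divide)
      also have "\<dots> = r powr (-1/4) * r powr (-3/4)" by (simp add: powr_add[symmetric])
      also have "\<dots> \<le> Im z powr (-1/4) * \<bar>Re z - t\<bar> powr (-3/4)"
        using r z by (intro mult_mono powr_mono2') auto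
      finally have "\<bar>f t\<bar> * (1 / r) \<le> B * (Im z powr (-1/4) * \<bar>Re z - t\<bar> powr (-3/4))"
        using B(2)[of t] elim B(1) r by (intro mult_mono) auto
      then show ?case by (simp add: norm_divide r_def mult.assoc)
    qed
  qed
  also have "\<dots> = B * Im z powr (-1/4) * (\<integral>t. \<bar>Re z - t\<bar> powr (-3/4) \<partial>seg)" by simp
  also have "\<dots> \<le> B * Im z powr (-1/4) * 10"
    using power_seg(2) B(1) by (intro mult_left_mono) auto
  finally show ?thesis by (simp add: mult_ac)
qed

lemma integrable_product_lborel:
  fixes a b :: "real \<Rightarrow> real"
  assumes a: "integrable lborel a" and b: "integrable lborel b"
  shows "integrable lborel (\<lambda>y. a (fst y) * b (snd y))"
proof -
  have m: "a \<in> borel_measurable borel" "b \<in> borel_measurable borel"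
    using a b by auto
  have "integrable (lborel \<Otimes>\<^sub>M lborel) (\<lambda>y. a (fst y) * b (snd y))"
  proof (rule lborel_pair.Fubini_integrable)
    show "(\<lambda>y. a (fst y) * b (snd y)) \<in> borel_measurable (lborel \<Otimes>\<^sub>M lborel)"
      using m by measurable
    show "integrable lborel (\<lambda>x. \<integral>y. norm (a (fst (x, y)) * b (snd (x, y))) \<partial>lborel)"
      using a by (simp add: abs_mult)
    show "AE x in lborel. integrable lborel (\<lambda>y. a (fst (x, y)) * b (snd (x, y)))"
      using b by simp
  qed
  then show ?thesis by (simp add: lborel_prod)
qed

lemma locally_finite_energy_logpot:
  assumes f: "continuous_on UNIV f"
  shows "locally_finite_energy (\<lambda>y. c + k * logpot f y)"
  unfolding locally_finite_energy_def
proof (intro allI impI)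
  fix R :: real assume R: "R > 0"
  have bf: "bdd_borel f" by (rule bdd_borel_continuous[OF f])
  obtain B where B: "B \<ge> 0" "\<And>t. t \<in> {-1<..<1} \<Longrightarrow> \<bar>f t\<bar> \<le> B" using bdd_borelE[OF bf] by blast
  define v where "v y = c + k * logpot f y" for y
  define G where "G z = of_real c + of_real k * complex_pot f z" for z
  have G: "G holomorphic_on upper"
    unfolding G_def by (intro holomorphic_intros complex_pot_holomorphic f)
  have v: "v y = re_part G y" if "y \<in> half_plane" for y
    by (simp add: v_def G_def re_part_def logpot_eq_complex_pot[OF f that])
  have dG: "deriv G z = of_real k * deriv (complex_pot f) z" if "Im z > 0" for z
    unfolding G_def using complex_pot_derivative[OF f that]
    by (intro DERIV_imp_deriv) (auto intro!: derivative_eq_intros simp: DERIV_imp_deriv)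
  have h: "harmonic_on v half_plane" by (rule harmonic_on_re_part[OF G v])
  let ?S = "ball 0 R \<inter> half_plane" and ?E = "\<lambda>y. (partial1 v y)\<^sup>2 + (partial2 v y)\<^sup>2"
  define C where "C = (k * (10 * B))\<^sup>2"
  have E: "?E y \<le> C * (1 + cut_power (snd y))" if "y \<in> half_plane" for y
  proof -
    define z where "z = Complex (fst y) (snd y)"
    have z: "Im z > 0" "Im z = snd y" using that by (auto simp: z_def half_plane_def)
    have "partial1 v y = Re (deriv G z)" "partial2 v y = - Im (deriv G z)"
      using partial1_cong_half_plane[of v "re_part G", OF v that] partial2_cong_half_plane[of v "re_part G", OF v that]
        re_part_differentiable(2,3)[OF G that]
      by (simp_all add: re_part_def[of "deriv G"] re_part_def[of "\<lambda>z. \<i> * deriv G z"] z_def)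
    then have "?E y = (cmod (deriv G z))\<^sup>2" by (simp add: cmod_power2)
    also have "cmod (deriv G z) \<le> \<bar>k\<bar> * (10 * B * Im z powr (-1/4))"
      unfolding dG[OF z(1)] norm_mult norm_of_real
      by (intro mult_left_mono deriv_complex_pot_bound f z B) auto
    then have "(cmod (deriv G z))\<^sup>2 \<le> (\<bar>k\<bar> * (10 * B * Im z powr (-1/4)))\<^sup>2" by (intro power_mono) auto
    also have "(\<bar>k\<bar> * (10 * B * Im z powr (-1/4)))\<^sup>2 = C * (snd y powr (-1/4))\<^sup>2"
      by (simp add: C_def z power_mult_distrib)
    also have "(snd y powr (-1/4))\<^sup>2 = snd y powr (-1/2)"
      using z by (simp add: power2_eq_square powr_add[symmetric])
    also have "snd y powr (-1/2) \<le> 1 + cut_power (snd y)"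
    proof (cases "snd y < 1")
      case True
      have "snd y powr (-1/2) \<le> snd y powr (-3/4)" using True z by (intro powr_mono') auto
      then show ?thesis using True z by (simp add: cut_power_def)
    next
      case False
      have "snd y powr (-1/2) \<le> snd y powr 0" using False by (intro powr_mono) auto
      then show ?thesis using False z by (simp add: cut_power_def)
    qed
    then have "C * snd y powr (-1/2) \<le> C * (1 + cut_power (snd y))" by (intro mult_left_mono) (auto simp: C_def)
    finally show ?thesis .
  qed
  have oS: "?S \<in> sets borel" using open_half_plane by auto
  have cE: "continuous_on ?S ?E"
    using h by (intro continuous_intros continuous_on_subset[OF differentiable_imp_continuous_on])
      (auto simp: harmonic_on_def)
  have ia: "integrable lborel (indicator {-R..R} :: real \<Rightarrow> real)"
    using R by (simp add: integrable_indicator_iff emeasure_lborel_Icc)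
  have ib: "integrable lborel (\<lambda>s. indicator {-R..R} s * (1 + cut_power s))"
  proof -
    have "integrable lborel (\<lambda>s. indicator {-R..R} s + indicator {-R..R} s *\<^sub>R cut_power s)"
      by (intro Bochner_Integration.integrable_add ia integrable_mult_indicator cut_power_integral(1)) auto
    then show ?thesis by (simp add: distrib_left)
  qed
  have ib': "integrable lborel (\<lambda>y. C * (indicator {-R..R} (fst y) * (indicator {-R..R} (snd y) * (1 + cut_power (snd y)))))"
    by (intro integrable_mult_right integrable_product_lborel[OF ia ib])
  show "set_integrable lborel ?S (\<lambda>y. (partial1 (\<lambda>y. c + k * logpot f y) y)\<^sup>2 + (partial2 (\<lambda>y. c + k * logpot f y) y)\<^sup>2)"
    unfolding set_integrable_def v_def[abs_def, symmetric]
  proof (rule Bochner_Integration.integrable_bound[OF ib'])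
    show "(\<lambda>y. indicator ?S y *\<^sub>R ?E y) \<in> borel_measurable lborel"
      using borel_measurable_continuous_on_indicator[OF oS cE] by simp
    show "AE y in lborel. norm (indicator ?S y *\<^sub>R ?E y)
        \<le> norm (C * (indicator {-R..R} (fst y) * (indicator {-R..R} (snd y) * (1 + cut_power (snd y)))))"
    proof (rule AE_I2)
      fix y
      have k0: "cut_power s \<ge> 0" for s by (simp add: cut_power_def)
      have C0: "C \<ge> 0" by (simp add: C_def)
      show "norm (indicator ?S y *\<^sub>R ?E y)
        \<le> norm (C * (indicator {-R..R} (fst y) * (indicator {-R..R} (snd y) * (1 + cut_power (snd y)))))"
      proof (cases "y \<in> ?S")
        case True
        then have "norm y < R" by simp
        then have "\<bar>fst y\<bar> \<le> R" "\<bar>snd y\<bar> \<le> R"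
          using norm_fst_le[of "fst y" "snd y"] norm_snd_le[of "snd y" "fst y"] by auto
        then have "fst y \<in> {-R..R}" "snd y \<in> {-R..R}" by (auto simp: abs_le_iff)
        then show ?thesis using E[of y] True C0 k0[of "snd y"] by simp
      qed simp
    qed
  qed
qed

lemma robin_greenI:
  assumes f: "continuous_on UNIV f"
    and eq: "\<And>x. \<bar>x\<bar> < 1 \<Longrightarrow> f x = A + \<nu> / pi * logpot f (x, 0)"
    and mass: "\<nu> / pi * integral\<^sup>L seg f = 1"
  shows "robin_green \<nu> (\<lambda>y. A + \<nu> / pi * logpot f y)"
    and "((\<lambda>y. A + \<nu> / pi * logpot f y - ln (norm y)) \<longlongrightarrow> A) infinity_in_half_plane"
proof -
  define g where "g y = A + \<nu> / pi * logpot f y" for y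
  define m where "m = integral\<^sup>L seg f"
  have bf: "bdd_borel f" by (rule bdd_borel_continuous[OF f])
  have m: "\<nu> / pi * m = 1" using mass by (simp add: m_def)
  have "((\<lambda>y. A + \<nu> / pi * (logpot f y - ln (norm y) * m)) \<longlongrightarrow> A + \<nu> / pi * 0) infinity_in_half_plane"
    unfolding m_def by (intro tendsto_intros logpot_asymptotics[OF bf])
  moreover have "A + \<nu> / pi * (logpot f y - ln (norm y) * m) = g y - ln (norm y)" for y
    using m unfolding g_def by (metis (no_types, lifting) add_diff_eq mult.left_commute mult.right_neutral right_diff_distrib)
  ultimately have lim: "((\<lambda>y. g y - ln (norm y)) \<longlongrightarrow> A) infinity_in_half_plane" by simp
  then show "((\<lambda>y. A + \<nu> / pi * logpot f y - ln (norm y)) \<longlongrightarrow> A) infinity_in_half_plane"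
    by (simp add: g_def)
  have nd: "((\<lambda>t. g (x, t)) has_real_derivative (if \<bar>x\<bar> < 1 then \<nu> * f x else 0)) (at 0 within {0..})"
    if "\<bar>x\<bar> \<noteq> 1" for x
    using DERIV_add[OF DERIV_const DERIV_cmult[OF vertical_derivative_logpot_boundary[OF f that], of "\<nu> / pi"], of A]
    unfolding g_def by (simp split: if_splits)
  have "mixed_solution (- \<nu>) g"
    unfolding mixed_solution_def
  proof (intro conjI allI impI)
    show "harmonic_on g half_plane" unfolding g_def by (rule harmonic_on_logpot[OF f])
    show "continuous_on closed_half_plane g"
      unfolding g_def by (intro continuous_intros continuous_on_subset[OF logpot_continuous[OF bf]]) auto
    show "locally_finite_energy g" unfolding g_def by (rule locally_finite_energy_logpot[OF f])
    show "has_normal_derivative g (- \<nu> * g (x, 0)) x" if "\<bar>x\<bar> < 1" for x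
      using nd[of x] that eq[OF that] by (simp add: has_normal_derivative_def g_def)
    show "has_normal_derivative g 0 x" if "\<bar>x\<bar> > 1" for x
      using nd[of x] that by (simp add: has_normal_derivative_def)
  qed
  then show "robin_green \<nu> (\<lambda>y. A + \<nu> / pi * logpot f y)"
    using tendsto_imp_bigo_one[OF lim] unfolding robin_green_def g_def by blast
qed


text \<open>The retraction of the line to \<open>[-1, 1]\<close> keeps the fixed point problem inside bounded
  continuous functions on the whole line, although potentials grow logarithmically.\<close>

definition clamp_seg :: "real \<Rightarrow> real" where "clamp_seg x = max (-1) (min 1 x)"

lemma clamp_seg: "\<bar>clamp_seg x\<bar> \<le> 1" "\<bar>x\<bar> \<le> 1 \<Longrightarrow> clamp_seg x = x"
  by (auto simp: clamp_seg_def)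

text \<open>On \<open>[-1, 1]\<close> the potential has operator norm at most \<open>24\<close> for the supremum norm, so
  \<open>h \<mapsto> 1 + \<kappa> K h\<close> contracts by the factor \<open>1/2\<close>. The fixed point has norm at most \<open>2\<close> and
  therefore stays above \<open>1 - 48 / 50 = 1 / 25\<close>, which makes its mass positive.\<close>

lemma integral_equation_solution:
  assumes \<kappa>: "\<bar>\<kappa>\<bar> \<le> 1 / 50"
  obtains h where "continuous_on UNIV h" "\<And>x. \<bar>x\<bar> \<le> 1 \<Longrightarrow> h x = 1 + \<kappa> * logpot h (x, 0)"
    and "integral\<^sup>L seg h > 0"
proof -
  define T0 where "T0 h x = 1 + \<kappa> * logpot h (clamp_seg x, 0)" for h x
  have bd: "\<bar>\<kappa> * logpot h (clamp_seg x, 0)\<bar> \<le> C / 2"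
    if "bdd_borel h" "C \<ge> 0" "\<And>t. \<bar>h t\<bar> \<le> C" for h C x
  proof -
    have "\<bar>logpot h (clamp_seg x, 0)\<bar> \<le> (22 + 2 * norm (clamp_seg x, 0 :: real)) * C"
      by (rule logpot_bound) (use that in auto)
    also have "\<dots> \<le> 24 * C"
      using clamp_seg(1)[of x] that(2) by (intro mult_right_mono) (auto simp: norm_Pair)
    finally have "\<bar>\<kappa>\<bar> * \<bar>logpot h (clamp_seg x, 0)\<bar> \<le> 1 / 50 * (24 * C)"
      using \<kappa> by (intro mult_mono) auto
    then show ?thesis using that(2) by (simp add: abs_mult)
  qed
  have bh: "bdd_borel (apply_bcontfun h)" for h :: "real \<Rightarrow>\<^sub>C real"
    by (rule bdd_borel_continuous) simp
  have cT: "continuous_on UNIV (T0 h)" if "bdd_borel h" for h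
    unfolding T0_def clamp_seg_def
    by (intro continuous_intros continuous_on_compose2[OF logpot_continuous[OF that]]) auto
  have TB: "T0 (apply_bcontfun h) \<in> bcontfun" for h :: "real \<Rightarrow>\<^sub>C real"
  proof (rule bcontfun_normI[OF cT[OF bh]])
    fix x
    have "\<bar>\<kappa> * logpot h (clamp_seg x, 0)\<bar> \<le> norm h / 2"
      by (rule bd[OF bh]) (use norm_bounded[of h] in auto)
    then show "norm (T0 (apply_bcontfun h) x) \<le> 1 + norm h / 2" by (simp add: T0_def)
  qed
  define T :: "(real \<Rightarrow>\<^sub>C real) \<Rightarrow> (real \<Rightarrow>\<^sub>C real)" where "T h = Bcontfun (T0 (apply_bcontfun h))" for h
  have T: "apply_bcontfun (T h) = T0 (apply_bcontfun h)" for h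
    unfolding T_def by (rule Bcontfun_inverse[OF TB])
  have contraction: "dist (T h) (T h') \<le> 1/2 * dist h h'" for h h'
  proof (rule dist_bound)
    fix x
    have "dist (T h x) (T h' x) = \<bar>\<kappa> * logpot (\<lambda>x. h x - h' x) (clamp_seg x, 0)\<bar>"
      by (simp add: T T0_def dist_real_def logpot_diff[OF bh bh] right_diff_distrib)
    also have "\<dots> \<le> dist h h' / 2"
    proof (rule bd)
      show "bdd_borel (\<lambda>x. h x - h' x)"
        by (intro bdd_borel_continuous continuous_intros) auto
      show "\<bar>h t - h' t\<bar> \<le> dist h h'" for t
        using dist_bounded[of h t h'] by (simp add: dist_real_def)
    qed simp
    finally show "dist (T h x) (T h' x) \<le> 1/2 * dist h h'" by simp
  qed
  have "\<exists>!h. T h = h"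
    by (rule banach_fix_type[of "1/2"]) (use contraction in auto)
  then obtain h where h: "T h = h" by blast
  have eq: "apply_bcontfun h x = 1 + \<kappa> * logpot h (clamp_seg x, 0)" for x
    using T[of h] h by (simp add: T0_def fun_eq_iff)
  have le: "\<bar>\<kappa> * logpot h (clamp_seg x, 0)\<bar> \<le> norm h / 2" for x
    by (rule bd[OF bh]) (use norm_bounded[of h] in auto)
  have "norm h \<le> 1 + norm h / 2"
  proof (rule norm_bound)
    show "norm (h x) \<le> 1 + norm h / 2" for x using le[of x] by (simp add: eq[of x])
  qed
  then have "norm h \<le> 2" by simp
  have pos: "h x \<ge> 1 / 25" for x
  proof -
    have "\<bar>logpot h (clamp_seg x, 0)\<bar> \<le> (22 + 2 * norm (clamp_seg x, 0 :: real)) * 2"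
      by (rule logpot_bound[OF bh]) (use norm_bounded[of h] \<open>norm h \<le> 2\<close> in \<open>auto intro: order_trans\<close>)
    also have "\<dots> \<le> 48" using clamp_seg(1)[of x] by (simp add: norm_Pair)
    finally have "\<bar>\<kappa>\<bar> * \<bar>logpot h (clamp_seg x, 0)\<bar> \<le> 1 / 50 * 48"
      using \<kappa> by (intro mult_mono) auto
    then have "\<bar>\<kappa> * logpot h (clamp_seg x, 0)\<bar> \<le> 24 / 25" by (simp add: abs_mult)
    then show ?thesis unfolding eq[of x] by linarith
  qed
  have "2 * (1 / 25) \<le> integral\<^sup>L seg h"
    unfolding integral_seg_const[symmetric]
    by (intro integral_mono bdd_borel_integrable bh bdd_borel_const pos)
  moreover have "h x = 1 + \<kappa> * logpot h (x, 0)" if "\<bar>x\<bar> \<le> 1" for x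
    using eq[of x] clamp_seg(2)[OF that] by simp
  ultimately show ?thesis
    by (intro that[of "apply_bcontfun h"]) simp_all
qed

text \<open>The solution of the integral equation is rescaled so that its mass is \<open>\<pi> / \<nu>\<close>, which makes
  the coefficient of \<open>ln \<bar>y\<bar>\<close> equal to \<open>1\<close>.\<close>

lemma robin_green_exists:
  assumes \<nu>: "\<nu> \<noteq> 0" "\<bar>\<nu>\<bar> \<le> 1 / 50"
  obtains g A where "robin_green \<nu> g" "((\<lambda>y. g y - ln (norm y)) \<longlongrightarrow> A) infinity_in_half_plane"
proof -
  have "\<bar>\<nu> / pi\<bar> \<le> \<bar>\<nu>\<bar> / 1" unfolding abs_divide using pi_gt3 by (intro divide_left_mono) auto
  then have "\<bar>\<nu> / pi\<bar> \<le> 1 / 50" using \<nu> by linarith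
  from integral_equation_solution[OF this] obtain h where h: "continuous_on UNIV h"
    "\<And>x. \<bar>x\<bar> \<le> 1 \<Longrightarrow> h x = 1 + \<nu> / pi * logpot h (x, 0)" "integral\<^sup>L seg h > 0" by blast
  define A where "A = pi / (\<nu> * integral\<^sup>L seg h)"
  define f where "f x = A * h x" for x
  have "continuous_on UNIV f" unfolding f_def by (intro continuous_intros h)
  moreover have "f x = A + \<nu> / pi * logpot f (x, 0)" if "\<bar>x\<bar> < 1" for x
    unfolding f_def logpot_cmult using h(2)[of x] that by (simp add: algebra_simps)
  moreover have "\<nu> / pi * integral\<^sup>L seg f = 1"
    unfolding f_def A_def using h(3) \<nu> by simp
  ultimately show ?thesis using robin_greenI[of f A \<nu>] that by blast
qed

section \<open>Expansion in the eigenfunctions\<close>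

definition segpot :: "(real \<Rightarrow> real) \<Rightarrow> real \<Rightarrow> real" where
  "segpot f x = logpot f (x, 0)"

definition ip :: "(real \<Rightarrow> real) \<Rightarrow> (real \<Rightarrow> real) \<Rightarrow> real" where
  "ip f g = (\<integral>x. f x * g x \<partial>seg)"

lemma segpot_eq: "segpot f x = (\<integral>t. ln \<bar>x - t\<bar> * f t \<partial>seg)"
  by (simp add: segpot_def logpot_def norm_Pair)

lemma bdd_borel_segpot: "bdd_borel f \<Longrightarrow> bdd_borel (segpot f)"
  unfolding segpot_def
  by (intro bdd_borel_continuous, rule continuous_on_compose2[OF logpot_continuous]) (auto intro!: continuous_intros)

lemma ip_commute: "ip f g = ip g f"
  by (simp add: ip_def mult.commute)

lemma ip_integrable: "bdd_borel f \<Longrightarrow> bdd_borel g \<Longrightarrow> integrable seg (\<lambda>x. f x * g x)"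
  by (intro bdd_borel_integrable bdd_borel_mult)

lemma ip_add:
  assumes "bdd_borel f" "bdd_borel g" "bdd_borel h"
  shows "ip (\<lambda>x. f x + g x) h = ip f h + ip g h"
  unfolding ip_def distrib_right by (intro Bochner_Integration.integral_add ip_integrable assms)

lemma ip_diff:
  assumes "bdd_borel f" "bdd_borel g" "bdd_borel h"
  shows "ip (\<lambda>x. f x - g x) h = ip f h - ip g h"
  unfolding ip_def left_diff_distrib by (intro Bochner_Integration.integral_diff ip_integrable assms)

lemma ip_cmult: "ip (\<lambda>x. c * f x) h = c * ip f h"
  unfolding ip_def by (subst integral_mult_right_zero[symmetric]) (simp add: mult_ac)

lemma ip_one: "ip f (\<lambda>_. 1) = integral\<^sup>L seg f" "ip (\<lambda>_. 1) f = integral\<^sup>L seg f"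
  by (simp_all add: ip_def)

lemma ip_cong_seg: "(\<And>x. x \<in> {-1<..<1} \<Longrightarrow> f x = f' x) \<Longrightarrow> ip f g = ip f' g"
  unfolding ip_def by (intro Bochner_Integration.integral_cong refl) auto

lemma bdd_borel_diff: "bdd_borel f \<Longrightarrow> bdd_borel g \<Longrightarrow> bdd_borel (\<lambda>x. f x - g x)"
  using bdd_borel_add[of f "\<lambda>x. -1 * g x"] bdd_borel_cmult[of g "-1"] by simp

text \<open>Fubini's theorem for the symmetric kernel \<open>ln \<bar>x - t\<bar>\<close>, whose absolute value has bounded
  integrals over the segment.\<close>

lemma segpot_symmetric:
  assumes f: "bdd_borel f" and g: "bdd_borel g"
  shows "ip (segpot f) g = ip f (segpot g)"
proof -
  obtain B where B: "B \<ge> 0" "\<And>t. t \<in> {-1<..<1} \<Longrightarrow> \<bar>f t\<bar> \<le> B" using bdd_borelE[OF f] by blast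
  obtain C where C: "C \<ge> 0" "\<And>t. t \<in> {-1<..<1} \<Longrightarrow> \<bar>g t\<bar> \<le> C" using bdd_borelE[OF g] by blast
  define F where "F = (\<lambda>(x, t). ln \<bar>x - t\<bar> * f t * g x)"
  have fm: "f \<in> borel_measurable seg" "g \<in> borel_measurable seg"
    using f g by (auto intro: borel_measurable_seg bdd_borel_measurable)
  have Fm: "F \<in> borel_measurable (seg \<Otimes>\<^sub>M seg)"
  proof -
    have a: "(\<lambda>p. fst p) \<in> borel_measurable (seg \<Otimes>\<^sub>M seg)" "(\<lambda>p. snd p) \<in> borel_measurable (seg \<Otimes>\<^sub>M seg)"
      using measurable_compose[OF measurable_fst ident_measurable_seg] measurable_compose[OF measurable_snd ident_measurable_seg]
      by auto
    have b: "(\<lambda>p. f (snd p)) \<in> borel_measurable (seg \<Otimes>\<^sub>M seg)" "(\<lambda>p. g (fst p)) \<in> borel_measurable (seg \<Otimes>\<^sub>M seg)"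
      by (rule measurable_compose[OF measurable_snd fm(1)], rule measurable_compose[OF measurable_fst fm(2)])
    show ?thesis unfolding F_def split_beta
      by (intro borel_measurable_times borel_measurable_ln borel_measurable_abs borel_measurable_diff a b)
  qed
  have i2: "integrable seg (\<lambda>t. F (x, t))" for x
    using integrable_mult_left[OF logpot_integrable[OF f, of "(x, 0)"], of "g x"]
    by (simp add: F_def norm_Pair)
  have "integrable (seg \<Otimes>\<^sub>M seg) F"
  proof (rule seg2.Fubini_integrable[OF Fm])
    show "AE x in seg. integrable seg (\<lambda>t. F (x, t))" using i2 by simp
    show "integrable seg (\<lambda>x. \<integral>t. norm (F (x, t)) \<partial>seg)"
    proof (rule seg.integrable_const_bound[of _ "24 * B * C"])
      have "(\<lambda>p. norm (F p)) \<in> borel_measurable (seg \<Otimes>\<^sub>M seg)" using Fm by measurable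
      then show "(\<lambda>x. \<integral>t. norm (F (x, t)) \<partial>seg) \<in> borel_measurable seg"
        using seg.borel_measurable_lebesgue_integral[of "\<lambda>x t. norm (F (x, t))" seg] by (simp add: split_beta)
      show "AE x in seg. norm (\<integral>t. norm (F (x, t)) \<partial>seg) \<le> 24 * B * C"
        using AE_space
      proof eventually_elim
        case (elim x)
        have ik: "integrable seg (\<lambda>t. (2 * \<bar>x - t\<bar> powr (-3/4) + 2) * (B * C))"
          by (intro integrable_mult_left Bochner_Integration.integrable_add integrable_mult_right power_seg) auto
        have "\<bar>\<integral>t. norm (F (x, t)) \<partial>seg\<bar> \<le> (\<integral>t. (2 * \<bar>x - t\<bar> powr (-3/4) + 2) * (B * C) \<partial>seg)"
        proof (rule abs_seg_integral_le[OF integrable_norm[OF i2] ik])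
          show "AE t in seg. \<bar>norm (F (x, t))\<bar> \<le> (2 * \<bar>x - t\<bar> powr (-3/4) + 2) * (B * C)"
            using AE_space AE_seg_neq[of x]
          proof eventually_elim
            case (elim t)
            have "\<bar>ln \<bar>x - t\<bar>\<bar> \<le> 2 * \<bar>x - t\<bar> powr (-3/4) + (norm (x, 0 :: real) + 1)"
              using abs_ln_norm_le[of t "(x, 0)"] elim by (simp add: norm_Pair)
            also have "\<dots> \<le> 2 * \<bar>x - t\<bar> powr (-3/4) + 2"
              using \<open>x \<in> space seg\<close> by (auto simp: norm_Pair)
            finally have "\<bar>ln \<bar>x - t\<bar>\<bar> * (\<bar>f t\<bar> * \<bar>g x\<bar>) \<le> (2 * \<bar>x - t\<bar> powr (-3/4) + 2) * (B * C)"
              using B(2)[of t] C(2)[of x] B(1) elim \<open>x \<in> space seg\<close> by (intro mult_mono) auto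
            then show ?case by (simp add: F_def abs_mult mult.assoc)
          qed
        qed
        also have "\<dots> = (2 * (\<integral>t. \<bar>x - t\<bar> powr (-3/4) \<partial>seg) + 4) * (B * C)"
          using power_seg(1)[of x] by simp
        also have "\<dots> \<le> 24 * (B * C)"
          using power_seg(2)[of x] B(1) C(1) by (intro mult_right_mono) auto
        finally show ?case by (simp add: mult.assoc)
      qed
    qed
  qed
  then have "(\<integral>t. (\<integral>x. F (x, t) \<partial>seg) \<partial>seg) = (\<integral>x. (\<integral>t. F (x, t) \<partial>seg) \<partial>seg)"
    using seg2.Fubini_integral[of "\<lambda>x t. F (x, t)"] by simp
  moreover have "(\<integral>t. F (x, t) \<partial>seg) = segpot f x * g x" for x
    unfolding F_def segpot_eq by simp
  moreover have "(\<integral>x. F (x, t) \<partial>seg) = f t * segpot g t" for t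
    unfolding F_def segpot_eq by (subst integral_mult_right_zero[symmetric]) (simp add: mult_ac abs_minus_commute)
  ultimately show ?thesis by (simp add: ip_def)
qed

locale steklov =
  fixes \<mu> :: "nat \<Rightarrow> real" and \<Psi> :: "nat \<Rightarrow> real \<times> real \<Rightarrow> real"
  assumes system: "steklov_neumann_system \<mu> \<Psi>"
begin

definition trace :: "nat \<Rightarrow> real \<Rightarrow> real" where "trace k x = \<Psi> k (x, 0)"
definition far :: "nat \<Rightarrow> real" where "far k = value_at_infinity (\<Psi> k)"

lemma eigen:
  shows "continuous_on UNIV (trace k)"
    and "\<mu> k * integral\<^sup>L seg (trace k) = 0"
    and "x \<in> {-1<..<1} \<Longrightarrow> trace k x = far k - \<mu> k / pi * segpot (trace k) x"
    and "(\<Psi> k \<longlongrightarrow> far k) infinity_in_half_plane"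
proof -
  have "steklov_neumann (\<mu> k) (\<Psi> k)" using system by (simp add: steklov_neumann_system_def)
  then have sol: "mixed_solution (\<mu> k) (\<Psi> k)" "(\<lambda>y. \<Psi> k y - 0 * ln (norm y)) \<in> O[infinity_in_half_plane](\<lambda>_. 1)"
    by (auto simp: steklov_neumann_def)
  from mixed_solution_representation[OF this] obtain d where
    d: "continuous_on UNIV (\<lambda>x. \<Psi> k (x, 0))" "\<mu> k / pi * integral\<^sup>L seg (\<lambda>x. \<Psi> k (x, 0)) = - 0"
      "\<And>x. \<bar>x\<bar> < 1 \<Longrightarrow> \<Psi> k (x, 0) = d - \<mu> k / pi * logpot (\<lambda>x. \<Psi> k (x, 0)) (x, 0)"
      "((\<lambda>y. \<Psi> k y - 0 * ln (norm y)) \<longlongrightarrow> d) infinity_in_half_plane" by blast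
  have cd: "far k = d" unfolding far_def value_at_infinity_def
    by (rule tendsto_Lim) (use d(4) in auto)
  show "continuous_on UNIV (trace k)" using d(1) by (simp add: trace_def[abs_def])
  show "\<mu> k * integral\<^sup>L seg (trace k) = 0" using d(2) by (simp add: trace_def[abs_def])
  show "trace k x = far k - \<mu> k / pi * segpot (trace k) x" if "x \<in> {-1<..<1}"
    using d(3)[of x] that by (simp add: trace_def[abs_def] cd segpot_def abs_less_iff)
  show "(\<Psi> k \<longlongrightarrow> far k) infinity_in_half_plane" using d(4) by (simp add: cd)
qed

lemma bdd_trace: "bdd_borel (trace k)" by (rule bdd_borel_continuous[OF eigen(1)])

lemma inner_L2_eq: "inner_L2 f h = ip f h"
  by (simp add: inner_L2_def ip_def integral_seg)

lemma orthonormal: "ip (trace j) (trace k) = (if j = k then 1 else 0)"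
proof -
  have "orthonormal_basis_L2 trace" using system by (simp add: steklov_neumann_system_def trace_def[abs_def])
  then show ?thesis by (simp add: orthonormal_basis_L2_def inner_L2_eq)
qed

lemma trace_0: "trace 0 x = 1 / sqrt 2"
  using system by (auto simp: steklov_neumann_system_def trace_def closed_half_plane_def)

lemma ip_trace_0: "ip f (trace 0) = integral\<^sup>L seg f / sqrt 2"
  unfolding ip_def trace_0 by simp

lemma mean_trace: "integral\<^sup>L seg (trace (Suc k)) = 0"
proof -
  have "ip (trace (Suc k)) (trace 0) = 0" by (simp add: orthonormal)
  then show ?thesis by (simp add: ip_trace_0)
qed

text \<open>The integral in the definition of completeness is the squared distance of \<open>f\<close> to its
  projection, which orthonormality turns into the defect in Bessel's inequality.\<close>

lemma parseval_square:
  assumes f: "bdd_borel f"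
  shows "(\<lambda>k. (ip f (trace k))\<^sup>2) sums ip f f"
proof -
  define S where "S N x = (\<Sum>k<N. ip f (trace k) * trace k x)" for N x
  define r where "r N x = f x - S N x" for N x
  have bS: "bdd_borel (S N)" for N
  proof (induction N)
    case 0 show ?case unfolding S_def by (simp add: bdd_borel_const)
  next
    case (Suc N)
    then show ?case unfolding S_def sum.lessThan_Suc by (intro bdd_borel_add bdd_borel_cmult bdd_trace)
  qed
  have br: "bdd_borel (r N)" for N unfolding r_def by (intro bdd_borel_diff f bS)
  have ipS: "ip (S N) (trace n) = (\<Sum>k<N. ip f (trace k) * ip (trace k) (trace n))" for N n
  proof (induction N)
    case 0 show ?case unfolding S_def by (simp add: ip_def)
  next
    case (Suc N)
    have "ip (S (Suc N)) (trace n) = ip (\<lambda>x. S N x + ip f (trace N) * trace N x) (trace n)"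
      by (simp add: S_def[abs_def])
    also have "\<dots> = ip (S N) (trace n) + ip f (trace N) * ip (trace N) (trace n)"
      by (subst ip_add[OF bS bdd_borel_cmult[OF bdd_trace] bdd_trace]) (simp add: ip_cmult)
    finally show ?case using Suc by simp
  qed
  have ipr: "ip (r N) (trace N) = ip f (trace N)" for N
  proof -
    have "ip (r N) (trace N) = ip f (trace N) - ip (S N) (trace N)"
      unfolding r_def by (rule ip_diff[OF f bS bdd_trace])
    also have "ip (S N) (trace N) = 0" unfolding ipS orthonormal by (intro sum.neutral) auto
    finally show ?thesis by simp
  qed
  have sq: "ip (r N) (r N) = ip f f - (\<Sum>k<N. (ip f (trace k))\<^sup>2)" for N
  proof (induction N)
    case 0 show ?case by (simp add: r_def S_def)
  next
    case (Suc N)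
    define a where "a = ip f (trace N)"
    have rr: "r (Suc N) = (\<lambda>x. r N x - a * trace N x)" by (auto simp: r_def S_def a_def)
    have b: "bdd_borel (\<lambda>x. r N x - a * trace N x)" by (intro bdd_borel_diff br bdd_borel_cmult bdd_trace)
    have "ip (r (Suc N)) (r (Suc N)) = ip (r N) (\<lambda>x. r N x - a * trace N x) - a * ip (trace N) (\<lambda>x. r N x - a * trace N x)"
      unfolding rr by (subst ip_diff[OF br bdd_borel_cmult[OF bdd_trace] b]) (simp add: ip_cmult)
    also have "ip (r N) (\<lambda>x. r N x - a * trace N x) = ip (r N) (r N) - a * ip (r N) (trace N)"
      unfolding ip_commute[of "r N" "\<lambda>x. r N x - a * trace N x"]
      by (subst ip_diff[OF br bdd_borel_cmult[OF bdd_trace] br]) (simp add: ip_cmult ip_commute[of "trace N" "r N"])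
    also have "ip (trace N) (\<lambda>x. r N x - a * trace N x) = ip (r N) (trace N) - a * ip (trace N) (trace N)"
      unfolding ip_commute[of "trace N" "\<lambda>x. r N x - a * trace N x"]
      by (subst ip_diff[OF br bdd_borel_cmult[OF bdd_trace] bdd_trace]) (simp add: ip_cmult)
    finally show ?case using Suc ipr[of N] by (simp add: orthonormal a_def power2_eq_square)
  qed
  have "orthonormal_basis_L2 trace" using system by (simp add: steklov_neumann_system_def trace_def[abs_def])
  moreover have "square_integrable f"
    unfolding square_integrable_def integrable_seg_iff[symmetric]
    using f ip_integrable[OF f f] by (auto simp: power2_eq_square intro: bdd_borel_measurable)
  ultimately have "(\<lambda>N. set_lebesgue_integral lborel {-1<..<1}
               (\<lambda>x. (f x - (\<Sum>k<N. inner_L2 f (trace k) * trace k x))\<^sup>2)) \<longlonglongrightarrow> 0"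
    unfolding orthonormal_basis_L2_def by blast
  then have "(\<lambda>N. ip (r N) (r N)) \<longlonglongrightarrow> 0"
    unfolding inner_L2_eq integral_seg[symmetric] ip_def r_def S_def power2_eq_square .
  then have "(\<lambda>N. ip f f - (\<Sum>k<N. (ip f (trace k))\<^sup>2)) \<longlonglongrightarrow> 0" by (simp only: sq)
  from tendsto_diff[OF tendsto_const[of "ip f f"] this]
  show ?thesis unfolding sums_def by simp
qed

lemma parseval:
  assumes f: "bdd_borel f" and g: "bdd_borel g"
  shows "(\<lambda>k. ip f (trace k) * ip g (trace k)) sums ip f g"
proof -
  define p where "p x = f x + g x" for x
  define m where "m x = f x - g x" for x
  have b: "bdd_borel p" "bdd_borel m"
    unfolding p_def[abs_def] m_def[abs_def] by (intro bdd_borel_add bdd_borel_diff f g)+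
  have p: "ip p h = ip f h + ip g h" and m: "ip m h = ip f h - ip g h" if "bdd_borel h" for h
    unfolding p_def[abs_def] m_def[abs_def] by (rule ip_add[OF f g that], rule ip_diff[OF f g that])
  have *: "(\<lambda>k. 1/4 * ((ip p (trace k))\<^sup>2 - (ip m (trace k))\<^sup>2)) sums (1/4 * (ip p p - ip m m))"
    by (intro sums_mult sums_diff parseval_square b)
  have "ip p p = ip f f + 2 * ip f g + ip g g"
    unfolding p[OF b(1)] ip_commute[of f p] ip_commute[of g p] p[OF f] p[OF g] ip_commute[of g f] by simp
  moreover have "ip m m = ip f f - 2 * ip f g + ip g g"
    unfolding m[OF b(2)] ip_commute[of f m] ip_commute[of g m] m[OF f] m[OF g] ip_commute[of g f] by simp
  ultimately have "1/4 * (ip p p - ip m m) = ip f g" by simp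
  moreover have "1/4 * ((ip p (trace k))\<^sup>2 - (ip m (trace k))\<^sup>2) = ip f (trace k) * ip g (trace k)" for k
    unfolding p[OF bdd_trace] m[OF bdd_trace] by (simp add: power2_eq_square algebra_simps)
  ultimately show ?thesis using * by (simp only:)
qed

lemma parseval_Suc:
  assumes f: "bdd_borel f" and g: "bdd_borel g"
  shows "(\<lambda>k. ip f (trace (Suc k)) * ip g (trace (Suc k))) sums (ip f g - integral\<^sup>L seg f * integral\<^sup>L seg g / 2)"
proof -
  have "(\<lambda>k. ip f (trace (Suc k)) * ip g (trace (Suc k))) sums (ip f g - ip f (trace 0) * ip g (trace 0))"
    using parseval[OF f g] by (subst sums_Suc_iff) simp
  then show ?thesis by (simp add: ip_trace_0)
qed

text \<open>An eigenfunction with eigenvalue \<open>0\<close> is constant by its representation, hence a multiple of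
  the trace of \<open>\<Psi> 0\<close>, to which the later ones are orthogonal.\<close>

lemma mu_pos: "\<mu> (Suc k) > 0"
proof -
  have "\<mu> 0 \<le> \<mu> (Suc k)" using system by (intro monoD[of \<mu>]) (auto simp: steklov_neumann_system_def)
  then have "\<mu> (Suc k) \<ge> 0" using system by (simp add: steklov_neumann_system_def)
  moreover have "\<mu> (Suc k) \<noteq> 0"
  proof
    assume 0: "\<mu> (Suc k) = 0"
    have "ip (trace (Suc k)) (trace (Suc k)) = ip (\<lambda>_. far (Suc k)) (trace (Suc k))"
      by (rule ip_cong_seg) (use eigen(3)[of _ "Suc k"] 0 in simp)
    also have "\<dots> = 0" using mean_trace[of k] by (simp add: ip_def)
    finally show False by (simp add: orthonormal)
  qed
  ultimately show ?thesis by simp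
qed

lemma segpot_trace: "x \<in> {-1<..<1} \<Longrightarrow> segpot (trace (Suc k)) x = pi / \<mu> (Suc k) * (far (Suc k) - trace (Suc k) x)"
  using eigen(3)[of x "Suc k"] mu_pos[of k] by (simp add: field_simps)

text \<open>\<open>e\<^sub>k\<close> would be an eigenfunction of \<open>K\<close> but for the constant \<open>\<Psi>\<^sub>k(\<infinity>)\<close>, which is seen only by the
  mass of \<open>f\<close>.\<close>

lemma ip_segpot_trace:
  assumes f: "bdd_borel f"
  shows "ip (segpot f) (trace (Suc k)) = pi / \<mu> (Suc k) * (far (Suc k) * integral\<^sup>L seg f - ip f (trace (Suc k)))"
proof -
  have "ip (segpot f) (trace (Suc k)) = ip (segpot (trace (Suc k))) f"
    by (rule trans[OF segpot_symmetric[OF f bdd_trace] ip_commute])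
  also have "\<dots> = ip (\<lambda>x. pi / \<mu> (Suc k) * (far (Suc k) - trace (Suc k) x)) f"
    by (rule ip_cong_seg) (rule segpot_trace)
  also have "\<dots> = pi / \<mu> (Suc k) * (far (Suc k) * integral\<^sup>L seg f - ip f (trace (Suc k)))"
    unfolding ip_cmult
    by (subst ip_diff[OF bdd_borel_const bdd_trace f]) (simp add: ip_commute[of "trace (Suc k)" f] ip_def[of "\<lambda>_. far (Suc k)"])
  finally show ?thesis .
qed

end

section \<open>The arcsine density\<close>

definition logcos :: "real \<Rightarrow> real \<Rightarrow> real" where
  "logcos x \<phi> = ln \<bar>x - cos \<phi>\<bar>"

text \<open>The product formula for \<open>cos \<theta> - cos \<phi>\<close> has two sine factors, both of which are at least
  \<open>sin (\<bar>\<theta> - \<phi>\<bar> / 2)\<close>; this is estimated by Jordan's inequality.\<close>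

lemma abs_cos_diff_ge:
  assumes "\<theta> \<in> {0..pi}" "\<phi> \<in> {0..pi}"
  shows "2 * (\<bar>\<theta> - \<phi>\<bar> / pi)\<^sup>2 \<le> \<bar>cos \<theta> - cos \<phi>\<bar>"
proof -
  have jordan: "2 * x / pi \<le> sin x" if "0 \<le> x" "x \<le> pi / 2" for x
  proof -
    have "concave_on {0..pi} sin"
    proof (rule f''_le0_imp_concave[where f' = cos and f'' = "\<lambda>x. - sin x"])
      show "- sin x \<le> 0" if "x \<in> {0..pi}" for x using that sin_ge_zero by auto
    qed (auto intro!: derivative_eq_intros)
    moreover define t where "t = 2 * x / pi"
    have "0 \<le> t" "t \<le> 1" using that by (auto simp: t_def field_simps)
    ultimately have "sin ((1 - t) *\<^sub>R 0 + t *\<^sub>R (pi / 2)) \<ge> (1 - t) * sin 0 + t * sin (pi / 2)"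
      by (intro concave_onD) auto
    then show ?thesis by (simp add: t_def)
  qed
  define d where "d = \<bar>\<theta> - \<phi>\<bar> / 2"
  define s where "s = (\<theta> + \<phi>) / 2"
  have d: "0 \<le> d" "d \<le> pi / 2" using assms by (auto simp: d_def abs_if)
  have s: "d \<le> s" "s \<le> pi - d" using assms by (auto simp: d_def s_def abs_if field_simps)
  have sd: "2 * d / pi \<le> sin d" by (rule jordan[OF d])
  have "sin d \<le> sin s"
  proof (cases "s \<le> pi / 2")
    case True
    then show ?thesis using s d by (intro sin_monotone_2pi_le) auto
  next
    case False
    then have "sin d \<le> sin (pi - s)" using s d by (intro sin_monotone_2pi_le) auto
    then show ?thesis by simp
  qed
  then have ss: "2 * d / pi \<le> sin s" using sd by linarith
  have "\<bar>cos \<theta> - cos \<phi>\<bar> = 2 * \<bar>sin s\<bar> * \<bar>sin ((\<phi> - \<theta>) / 2)\<bar>"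
    by (simp add: cos_diff_cos abs_mult s_def)
  also have "\<bar>sin ((\<phi> - \<theta>) / 2)\<bar> = sin d"
  proof (cases "\<theta> \<le> \<phi>")
    case True
    then have e: "(\<phi> - \<theta>) / 2 = d" by (simp add: d_def)
    show ?thesis unfolding e using d sin_ge_zero[of d] by simp
  next
    case False
    then have e: "(\<phi> - \<theta>) / 2 = - d" by (simp add: d_def diff_divide_distrib)
    show ?thesis unfolding e using d sin_ge_zero[of d] by simp
  qed
  finally have e: "\<bar>cos \<theta> - cos \<phi>\<bar> = 2 * \<bar>sin s\<bar> * sin d" .
  have d0: "2 * d / pi \<ge> 0" using d by simp
  have "(2 * d / pi) * (2 * d / pi) \<le> \<bar>sin s\<bar> * sin d"
    using sd ss d0 by (intro mult_mono) auto
  then show ?thesis unfolding e by (simp add: d_def power2_eq_square)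
qed

lemma abs_logcos_le:
  assumes "\<theta> \<in> {0..pi}" "\<phi> \<in> {0..pi}" "\<theta> \<noteq> \<phi>"
  shows "\<bar>logcos (cos \<theta>) \<phi>\<bar> \<le> 1 + 16 * \<bar>\<theta> - \<phi>\<bar> powr (-3/4)"
proof -
  define d where "d = \<bar>\<theta> - \<phi>\<bar> / pi"
  have d: "d > 0" "d \<le> 1" using assms by (auto simp: d_def abs_if)
  have ge: "2 * d\<^sup>2 \<le> \<bar>cos \<theta> - cos \<phi>\<bar>" unfolding d_def by (rule abs_cos_diff_ge) (use assms in auto)
  have "d\<^sup>2 > 0" using d by simp
  then have p: "\<bar>cos \<theta> - cos \<phi>\<bar> > 0" using ge by linarith
  have "\<bar>cos \<theta> - cos \<phi>\<bar> \<le> 2"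
    using abs_cos_le_one[of \<theta>] abs_cos_le_one[of \<phi>] by linarith
  then have "ln \<bar>cos \<theta> - cos \<phi>\<bar> \<le> ln 2" using p by simp
  then have up: "ln \<bar>cos \<theta> - cos \<phi>\<bar> \<le> 1" using ln_2_less_1 by linarith
  have "ln (2 * d\<^sup>2) \<le> ln \<bar>cos \<theta> - cos \<phi>\<bar>" by (rule ln_mono) (use ge d in auto)
  moreover have "ln (2 * d\<^sup>2) = ln 2 + 2 * ln d" using d by (simp add: ln_mult ln_realpow)
  moreover have "ln 2 > (0::real)" by simp
  moreover have "- ln d \<le> 2 * d powr (-3/4)"
  proof -
    have "ln (d powr (-3/4)) \<le> d powr (-3/4) - 1" using d by (intro ln_le_minus_one) simp
    then have "(-3/4) * ln d \<le> d powr (-3/4)" using d by (simp add: ln_powr)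
    moreover have "d powr (-3/4) \<ge> 0" by simp
    ultimately show ?thesis by linarith
  qed
  ultimately have lo: "- ln \<bar>cos \<theta> - cos \<phi>\<bar> \<le> 4 * d powr (-3/4)" by linarith
  have "d powr (-3/4) = \<bar>\<theta> - \<phi>\<bar> powr (-3/4) * pi powr (3/4)"
    using powr_minus_divide[of pi "3/4"] pi_gt_zero by (simp add: d_def powr_divide)
  also have "\<dots> \<le> \<bar>\<theta> - \<phi>\<bar> powr (-3/4) * 4"
  proof (intro mult_left_mono)
    have "pi powr (3/4) \<le> pi powr 1" using pi_gt3 by (intro powr_mono) auto
    also have "pi powr 1 = pi" by simp
    finally show "pi powr (3/4) \<le> 4" using pi_less_4 by linarith
  qed simp
  finally have lo': "- ln \<bar>cos \<theta> - cos \<phi>\<bar> \<le> 16 * \<bar>\<theta> - \<phi>\<bar> powr (-3/4)" using lo by linarith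
  have "\<bar>\<theta> - \<phi>\<bar> powr (-3/4) \<ge> 0" by simp
  then show ?thesis using up lo' unfolding logcos_def abs_le_iff by linarith
qed

lemma logcos_measurable [measurable]: "logcos x \<in> borel_measurable borel"
  unfolding logcos_def[abs_def] by measurable

lemma logcos_integrable:
  assumes "\<bar>x\<bar> \<le> 1"
  shows "set_integrable lborel {0<..<pi} (logcos x)"
    and "(LINT \<phi>:{0<..<pi}|lborel. \<bar>logcos x \<phi>\<bar>) \<le> 200"
proof -
  define \<theta> where "\<theta> = arccos x"
  have x: "-1 \<le> x" "x \<le> 1" using assms by auto
  have \<theta>: "\<theta> \<in> {0..pi}" "cos \<theta> = x"
    using arccos[OF x] by (auto simp: \<theta>_def)
  let ?b = "\<lambda>\<phi>. 1 + 16 * \<bar>\<theta> - \<phi>\<bar> powr (-3/4)"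
  have i1: "set_integrable lborel {0<..<pi} (\<lambda>\<phi>. 1 :: real)"
    by (simp add: set_integrable_def integrable_indicator_iff emeasure_lborel_Ioo)
  have ik: "set_integrable lborel {0<..<pi} (\<lambda>\<phi>. 16 * \<bar>\<theta> - \<phi>\<bar> powr (-3/4))"
    by (intro set_integrable_mult_right power_interval) simp
  have ib: "set_integrable lborel {0<..<pi} ?b" by (rule set_integral_add(1)[OF i1 ik])
  have ae: "AE \<phi> in lborel. \<phi> \<in> {0<..<pi} \<longrightarrow> \<bar>logcos x \<phi>\<bar> \<le> ?b \<phi>"
    using AE_lborel_singleton[of \<theta>]
  proof eventually_elim
    case (elim \<phi>)
    then show ?case using abs_logcos_le[of \<theta> \<phi>] \<theta> by auto
  qed
  show i: "set_integrable lborel {0<..<pi} (logcos x)"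
    by (rule set_integrable_bound[OF ib])
       (use ae in \<open>auto simp: set_borel_measurable_def elim!: eventually_mono\<close>)
  have "(LINT \<phi>:{0<..<pi}|lborel. \<bar>logcos x \<phi>\<bar>) \<le> (LINT \<phi>:{0<..<pi}|lborel. ?b \<phi>)"
    by (rule set_integral_mono_AE[OF set_integrable_abs[OF i] ib ae])
  also have "\<dots> = pi + 16 * (LINT \<phi>:{0<..<pi}|lborel. \<bar>\<theta> - \<phi>\<bar> powr (-3/4))"
    by (subst set_integral_add(2)[OF i1 ik]) (simp add: set_lebesgue_integral_def)
  also have "\<dots> \<le> 4 + 16 * ((pi - 0) + 8)"
    using power_interval(2)[of 0 pi \<theta>] pi_less_4 by (intro add_mono mult_left_mono) auto
  also have "\<dots> \<le> 200" using pi_less_4 by simp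
  finally show "(LINT \<phi>:{0<..<pi}|lborel. \<bar>logcos x \<phi>\<bar>) \<le> 200" .
qed

definition logcos_mean :: "real \<Rightarrow> real" where "logcos_mean x = integral {0..pi} (logcos x)"

lemma logcos_integral:
  assumes "\<bar>x\<bar> \<le> 1"
  shows "(logcos x has_integral logcos_mean x) {0..pi}" "(LINT \<phi>:{0<..<pi}|lborel. logcos x \<phi>) = logcos_mean x" "\<bar>logcos_mean x\<bar> \<le> 200"
proof -
  note i = logcos_integrable[OF assms]
  note s = set_borel_integral_eq_integral[OF i(1)]
  have "logcos x integrable_on {0..pi}" using s(1) by (simp add: integrable_on_Icc_iff_Ioo)
  then show "(logcos x has_integral logcos_mean x) {0..pi}" unfolding logcos_mean_def by (rule integrable_integral)
  show e: "(LINT \<phi>:{0<..<pi}|lborel. logcos x \<phi>) = logcos_mean x"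
    unfolding logcos_mean_def s(2) by (simp add: integral_open_interval_real)
  have "\<bar>LINT \<phi>:{0<..<pi}|lborel. logcos x \<phi>\<bar> \<le> (LINT \<phi>:{0<..<pi}|lborel. \<bar>logcos x \<phi>\<bar>)"
    using set_integral_norm_bound[OF i(1)] by simp
  then show "\<bar>logcos_mean x\<bar> \<le> 200" using e i(2) by linarith
qed

text \<open>From \<open>2 x\<^sup>2 - 1 - cos \<phi> = 2 (x - cos (\<phi>/2)) (x + cos (\<phi>/2))\<close>, the substitutions \<open>\<phi> = 2 \<psi>\<close> and
  \<open>\<phi> = 2 (\<pi> - \<psi>)\<close> in the two factors cover the two halves of the interval.\<close>

lemma logcos_mean_double:
  assumes "\<bar>x\<bar> \<le> 1"
  shows "logcos_mean (2 * x\<^sup>2 - 1) = pi * ln 2 + 2 * logcos_mean x"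
proof -
  have io: "logcos x integrable_on {0..pi}" using logcos_integral(1)[OF assms] by (rule has_integral_integrable)
  define I1 where "I1 = integral {0..pi/2} (logcos x)"
  define I2 where "I2 = integral {pi/2..pi} (logcos x)"
  have i1: "(logcos x has_integral I1) {0..pi/2}" and i2: "(logcos x has_integral I2) {pi/2..pi}"
    unfolding I1_def I2_def using integrable_subinterval_real[OF io] by (auto intro!: integrable_integral)
  have "((logcos x) has_integral I1 + I2) {0..pi}"
    by (rule has_integral_combine[OF _ _ i1 i2]) auto
  then have s: "I1 + I2 = logcos_mean x" using logcos_integral(1)[OF assms] has_integral_unique by blast
  have im1: "(\<lambda>x. (1 / (1/2)) *\<^sub>R x + -((1 / (1/2)) *\<^sub>R 0)) ` cbox 0 (pi/2) = {0..pi}"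
  proof -
    have "(\<lambda>x::real. (1 / (1/2)) *\<^sub>R x + -((1 / (1/2)) *\<^sub>R 0)) = (\<lambda>x. 2 * x + 0)" by auto
    then show ?thesis by (simp add: image_affinity_atLeastAtMost)
  qed
  have j1: "((\<lambda>\<phi>. ln \<bar>x - cos (\<phi> / 2)\<bar>) has_integral 2 * I1) {0..pi}"
    using has_integral_affinity[of "logcos x" I1 0 "pi/2" "1/2" 0] i1 unfolding im1
    by (simp add: logcos_def)
  have im2: "(\<lambda>x. (1 / (-1/2)) *\<^sub>R x + -((1 / (-1/2)) *\<^sub>R pi)) ` cbox (pi/2) pi = {0..pi}"
  proof -
    have "(\<lambda>x::real. (1 / (-1/2)) *\<^sub>R x + -((1 / (-1/2)) *\<^sub>R pi)) = (\<lambda>x. (-2) * x + 2 * pi)" by auto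
    then show ?thesis using image_affinity_atLeastAtMost[of "-2" "2 * pi" "pi/2" pi] by simp
  qed
  have "((\<lambda>\<phi>. ln \<bar>x - cos ((-1/2) *\<^sub>R \<phi> + pi)\<bar>) has_integral 2 * I2) {0..pi}"
    using has_integral_affinity[of "logcos x" I2 "pi/2" pi "-1/2" pi] i2 unfolding im2
    by (simp add: logcos_def)
  moreover have "cos ((-1/2) *\<^sub>R \<phi> + pi) = - cos (\<phi> / 2)" for \<phi>
    by (simp add: cos_add)
  ultimately have j2: "((\<lambda>\<phi>. ln \<bar>x + cos (\<phi> / 2)\<bar>) has_integral 2 * I2) {0..pi}" by simp
  have j0: "((\<lambda>\<phi>. ln 2) has_integral pi * ln 2) {0..pi}"
    using has_integral_const_real[of "ln 2 :: real" 0 pi] by simp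
  have "((\<lambda>\<phi>. ln 2 + (ln \<bar>x - cos (\<phi> / 2)\<bar> + ln \<bar>x + cos (\<phi> / 2)\<bar>)) has_integral pi * ln 2 + (2 * I1 + 2 * I2)) {0..pi}"
    by (intro has_integral_add j0 j1 j2)
  moreover have "((\<lambda>\<phi>. ln 2 + (ln \<bar>x - cos (\<phi> / 2)\<bar> + ln \<bar>x + cos (\<phi> / 2)\<bar>)) has_integral I) {0..pi}
    \<longleftrightarrow> (logcos (2 * x\<^sup>2 - 1) has_integral I) {0..pi}" for I
  proof (rule has_integral_spike_eq)
    define S where "S = {2 * arccos x, 2 * arccos (- x)}"
    show "negligible S" by (simp add: S_def)
    fix \<phi> assume \<phi>: "\<phi> \<in> {0..pi} - S"
    have "arccos (cos (\<phi> / 2)) = \<phi> / 2" using \<phi> by (intro arccos_cos) auto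
    then have ne: "x - cos (\<phi> / 2) \<noteq> 0" "x + cos (\<phi> / 2) \<noteq> 0"
      using \<phi> by (auto simp: S_def add_eq_0_iff)
    have "cos \<phi> = 2 * (cos (\<phi> / 2))\<^sup>2 - 1" using cos_double_cos[of "\<phi> / 2"] by simp
    then have "2 * x\<^sup>2 - 1 - cos \<phi> = 2 * ((x - cos (\<phi> / 2)) * (x + cos (\<phi> / 2)))"
      by (simp add: power2_eq_square algebra_simps)
    then have "logcos (2 * x\<^sup>2 - 1) \<phi> = ln (2 * (\<bar>x - cos (\<phi> / 2)\<bar> * \<bar>x + cos (\<phi> / 2)\<bar>))"
      by (simp add: logcos_def abs_mult)
    also have "\<dots> = ln 2 + (ln \<bar>x - cos (\<phi> / 2)\<bar> + ln \<bar>x + cos (\<phi> / 2)\<bar>)"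
      using ne by (simp add: ln_mult)
    finally show "logcos (2 * x\<^sup>2 - 1) \<phi> = ln 2 + (ln \<bar>x - cos (\<phi> / 2)\<bar> + ln \<bar>x + cos (\<phi> / 2)\<bar>)" .
  qed
  ultimately have "(logcos (2 * x\<^sup>2 - 1) has_integral pi * ln 2 + (2 * I1 + 2 * I2)) {0..pi}" by blast
  then have "logcos_mean (2 * x\<^sup>2 - 1) = pi * ln 2 + (2 * I1 + 2 * I2)" unfolding logcos_mean_def by (rule integral_unique)
  then show ?thesis using s by simp
qed

text \<open>Duplication doubles the deviation from \<open>- \<pi> ln 2\<close> and maps \<open>[-1, 1]\<close> to itself, so a bounded
  deviation must vanish.\<close>

lemma logcos_mean_value:
  assumes "\<bar>x\<bar> \<le> 1"
  shows "logcos_mean x = - pi * ln 2"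
proof -
  have le: "\<bar>logcos_mean x + pi * ln 2\<bar> \<le> 204 / 2 ^ n" if "\<bar>x\<bar> \<le> 1" for n x
    using that
  proof (induction n arbitrary: x)
    case 0
    have "pi * ln 2 \<le> 4 * 1" using pi_less_4 ln_2_less_1 by (intro mult_mono) auto
    moreover have "pi * ln 2 \<ge> 0" by simp
    ultimately show ?case using logcos_integral(3)[OF 0] unfolding power_0 by linarith
  next
    case (Suc n)
    have "x\<^sup>2 \<le> 1" using Suc.prems by (simp add: abs_square_le_1)
    moreover have "x\<^sup>2 \<ge> 0" by simp
    ultimately have "\<bar>2 * x\<^sup>2 - 1\<bar> \<le> 1" by linarith
    from Suc.IH[OF this] have "\<bar>2 * (logcos_mean x + pi * ln 2)\<bar> \<le> 204 / 2 ^ n"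
      unfolding logcos_mean_double[OF Suc.prems] by (simp add: algebra_simps)
    then show ?case by (simp add: abs_mult)
  qed
  have "(\<lambda>n. 204 * (1 / 2) ^ n) \<longlonglongrightarrow> 204 * (0::real)" by (intro tendsto_mult tendsto_const LIMSEQ_power_zero) auto
  then have "\<bar>logcos_mean x + pi * ln 2\<bar> \<le> 204 * 0"
    by (rule LIMSEQ_le_const) (use le[OF assms] in \<open>auto simp: power_divide\<close>)
  then show ?thesis by simp
qed


text \<open>The equilibrium distribution of the segment.\<close>

definition arcsine :: "real \<Rightarrow> real" where "arcsine t = 1 / (pi * sqrt (1 - t\<^sup>2))"

lemma arcsine_measurable [measurable]: "arcsine \<in> borel_measurable borel"
  unfolding arcsine_def[abs_def] by measurable

lemma arcsine_nonneg: "t \<in> {-1<..<1} \<Longrightarrow> arcsine t \<ge> 0"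
  by (auto simp: arcsine_def abs_square_le_1 abs_le_iff)

lemma set_integrable_lebesgue_iff:
  fixes f :: "real \<Rightarrow> real"
  assumes "f \<in> borel_measurable borel" "S \<in> sets borel"
  shows "f absolutely_integrable_on S \<longleftrightarrow> set_integrable lborel S f"
  unfolding set_integrable_def
  by (rule integrable_completion) (use assms in \<open>auto intro!: borel_measurable_scaleR\<close>)

text \<open>The substitution \<open>t = cos \<phi>\<close> turns the arcsine distribution into the uniform one on \<open>(0, \<pi>)\<close>.\<close>

lemma arcsine_substitution:
  fixes g :: "real \<Rightarrow> real"
  assumes [measurable]: "g \<in> borel_measurable borel"
    and i: "set_integrable lborel {0<..<pi} (\<lambda>\<phi>. g (cos \<phi>))"
  shows "integrable seg (\<lambda>t. g t * arcsine t)"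
    and "(\<integral>t. g t * arcsine t \<partial>seg) = (LINT \<phi>:{0<..<pi}|lborel. g (cos \<phi>)) / pi"
proof -
  let ?S = "{0<..<pi}" and ?f = "\<lambda>t. g t * arcsine t"
  have e: "\<bar>- sin \<phi>\<bar> *\<^sub>R ?f (cos \<phi>) = g (cos \<phi>) / pi" if "\<phi> \<in> ?S" for \<phi>
  proof -
    have "sin \<phi> > 0" using that by (auto intro: sin_gt_zero)
    moreover have "sqrt (1 - (cos \<phi>)\<^sup>2) = sin \<phi>" using calculation by (simp add: cos_squared_eq)
    ultimately show ?thesis by (simp add: arcsine_def)
  qed
  have img: "cos ` ?S = {-1<..<1}"
  proof safe
    fix \<phi> assume "\<phi> \<in> ?S"
    then have "cos \<phi> < cos 0" "cos pi < cos \<phi>" by (intro cos_monotone_0_pi; auto)+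
    then show "cos \<phi> \<in> {-1<..<1}" by simp
  next
    fix t :: real assume t: "t \<in> {-1<..<1}"
    then have "arccos t \<in> ?S" using arccos_lt_bounded[of t] by auto
    moreover have "cos (arccos t) = t" using t by (intro cos_arccos) auto
    ultimately show "t \<in> cos ` ?S" by (metis imageI)
  qed
  have i': "set_integrable lborel ?S (\<lambda>\<phi>. g (cos \<phi>) / pi)" using i by (rule set_integrable_divide)
  have eq: "set_integrable lebesgue ?S (\<lambda>\<phi>. \<bar>- sin \<phi>\<bar> *\<^sub>R ?f (cos \<phi>)) \<longleftrightarrow> set_integrable lebesgue ?S (\<lambda>\<phi>. g (cos \<phi>) / pi)"
    by (rule set_integrable_cong[OF refl refl e])
  have "set_integrable lebesgue ?S (\<lambda>\<phi>. g (cos \<phi>) / pi)"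
    using i' by (subst set_integrable_lebesgue_iff) auto
  then have "(\<lambda>\<phi>. \<bar>- sin \<phi>\<bar> *\<^sub>R ?f (cos \<phi>)) absolutely_integrable_on ?S"
    by (simp only: eq)
  moreover have "integral ?S (\<lambda>\<phi>. \<bar>- sin \<phi>\<bar> *\<^sub>R ?f (cos \<phi>)) = (LINT \<phi>:?S|lborel. g (cos \<phi>)) / pi"
  proof -
    have "integral ?S (\<lambda>\<phi>. \<bar>- sin \<phi>\<bar> *\<^sub>R ?f (cos \<phi>)) = integral ?S (\<lambda>\<phi>. g (cos \<phi>) / pi)"
      by (rule integral_cong) (rule e)
    also have "\<dots> = (LINT \<phi>:?S|lborel. g (cos \<phi>) / pi)"
      by (rule set_borel_integral_eq_integral(2)[OF i', symmetric])
    also have "\<dots> = (LINT \<phi>:?S|lborel. g (cos \<phi>)) / pi" by (rule set_integral_divide_zero)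
    finally show ?thesis .
  qed
  moreover have "(\<lambda>\<phi>. \<bar>- sin \<phi>\<bar> *\<^sub>R ?f (cos \<phi>)) absolutely_integrable_on ?S \<and>
      integral ?S (\<lambda>\<phi>. \<bar>- sin \<phi>\<bar> *\<^sub>R ?f (cos \<phi>)) = b \<longleftrightarrow>
      ?f absolutely_integrable_on cos ` ?S \<and> integral (cos ` ?S) ?f = b" for b
  proof (rule has_absolute_integral_change_of_variables_real)
    show "(cos has_field_derivative - sin \<phi>) (at \<phi> within ?S)" for \<phi> :: real
      by (rule has_field_derivative_at_within[OF DERIV_cos])
    show "inj_on cos ?S" by (rule inj_onI) (auto intro: cos_inj_pi)
  qed simp
  ultimately have "?f absolutely_integrable_on cos ` ?S \<and> integral (cos ` ?S) ?f = (LINT \<phi>:?S|lborel. g (cos \<phi>)) / pi"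
    by blast
  then have *: "?f absolutely_integrable_on {-1<..<1}" "integral {-1<..<1} ?f = (LINT \<phi>:?S|lborel. g (cos \<phi>)) / pi"
    unfolding img by auto
  have si: "set_integrable lborel {-1<..<1} ?f"
    using *(1) by (subst (asm) set_integrable_lebesgue_iff) auto
  then show "integrable seg ?f" by (simp add: integrable_seg_iff)
  show "integral\<^sup>L seg ?f = (LINT \<phi>:?S|lborel. g (cos \<phi>)) / pi"
    unfolding integral_seg set_borel_integral_eq_integral(2)[OF si] by (rule *(2))
qed

lemma arcsine_integral: "integrable seg arcsine" "integral\<^sup>L seg arcsine = 1"
proof -
  have i: "set_integrable lborel {0<..<pi} (\<lambda>\<phi>. 1 :: real)"
    by (simp add: set_integrable_def integrable_indicator_iff emeasure_lborel_Ioo)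
  show "integrable seg arcsine" using arcsine_substitution(1)[of "\<lambda>_. 1"] i by simp
  show "integral\<^sup>L seg arcsine = 1" using arcsine_substitution(2)[of "\<lambda>_. 1"] i
    by (simp add: set_lebesgue_integral_def measure_lborel_Ioo)
qed

text \<open>The potential of the equilibrium distribution is constant on the segment, with value the
  logarithm of the capacity \<open>1/2\<close>.\<close>

lemma arcsine_potential:
  assumes "\<bar>x\<bar> < 1"
  shows "integrable seg (\<lambda>t. ln \<bar>x - t\<bar> * arcsine t)" "(\<integral>t. ln \<bar>x - t\<bar> * arcsine t \<partial>seg) = - ln 2"
    and "(\<integral>t. \<bar>ln \<bar>x - t\<bar>\<bar> * arcsine t \<partial>seg) \<le> 200"
proof -
  have x: "\<bar>x\<bar> \<le> 1" using assms by simp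
  have lc: "(\<lambda>\<phi>. ln \<bar>x - cos \<phi>\<bar>) = logcos x" by (auto simp: logcos_def)
  have i: "set_integrable lborel {0<..<pi} (\<lambda>\<phi>. ln \<bar>x - cos \<phi>\<bar>)" unfolding lc by (rule logcos_integrable(1)[OF x])
  show "integrable seg (\<lambda>t. ln \<bar>x - t\<bar> * arcsine t)" by (rule arcsine_substitution(1)[OF _ i]) measurable
  have "(\<integral>t. ln \<bar>x - t\<bar> * arcsine t \<partial>seg) = (LINT \<phi>:{0<..<pi}|lborel. ln \<bar>x - cos \<phi>\<bar>) / pi"
    by (rule arcsine_substitution(2)[OF _ i]) measurable
  then show "(\<integral>t. ln \<bar>x - t\<bar> * arcsine t \<partial>seg) = - ln 2"
    using logcos_integral(2)[OF x] logcos_mean_value[OF x] by (simp add: logcos_def)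
  have "(\<integral>t. \<bar>ln \<bar>x - t\<bar>\<bar> * arcsine t \<partial>seg) = (LINT \<phi>:{0<..<pi}|lborel. \<bar>ln \<bar>x - cos \<phi>\<bar>\<bar>) / pi"
    by (rule arcsine_substitution(2)[OF _ set_integrable_abs[OF i]]) measurable
  also have "\<dots> \<le> 200 / pi" using logcos_integrable(2)[OF x] by (intro divide_right_mono) (auto simp: logcos_def)
  also have "\<dots> \<le> 200 / 1" using pi_gt3 by (intro divide_left_mono) auto
  finally show "(\<integral>t. \<bar>ln \<bar>x - t\<bar>\<bar> * arcsine t \<partial>seg) \<le> 200" by simp
qed

text \<open>Bounded approximations from below. They converge dominatedly with bounded potentials, so all
  pairings with \<open>K\<close> pass to the limit.\<close>

definition arcsine_cut :: "nat \<Rightarrow> real \<Rightarrow> real" where "arcsine_cut n t = min (real n) (arcsine t)"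

lemma arcsine_cut_bounds:
  assumes "t \<in> {-1<..<1}"
  shows "0 \<le> arcsine_cut n t" "arcsine_cut n t \<le> arcsine t" "arcsine_cut n t \<le> n"
  using arcsine_nonneg[OF assms] by (auto simp: arcsine_cut_def)

lemma arcsine_cut_tendsto: "(\<lambda>n. arcsine_cut n t) \<longlonglongrightarrow> arcsine t"
proof (rule tendsto_eventually)
  show "\<forall>\<^sub>F n in sequentially. arcsine_cut n t = arcsine t"
    using eventually_ge_at_top[of "nat \<lceil>arcsine t\<rceil>"]
    by eventually_elim (auto simp: arcsine_cut_def min_def nat_le_iff ceiling_le_iff)
qed

lemma arcsine_cut_measurable [measurable]: "arcsine_cut n \<in> borel_measurable borel"
  unfolding arcsine_cut_def[abs_def] by measurable

lemma bdd_borel_arcsine_cut: "bdd_borel (arcsine_cut n)"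
  by (rule bdd_borelI[of _ n]) (use arcsine_cut_bounds in auto)

lemma arcsine_cut_integral: "(\<lambda>n. integral\<^sup>L seg (arcsine_cut n)) \<longlonglongrightarrow> 1"
  unfolding arcsine_integral(2)[symmetric]
proof (rule integral_dominated_convergence[where w = arcsine])
  show "AE t in seg. (\<lambda>n. arcsine_cut n t) \<longlonglongrightarrow> arcsine t" by (simp add: arcsine_cut_tendsto)
  show "AE t in seg. norm (arcsine_cut n t) \<le> arcsine t" for n
    using AE_space by eventually_elim (use arcsine_cut_bounds in auto)
qed (auto intro: arcsine_integral borel_measurable_seg)

lemma segpot_arcsine_cut_bound:
  assumes x: "\<bar>x\<bar> < 1"
  shows "\<bar>segpot (arcsine_cut n) x\<bar> \<le> 200"
proof -
  have i: "integrable seg (\<lambda>t. \<bar>ln \<bar>x - t\<bar>\<bar> * arcsine t)"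
    by (rule Bochner_Integration.integrable_bound[OF arcsine_potential(1)[OF x]])
       (auto simp: abs_mult intro!: borel_measurable_seg)
  have "\<bar>segpot (arcsine_cut n) x\<bar> \<le> (\<integral>t. \<bar>ln \<bar>x - t\<bar>\<bar> * arcsine t \<partial>seg)"
    unfolding segpot_eq
  proof (rule abs_seg_integral_le[OF _ i])
    show "integrable seg (\<lambda>t. ln \<bar>x - t\<bar> * arcsine_cut n t)"
      using logpot_integrable[OF bdd_borel_arcsine_cut, of "(x, 0)"] by (simp add: norm_Pair)
    show "AE t in seg. \<bar>ln \<bar>x - t\<bar> * arcsine_cut n t\<bar> \<le> \<bar>ln \<bar>x - t\<bar>\<bar> * arcsine t"
      using AE_space by eventually_elim (use arcsine_cut_bounds in \<open>auto simp: abs_mult intro!: mult_left_mono\<close>)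
  qed
  then show ?thesis using arcsine_potential(3)[OF x] by linarith
qed

lemma segpot_arcsine_cut_tendsto:
  assumes x: "\<bar>x\<bar> < 1"
  shows "(\<lambda>n. segpot (arcsine_cut n) x) \<longlonglongrightarrow> - ln 2"
  unfolding arcsine_potential(2)[OF x, symmetric] segpot_eq
proof (rule integral_dominated_convergence[where w = "\<lambda>t. \<bar>ln \<bar>x - t\<bar>\<bar> * arcsine t"])
  show "integrable seg (\<lambda>t. \<bar>ln \<bar>x - t\<bar>\<bar> * arcsine t)"
    by (rule Bochner_Integration.integrable_bound[OF arcsine_potential(1)[OF x]])
       (auto simp: abs_mult intro!: borel_measurable_seg)
  show "AE t in seg. (\<lambda>n. ln \<bar>x - t\<bar> * arcsine_cut n t) \<longlonglongrightarrow> ln \<bar>x - t\<bar> * arcsine t"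
    by (intro AE_I2 tendsto_mult tendsto_const arcsine_cut_tendsto)
  show "AE t in seg. norm (ln \<bar>x - t\<bar> * arcsine_cut n t) \<le> \<bar>ln \<bar>x - t\<bar>\<bar> * arcsine t" for n
    using AE_space by eventually_elim (use arcsine_cut_bounds in \<open>auto simp: abs_mult intro!: mult_left_mono\<close>)
qed (auto intro!: borel_measurable_seg)

lemma ip_segpot_arcsine_cut:
  assumes h: "bdd_borel h"
  shows "(\<lambda>n. ip (segpot (arcsine_cut n)) h) \<longlonglongrightarrow> - ln 2 * integral\<^sup>L seg h"
proof -
  obtain B where B: "B \<ge> 0" "\<And>t. t \<in> {-1<..<1} \<Longrightarrow> \<bar>h t\<bar> \<le> B" using bdd_borelE[OF h] by blast
  have "(\<lambda>n. ip (segpot (arcsine_cut n)) h) \<longlonglongrightarrow> (\<integral>x. - ln 2 * h x \<partial>seg)"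
    unfolding ip_def
  proof (rule integral_dominated_convergence[where w = "\<lambda>_. 200 * B"])
    show "(\<lambda>x. segpot (arcsine_cut n) x * h x) \<in> borel_measurable seg" for n
      using ip_integrable[OF bdd_borel_segpot[OF bdd_borel_arcsine_cut] h] by (rule borel_measurable_integrable)
    show "(\<lambda>x. - ln 2 * h x) \<in> borel_measurable seg"
      using bdd_borel_integrable[OF bdd_borel_cmult[OF h]] by (rule borel_measurable_integrable)
    show "AE x in seg. (\<lambda>n. segpot (arcsine_cut n) x * h x) \<longlonglongrightarrow> - ln 2 * h x"
      using AE_space
      by eventually_elim (intro tendsto_mult tendsto_const segpot_arcsine_cut_tendsto, auto)
    show "AE x in seg. norm (segpot (arcsine_cut n) x * h x) \<le> 200 * B" for n
      using AE_space
      by eventually_elim (use B segpot_arcsine_cut_bound in \<open>auto simp: abs_mult intro!: mult_mono\<close>)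
  qed simp
  then show ?thesis by simp
qed

lemma ip_segpot_arcsine_cut_self: "(\<lambda>n. ip (segpot (arcsine_cut n)) (arcsine_cut n)) \<longlonglongrightarrow> - ln 2"
proof -
  have "(\<lambda>n. ip (segpot (arcsine_cut n)) (arcsine_cut n)) \<longlonglongrightarrow> (\<integral>x. - ln 2 * arcsine x \<partial>seg)"
    unfolding ip_def
  proof (rule integral_dominated_convergence[where w = "\<lambda>x. 200 * arcsine x"])
    show "(\<lambda>x. segpot (arcsine_cut n) x * arcsine_cut n x) \<in> borel_measurable seg" for n
      using ip_integrable[OF bdd_borel_segpot[OF bdd_borel_arcsine_cut] bdd_borel_arcsine_cut] by (rule borel_measurable_integrable)
    show "AE x in seg. (\<lambda>n. segpot (arcsine_cut n) x * arcsine_cut n x) \<longlonglongrightarrow> - ln 2 * arcsine x"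
      using AE_space
      by eventually_elim (intro tendsto_mult arcsine_cut_tendsto segpot_arcsine_cut_tendsto, auto)
    show "AE x in seg. norm (segpot (arcsine_cut n) x * arcsine_cut n x) \<le> 200 * arcsine x" for n
      using AE_space
      by eventually_elim (use arcsine_cut_bounds segpot_arcsine_cut_bound in \<open>auto simp: abs_mult intro!: mult_mono\<close>)
  qed (auto intro!: arcsine_integral borel_measurable_seg)
  then show ?thesis using arcsine_integral(2) by simp
qed

section \<open>Moments of the potential of the constant density\<close>

definition xlogx :: "real \<Rightarrow> real" where "xlogx u = u * ln \<bar>u\<bar>"

lemma xlogx_0 [simp]: "xlogx 0 = 0" and xlogx_1 [simp]: "xlogx 1 = 0"
  by (simp_all add: xlogx_def)

lemma xlogx_minus: "xlogx (- u) = - xlogx u"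
  by (simp add: xlogx_def)

lemma xlogx_derivative:
  assumes "u \<noteq> 0"
  shows "(xlogx has_real_derivative ln \<bar>u\<bar> + 1) (at u)"
proof -
  have "((\<lambda>u. u * (ln (u\<^sup>2) / 2)) has_real_derivative ln (u\<^sup>2) / 2 + 1) (at u)"
    using assms by (auto intro!: derivative_eq_intros) (auto simp: power2_eq_square)
  moreover have "ln (v\<^sup>2) / 2 = ln \<bar>v\<bar>" for v :: real
    by (cases "v = 0") (simp_all add: ln_realpow[of "\<bar>v\<bar>" 2, simplified])
  ultimately show ?thesis by (simp add: xlogx_def[abs_def])
qed

lemma xlogx_continuous: "continuous_on S xlogx"
proof -
  have "isCont xlogx u" for u
  proof (cases "u = 0")
    case False
    then show ?thesis using xlogx_derivative DERIV_isCont by blast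
  next
    case True
    have "(xlogx \<longlongrightarrow> 0) (at 0)"
    proof (rule Lim_null_comparison)
      show "\<forall>\<^sub>F u in at 0. norm (xlogx u) \<le> 2 * \<bar>u\<bar> powr (1/4) + \<bar>u\<bar>\<^sup>2"
        unfolding eventually_at_filter
      proof (intro always_eventually allI impI)
        fix u :: real assume "u \<noteq> 0"
        then have u: "\<bar>u\<bar> > 0" by simp
        have "norm (xlogx u) = \<bar>u\<bar> * \<bar>ln \<bar>u\<bar>\<bar>" by (simp add: xlogx_def abs_mult)
        also have "\<dots> \<le> \<bar>u\<bar> * (2 * \<bar>u\<bar> powr (-3/4) + \<bar>u\<bar>)"
          using abs_ln_le[OF u] by (intro mult_left_mono) auto
        also have "\<dots> = 2 * (\<bar>u\<bar> powr 1 * \<bar>u\<bar> powr (-3/4)) + \<bar>u\<bar>\<^sup>2"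
          using u by (simp add: power2_eq_square distrib_left)
        also have "\<bar>u\<bar> powr 1 * \<bar>u\<bar> powr (-3/4) = \<bar>u\<bar> powr (1/4)"
          unfolding powr_add[symmetric] by simp
        finally show "norm (xlogx u) \<le> 2 * \<bar>u\<bar> powr (1/4) + \<bar>u\<bar>\<^sup>2" .
      qed
      have "((\<lambda>u. 2 * \<bar>u\<bar> powr (1/4) + \<bar>u\<bar>\<^sup>2) \<longlongrightarrow> 2 * \<bar>0\<bar> powr (1/4) + \<bar>0\<bar>\<^sup>2) (at (0::real))"
        by (intro tendsto_add tendsto_mult tendsto_const tendsto_powr' tendsto_rabs tendsto_power tendsto_ident_at) auto
      then show "((\<lambda>u::real. 2 * \<bar>u\<bar> powr (1/4) + \<bar>u\<bar>\<^sup>2) \<longlongrightarrow> 0) (at 0)" by simp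
    qed
    then show ?thesis using True by (simp add: isCont_def)
  qed
  then show ?thesis by (simp add: continuous_at_imp_continuous_on)
qed

lemma xlogx_continuous_compose [continuous_intros]:
  "continuous_on S f \<Longrightarrow> continuous_on S (\<lambda>x. xlogx (f x))"
  by (rule continuous_on_compose2[OF xlogx_continuous[of UNIV]]) auto

lemma segpot_one:
  assumes x: "\<bar>x\<bar> < 1"
  shows "segpot (\<lambda>_. 1) x = xlogx (1 - x) + xlogx (1 + x) - 2"
proof -
  have "((\<lambda>t. ln \<bar>x - t\<bar>) has_integral ((xlogx (1 - x) - (1 - x)) - (xlogx (-1 - x) - (-1 - x)))) {-1..1}"
  proof (rule fundamental_theorem_of_calculus_interior_strong[of "{x}"])
    show "continuous_on {-1..1} (\<lambda>t. xlogx (t - x) - (t - x))" by (intro continuous_intros)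
    fix t assume "t \<in> {-1<..<1} - {x}"
    then have ne: "t - x \<noteq> 0" by simp
    have "((\<lambda>t. xlogx (t - x) - (t - x)) has_real_derivative (ln \<bar>t - x\<bar> + 1) * 1 - 1) (at t)"
      by (rule DERIV_diff[OF DERIV_chain2[of xlogx _ "\<lambda>t. t - x", OF xlogx_derivative[OF ne]]]) (auto intro!: derivative_eq_intros)
    then show "((\<lambda>t. xlogx (t - x) - (t - x)) has_vector_derivative ln \<bar>x - t\<bar>) (at t)"
      by (simp add: has_real_derivative_iff_has_vector_derivative abs_minus_commute)
  qed auto
  then have I: "integral {-1..1} (\<lambda>t. ln \<bar>x - t\<bar>) = xlogx (1 - x) - (1 - x) - (xlogx (-1 - x) - (-1 - x))"
    by (rule integral_unique)
  have "integrable seg (\<lambda>t. ln (norm ((x, 0) - (t, 0 :: real))) * 1)"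
    by (rule logpot_integrable[OF bdd_borel_const])
  then have si: "set_integrable lborel {-1<..<1} (\<lambda>t. ln \<bar>x - t\<bar>)"
    by (simp add: integrable_seg_iff norm_Pair)
  have "segpot (\<lambda>_. 1) x = integral {-1..1} (\<lambda>t. ln \<bar>x - t\<bar>)"
    using set_borel_integral_eq_integral(2)[OF si]
    by (simp add: segpot_eq integral_seg integral_open_interval_real)
  moreover have "xlogx (-1 - x) = - xlogx (1 + x)" using xlogx_minus[of "1 + x"] by simp
  ultimately show ?thesis using I by simp
qed

text \<open>In the variable \<open>s = (1 + x) / 2\<close> the potential of the constant density is an affine function of
  \<open>s ln s + (1 - s) ln (1 - s)\<close>, so that only moments of the latter over the unit interval are needed.\<close>

definition neg_entropy :: "real \<Rightarrow> real" where "neg_entropy s = xlogx s + xlogx (1 - s)"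

lemma segpot_one_eq_neg_entropy:
  assumes x: "\<bar>x\<bar> < 1"
  shows "segpot (\<lambda>_. 1) x = 2 * (ln 2 - 1) + 2 * neg_entropy ((1 + x) / 2)"
proof -
  have d: "xlogx (2 * a) = 2 * ln 2 * a + 2 * xlogx a" if "a > 0" for a
    using that by (simp add: xlogx_def ln_mult algebra_simps)
  have a: "2 * ((1 + x) / 2) = 1 + x" "2 * (1 - (1 + x) / 2) = 1 - x" by (simp_all add: field_simps)
  have p: "(1 + x) / 2 > 0" "1 - (1 + x) / 2 > 0" using x by auto
  have e1: "xlogx (1 + x) = 2 * ln 2 * ((1 + x) / 2) + 2 * xlogx ((1 + x) / 2)"
    using d[OF p(1)] unfolding a .
  have e2: "xlogx (1 - x) = 2 * ln 2 * (1 - (1 + x) / 2) + 2 * xlogx (1 - (1 + x) / 2)"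
    using d[OF p(2)] unfolding a .
  show ?thesis unfolding segpot_one[OF x] e1 e2 neg_entropy_def by (simp add: algebra_simps)
qed

lemma seg_half:
  fixes h :: "real \<Rightarrow> real"
  assumes h: "continuous_on {0..1} h"
  shows "integrable seg (\<lambda>x. h ((1 + x) / 2))" "(\<integral>x. h ((1 + x) / 2) \<partial>seg) = 2 * integral {0..1} h"
proof -
  have c: "continuous_on {-1..1} (\<lambda>x::real. h ((1 + x) / 2))"
    by (rule continuous_on_compose2[OF h]) (auto intro!: continuous_intros)
  show "integrable seg (\<lambda>x. h ((1 + x) / 2))" by (rule continuous_integral_seg(1)[OF c])
  have "(h has_integral integral {0..1} h) (cbox 0 1)"
    using integrable_integral[OF integrable_continuous_real[OF h]] by simp
  from has_integral_affinity'[OF this, of "1/2" "1/2"]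
  have "((\<lambda>x. h ((1 + x) / 2)) has_integral 2 * integral {0..1} h) {-1..1}"
    by (simp add: add_divide_distrib add.commute)
  then show "(\<integral>x. h ((1 + x) / 2) \<partial>seg) = 2 * integral {0..1} h"
    by (simp add: continuous_integral_seg(2)[OF c] integral_unique)
qed

lemma has_integral_power_xlogx:
  "((\<lambda>s. s ^ m * xlogx s) has_integral (- 1 / (real m + 2)\<^sup>2)) {0..1}"
proof -
  let ?F = "\<lambda>s. s ^ (m + 1) * xlogx s / (real m + 2) - s ^ (m + 2) / (real m + 2)\<^sup>2"
  have "((\<lambda>s. s ^ m * xlogx s) has_integral (?F 1 - ?F 0)) {0..1}"
  proof (rule fundamental_theorem_of_calculus_interior)
    show "continuous_on {0..1} ?F" by (intro continuous_intros) auto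
    fix s :: real assume s: "s \<in> {0<..<1}"
    have m: "real m + 2 \<noteq> 0" by linarith
    have ld: "ln \<bar>s\<bar> = ln s" using s by simp
    have "(?F has_real_derivative
        ((real (m + 1) * s ^ m) * xlogx s + (ln \<bar>s\<bar> + 1) * s ^ (m + 1)) / (real m + 2)
        - (real (m + 2) * s ^ (m + 1)) / (real m + 2)\<^sup>2) (at s)"
    proof (rule DERIV_diff[OF DERIV_cdivide[OF DERIV_mult[OF _ xlogx_derivative]] DERIV_cdivide])
      show "((\<lambda>s. s ^ (m + 1)) has_real_derivative real (m + 1) * s ^ m) (at s)"
        using DERIV_pow[of "m + 1" s] by simp
      show "((\<lambda>s. s ^ (m + 2)) has_real_derivative real (m + 2) * s ^ (m + 1)) (at s)"
        using DERIV_pow[of "m + 2" s] by simp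
    qed (use s in auto)
    also have "((real (m + 1) * s ^ m) * xlogx s + (ln \<bar>s\<bar> + 1) * s ^ (m + 1)) / (real m + 2)
        - (real (m + 2) * s ^ (m + 1)) / (real m + 2)\<^sup>2 = s ^ m * xlogx s"
      unfolding xlogx_def ld using m
      by (simp add: divide_simps power2_eq_square) (simp add: algebra_simps)
    finally show "(?F has_vector_derivative s ^ m * xlogx s) (at s)"
      by (simp add: has_real_derivative_iff_has_vector_derivative)
  qed simp
  then show ?thesis by simp
qed

lemma has_integral_xlogx_squared: "((\<lambda>s. (xlogx s)\<^sup>2) has_integral 2 / 27) {0..1}"
proof -
  let ?F = "\<lambda>s. s * (xlogx s)\<^sup>2 / 3 - 2 / 9 * (s\<^sup>2 * xlogx s) + 2 / 27 * s ^ 3"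
  have "((\<lambda>s. (xlogx s)\<^sup>2) has_integral (?F 1 - ?F 0)) {0..1}"
  proof (rule fundamental_theorem_of_calculus_interior)
    show "continuous_on {0..1} ?F" by (intro continuous_intros) auto
    fix s :: real assume s: "s \<in> {0<..<1}"
    have "(?F has_real_derivative
        (1 * (xlogx s)\<^sup>2 + (2 * xlogx s * (ln \<bar>s\<bar> + 1)) * s) / 3
        - 2 / 9 * ((2 * s) * xlogx s + (ln \<bar>s\<bar> + 1) * s\<^sup>2) + 2 / 27 * (3 * s\<^sup>2)) (at s)"
      using s by (auto intro!: derivative_eq_intros xlogx_derivative) (simp add: field_simps)
    also have "(1 * (xlogx s)\<^sup>2 + (2 * xlogx s * (ln \<bar>s\<bar> + 1)) * s) / 3
        - 2 / 9 * ((2 * s) * xlogx s + (ln \<bar>s\<bar> + 1) * s\<^sup>2) + 2 / 27 * (3 * s\<^sup>2) = (xlogx s)\<^sup>2"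
      unfolding xlogx_def by (simp add: power2_eq_square algebra_simps)
    finally show "(?F has_vector_derivative (xlogx s)\<^sup>2) (at s)"
      by (simp add: has_real_derivative_iff_has_vector_derivative)
  qed simp
  then show ?thesis by simp
qed

lemma has_integral_reflect_unit:
  fixes f :: "real \<Rightarrow> real"
  assumes "(f has_integral I) {0..1}"
  shows "((\<lambda>s. f (1 - s)) has_integral I) {0..1}"
proof -
  have "(\<lambda>x. (1 / (-1)) *\<^sub>R x + -((1 / (-1)) *\<^sub>R (1::real))) ` cbox 0 1 = {0..1}"
    using image_affinity_atLeastAtMost[of "-1" 1 0 "1::real"] by simp
  then show ?thesis
    using has_integral_affinity[of f I 0 1 "-1" 1] assms by simp
qed

text \<open>By partial fractions the series splits into two telescoping ones and two tails of
  \<open>\<Sum> 1 / n\<^sup>2 = \<pi>\<^sup>2 / 6\<close>.\<close>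

lemma dilog_sum:
  "(\<lambda>n. 1 / (real n + 1) * (1 / (real n + 3)\<^sup>2 - 1 / (real n + 4)\<^sup>2)) sums (37 / 108 - pi\<^sup>2 / 36)"
proof -
  have t0: "(\<lambda>n. 1 / (real n + k)) \<longlonglongrightarrow> 0" for k
  proof -
    have "filterlim (\<lambda>n. real n + k) at_top sequentially"
      using filterlim_tendsto_add_at_top[OF tendsto_const[of k] filterlim_real_sequentially]
      by (simp add: add.commute)
    then show ?thesis
      by (intro tendsto_divide_0[OF tendsto_const] filterlim_at_top_imp_at_infinity)
  qed
  have b: "(\<lambda>n. 1 / (real n + 1)\<^sup>2) sums (pi\<^sup>2 / 6)"
    using inverse_squares_sums by (simp add: add.commute)
  have b3: "(\<lambda>n. 1 / (real n + 3)\<^sup>2) sums (pi\<^sup>2 / 6 - 5 / 4)"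
    using sums_split_initial_segment[OF b, of 2] by (simp add: numeral_2_eq_2 add_ac)
  have b4: "(\<lambda>n. 1 / (real n + 4)\<^sup>2) sums (pi\<^sup>2 / 6 - 49 / 36)"
    using sums_split_initial_segment[OF b, of 3] by (simp add: numeral_3_eq_3 add_ac)
  let ?f = "\<lambda>n. 1 / (real n + 1) + 1 / (real n + 2)"
  let ?g = "\<lambda>n. 1 / (real n + 1) + 1 / (real n + 2) + 1 / (real n + 3)"
  have "?f \<longlonglongrightarrow> 0 + 0" by (intro tendsto_add t0)
  from telescope_sums'[OF this] have f: "(\<lambda>n. 1 / (real n + 1) - 1 / (real n + 3)) sums (3 / 2)"
    by (simp add: add_ac)
  have "?g \<longlonglongrightarrow> 0 + 0 + 0" by (intro tendsto_add t0)
  from telescope_sums'[OF this] have g: "(\<lambda>n. 1 / (real n + 1) - 1 / (real n + 4)) sums (11 / 6)"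
    by (simp add: add_ac)
  have A: "(\<lambda>n. 1 / 4 * (1 / (real n + 1) - 1 / (real n + 3)) - 1 / 2 * (1 / (real n + 3)\<^sup>2)
      - 1 / 9 * (1 / (real n + 1) - 1 / (real n + 4)) + 1 / 3 * (1 / (real n + 4)\<^sup>2))
    sums (1 / 4 * (3 / 2) - 1 / 2 * (pi\<^sup>2 / 6 - 5 / 4) - 1 / 9 * (11 / 6) + 1 / 3 * (pi\<^sup>2 / 6 - 49 / 36))"
    by (intro sums_add sums_diff sums_mult f g b3 b4)
  have B: "1 / 4 * (1 / (x + 1) - 1 / (x + 3)) - 1 / 2 * (1 / (x + 3)\<^sup>2)
      - 1 / 9 * (1 / (x + 1) - 1 / (x + 4)) + 1 / 3 * (1 / (x + 4)\<^sup>2)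
      = 1 / (x + 1) * (1 / (x + 3)\<^sup>2 - 1 / (x + 4)\<^sup>2)" if "x \<ge> 0" for x :: real
  proof -
    have "x + 1 \<noteq> 0" "x + 3 \<noteq> 0" "x + 4 \<noteq> 0" using that by auto
    then show ?thesis by (simp add: divide_simps power2_eq_square) (simp add: algebra_simps)
  qed
  have V: "1 / 4 * (3 / 2) - 1 / 2 * (pi\<^sup>2 / 6 - 5 / 4) - 1 / 9 * (11 / 6) + 1 / 3 * (pi\<^sup>2 / 6 - 49 / 36)
      = 37 / 108 - pi\<^sup>2 / 36" by (simp add: field_simps)
  show ?thesis using A unfolding B[OF of_nat_0_le_iff] V .
qed

text \<open>Expanding \<open>ln (1 - s)\<close> in powers of \<open>s\<close> gives terms of one sign, which may be integrated
  separately.\<close>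

lemma integral_xlogx_xlogx:
  "integral {0..1} (\<lambda>s. xlogx s * xlogx (1 - s)) = 37 / 108 - pi\<^sup>2 / 36"
proof -
  \<comment> \<open>the \<open>n\<close>th term is \<open>(1 - s) s ln s\<close> times \<open>- s ^ (n + 1) / (n + 1)\<close>\<close>
  define g where "g n s = 1 / (real n + 1) * (s ^ (n + 2) * xlogx s - s ^ (n + 1) * xlogx s)" for n and s :: real
  have gi: "integral {0..1} (g n) = 1 / (real n + 1) * (1 / (real n + 3)\<^sup>2 - 1 / (real n + 4)\<^sup>2)" for n
  proof -
    have "(g n has_integral 1 / (real n + 1) * (- 1 / (real (n + 2) + 2)\<^sup>2 - (- 1 / (real (n + 1) + 2)\<^sup>2))) {0..1}"
      unfolding g_def by (intro has_integral_mult_right has_integral_diff has_integral_power_xlogx)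
    then show ?thesis by (simp add: integral_unique add_ac)
  qed
  have gc: "continuous_on {0..1} (g n)" for n unfolding g_def by (intro continuous_intros) auto
  have pos: "g n s \<ge> 0" if "s \<in> {0<..<1}" for n s
  proof -
    have "ln s \<le> 0" using that by simp
    then have "xlogx s \<le> 0" using that by (simp add: xlogx_def mult_nonneg_nonpos)
    moreover have "s ^ (n + 2) \<le> s ^ (n + 1)" using that by (intro power_decreasing) auto
    ultimately show ?thesis unfolding g_def left_diff_distrib[symmetric]
      by (intro mult_nonneg_nonneg mult_nonpos_nonpos) auto
  qed
  have ser: "(\<lambda>n. g n s) sums (xlogx s * xlogx (1 - s))" if "s \<in> {0<..<1}" for s
  proof -
    have "(\<lambda>n. - ((- (- s)) ^ n) / of_nat n) sums ln (1 + (- s))"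
      by (rule ln_series') (use that in auto)
    then have "(\<lambda>n. - (s ^ Suc n) / real (Suc n)) sums ln (1 - s)"
      by (subst sums_Suc_iff) simp
    from sums_mult[OF this, of "(1 - s) * xlogx s"]
    have "(\<lambda>n. (1 - s) * xlogx s * (- (s ^ Suc n) / real (Suc n))) sums ((1 - s) * xlogx s * ln (1 - s))" .
    moreover have "(1 - s) * xlogx s * (- (s ^ Suc n) / real (Suc n)) = g n s" for n
      by (simp add: g_def field_simps)
    moreover have "(1 - s) * xlogx s * ln (1 - s) = xlogx s * xlogx (1 - s)"
      using that by (simp add: xlogx_def)
    ultimately show ?thesis by simp
  qed
  define G where "G n x = g n ((1 + x) / 2)" for n x
  have Gi: "integrable seg (G n)" "integral\<^sup>L seg (G n) = 2 * (1 / (real n + 1) * (1 / (real n + 3)\<^sup>2 - 1 / (real n + 4)\<^sup>2))" for n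
    unfolding G_def using seg_half[OF gc] gi by auto
  have half: "(1 + x) / 2 \<in> {0<..<1}" if "x \<in> {-1<..<1}" for x :: real using that by auto
  have nG: "norm (G n x) = G n x" if "x \<in> {-1<..<1}" for n x
    using pos[OF half[OF that]] by (simp add: G_def)
  have "(\<lambda>n. integral\<^sup>L seg (G n)) sums (\<integral>x. (\<Sum>n. G n x) \<partial>seg)"
  proof (rule sums_integral[OF Gi(1)])
    show "AE x in seg. summable (\<lambda>n. norm (G n x))"
      using AE_space
    proof eventually_elim
      case (elim x)
      then have x: "x \<in> {-1<..<1}" by simp
      show ?case unfolding nG[OF x] unfolding G_def by (rule sums_summable[OF ser[OF half[OF x]]])
    qed
    have nGi: "(\<integral>x. norm (G n x) \<partial>seg) = integral\<^sup>L seg (G n)" for n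
      by (rule Bochner_Integration.integral_cong) (auto simp: nG[unfolded real_norm_def])
    show "summable (\<lambda>n. \<integral>x. norm (G n x) \<partial>seg)"
      unfolding nGi Gi(2) by (rule sums_summable[OF sums_mult[OF dilog_sum]])
  qed
  moreover have "(\<integral>x. (\<Sum>n. G n x) \<partial>seg) = (\<integral>x. (\<lambda>s. xlogx s * xlogx (1 - s)) ((1 + x) / 2) \<partial>seg)"
    by (rule Bochner_Integration.integral_cong)
       (auto simp: G_def intro!: sums_unique[symmetric] ser)
  moreover have "(\<integral>x. (\<lambda>s. xlogx s * xlogx (1 - s)) ((1 + x) / 2) \<partial>seg) = 2 * integral {0..1} (\<lambda>s. xlogx s * xlogx (1 - s))"
    by (rule seg_half(2)) (intro continuous_intros)
  ultimately have "(\<lambda>n. 2 * (1 / (real n + 1) * (1 / (real n + 3)\<^sup>2 - 1 / (real n + 4)\<^sup>2)))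
      sums (2 * integral {0..1} (\<lambda>s. xlogx s * xlogx (1 - s)))"
    unfolding Gi(2) by simp
  from sums_unique2[OF this sums_mult[OF dilog_sum, of 2]] show ?thesis by simp
qed

lemma neg_entropy_integrals:
  "integral {0..1} neg_entropy = - 1 / 2"
  "integral {0..1} (\<lambda>s. (neg_entropy s)\<^sup>2) = 5 / 6 - pi\<^sup>2 / 18"
proof -
  have i1: "(xlogx has_integral - 1 / 4) {0..1}" using has_integral_power_xlogx[of 0] by simp
  have "(neg_entropy has_integral - 1 / 4 + - 1 / 4) {0..1}"
    unfolding neg_entropy_def by (intro has_integral_add i1 has_integral_reflect_unit[OF i1])
  then show "integral {0..1} neg_entropy = - 1 / 2" by (simp add: integral_unique)
  have i2: "((\<lambda>s. xlogx s * xlogx (1 - s)) has_integral 37 / 108 - pi\<^sup>2 / 36) {0..1}"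
    unfolding integral_xlogx_xlogx[symmetric]
    by (intro integrable_integral integrable_continuous_real continuous_intros)
  have "((\<lambda>s. (xlogx s)\<^sup>2 + (xlogx (1 - s))\<^sup>2 + 2 * (xlogx s * xlogx (1 - s)))
      has_integral 2 / 27 + 2 / 27 + 2 * (37 / 108 - pi\<^sup>2 / 36)) {0..1}"
    by (intro has_integral_add has_integral_mult_right has_integral_xlogx_squared i2
        has_integral_reflect_unit[OF has_integral_xlogx_squared])
  moreover have "(neg_entropy s)\<^sup>2 = (xlogx s)\<^sup>2 + (xlogx (1 - s))\<^sup>2 + 2 * (xlogx s * xlogx (1 - s))" for s
    by (simp add: neg_entropy_def power2_eq_square algebra_simps)
  ultimately show "integral {0..1} (\<lambda>s. (neg_entropy s)\<^sup>2) = 5 / 6 - pi\<^sup>2 / 18"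
    by (simp add: integral_unique)
qed

lemma neg_entropy_continuous: "continuous_on {0..1} neg_entropy"
  unfolding neg_entropy_def by (intro continuous_intros)

text \<open>The second combination is twice the variance of \<open>K 1\<close> under the uniform distribution, in which
  the additive constant \<open>2 (ln 2 - 1)\<close> drops out.\<close>

lemma segpot_one_integrals:
  "integral\<^sup>L seg (segpot (\<lambda>_. 1)) = 4 * ln 2 - 6"
  "ip (segpot (\<lambda>_. 1)) (segpot (\<lambda>_. 1)) - (integral\<^sup>L seg (segpot (\<lambda>_. 1)))\<^sup>2 / 2 = 14 / 3 - 4 * pi\<^sup>2 / 9"
proof -
  define a where "a = 2 * (ln 2 - 1 :: real)"
  have e: "segpot (\<lambda>_. 1) x = a + 2 * neg_entropy ((1 + x) / 2)" if "x \<in> space seg" for x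
    using segpot_one_eq_neg_entropy[of x] that by (simp add: a_def abs_less_iff)
  note h1 = seg_half[OF neg_entropy_continuous]
  have c2: "continuous_on {0..1} (\<lambda>s. (neg_entropy s)\<^sup>2)" by (intro continuous_intros neg_entropy_continuous)
  note h2 = seg_half[OF c2]
  have "integral\<^sup>L seg (segpot (\<lambda>_. 1)) = (\<integral>x. a + 2 * neg_entropy ((1 + x) / 2) \<partial>seg)"
    by (intro Bochner_Integration.integral_cong refl e)
  also have "\<dots> = 2 * a + 2 * (2 * (- 1 / 2))"
    by (subst Bochner_Integration.integral_add) (auto simp: h1 neg_entropy_integrals(1))
  finally have m: "integral\<^sup>L seg (segpot (\<lambda>_. 1)) = 2 * a - 2" by simp
  then show "integral\<^sup>L seg (segpot (\<lambda>_. 1)) = 4 * ln 2 - 6" by (simp add: a_def)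
  have "ip (segpot (\<lambda>_. 1)) (segpot (\<lambda>_. 1)) = (\<integral>x. a\<^sup>2 + (4 * a * neg_entropy ((1 + x) / 2) + 4 * (neg_entropy ((1 + x) / 2))\<^sup>2) \<partial>seg)"
    unfolding ip_def
    by (intro Bochner_Integration.integral_cong refl) (simp add: e power2_eq_square algebra_simps)
  also have "\<dots> = 2 * a\<^sup>2 + (4 * a * (2 * (- 1 / 2)) + 4 * (2 * (5 / 6 - pi\<^sup>2 / 18)))"
    using h1 h2 neg_entropy_integrals by simp
  finally show "ip (segpot (\<lambda>_. 1)) (segpot (\<lambda>_. 1)) - (integral\<^sup>L seg (segpot (\<lambda>_. 1)))\<^sup>2 / 2 = 14 / 3 - 4 * pi\<^sup>2 / 9"
    unfolding m by (simp add: power2_eq_square field_simps)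
qed

section \<open>Summation\<close>

text \<open>Interchange of the geometric series with a convergent series of nonnegative weights. The finite
  geometric sums leave a remainder that is at most \<open>r ^ N / (1 - r)\<close> times the total weight.\<close>

lemma sums_power_suminf:
  fixes T x :: "nat \<Rightarrow> real"
  assumes T: "summable T" "\<And>k. T k \<ge> 0" and x: "\<And>k. \<bar>x k\<bar> \<le> r" and r: "r < 1"
  shows "summable (\<lambda>k. T k * x k ^ n)" "summable (\<lambda>k. T k / (1 - x k))"
    and "(\<lambda>n. \<Sum>k. T k * x k ^ n) sums (\<Sum>k. T k / (1 - x k))"
proof -
  have r0: "r \<ge> 0" using x[of 0] by linarith
  have p: "1 - x k \<ge> 1 - r" "1 - x k > 0" for k using x[of k] r by linarith+
  have bd: "\<bar>x k ^ n\<bar> \<le> r ^ n" for k n unfolding power_abs using x by (intro power_mono) auto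
  show s1: "summable (\<lambda>k. T k * x k ^ n)" for n
  proof (rule summable_comparison_test'[OF T(1), of 0])
    fix k
    have "\<bar>x k ^ n\<bar> \<le> 1" using bd[of k n] power_le_one[of r n] r0 r by linarith
    then have "T k * \<bar>x k ^ n\<bar> \<le> T k * 1" using T(2) by (intro mult_left_mono)
    then show "norm (T k * x k ^ n) \<le> T k" using T(2)[of k] by (simp add: abs_mult)
  qed
  have s3: "summable (\<lambda>k. T k * x k ^ n / (1 - x k))"
    and b3: "\<bar>\<Sum>k. T k * x k ^ n / (1 - x k)\<bar> \<le> r ^ n * (suminf T / (1 - r))" for n
  proof -
    have le: "norm (T k * x k ^ n / (1 - x k)) \<le> r ^ n / (1 - r) * T k" for k
    proof -
      have "T k * \<bar>x k ^ n\<bar> / (1 - x k) \<le> T k * r ^ n / (1 - r)"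
        using p[of k] r T(2)[of k] bd[of k n] r0 by (intro frac_le mult_left_mono mult_nonneg_nonneg) auto
      then show ?thesis using p[of k] T(2)[of k] by (simp add: abs_mult mult.commute)
    qed
    show "summable (\<lambda>k. T k * x k ^ n / (1 - x k))"
      by (rule summable_comparison_test'[OF summable_mult[OF T(1)], of 0, OF le])
    have sn: "summable (\<lambda>k. norm (T k * x k ^ n / (1 - x k)))"
      by (rule summable_comparison_test'[OF summable_mult[OF T(1)], of 0 _ "r ^ n / (1 - r)"]) (use le in simp)
    have "norm (\<Sum>k. T k * x k ^ n / (1 - x k)) \<le> (\<Sum>k. norm (T k * x k ^ n / (1 - x k)))"
      by (rule summable_norm[OF sn])
    also have "\<dots> \<le> (\<Sum>k. r ^ n / (1 - r) * T k)"
      by (rule suminf_le[OF le sn summable_mult[OF T(1)]])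
    finally have "norm (\<Sum>k. T k * x k ^ n / (1 - x k)) \<le> (\<Sum>k. r ^ n / (1 - r) * T k)" .
    then show "\<bar>\<Sum>k. T k * x k ^ n / (1 - x k)\<bar> \<le> r ^ n * (suminf T / (1 - r))"
      unfolding suminf_mult[OF T(1)] by simp
  qed
  show s2: "summable (\<lambda>k. T k / (1 - x k))" using s3[of 0] by simp
  have part: "(\<Sum>n<N. \<Sum>k. T k * x k ^ n) = (\<Sum>k. T k / (1 - x k)) - (\<Sum>k. T k * x k ^ N / (1 - x k))" for N
  proof -
    have "(\<Sum>n<N. \<Sum>k. T k * x k ^ n) = (\<Sum>k. \<Sum>n<N. T k * x k ^ n)"
      by (rule suminf_sum[symmetric]) (rule s1)
    also have "\<dots> = (\<Sum>k. T k / (1 - x k) - T k * x k ^ N / (1 - x k))"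
    proof (rule suminf_cong)
      fix k
      have "x k \<noteq> 1" using p[of k] by auto
      then have "(\<Sum>n<N. x k ^ n) = (1 - x k ^ N) / (1 - x k)" using sum_gp_strict[of "x k" N] by simp
      then have "(\<Sum>n<N. T k * x k ^ n) = T k * ((1 - x k ^ N) / (1 - x k))"
        unfolding sum_distrib_left[symmetric] by (rule arg_cong)
      then show "(\<Sum>n<N. T k * x k ^ n) = T k / (1 - x k) - T k * x k ^ N / (1 - x k)"
        by (simp add: right_diff_distrib diff_divide_distrib)
    qed
    also have "\<dots> = (\<Sum>k. T k / (1 - x k)) - (\<Sum>k. T k * x k ^ N / (1 - x k))"
      by (rule suminf_diff[OF s2 s3, symmetric])
    finally show ?thesis .
  qed
  have "(\<lambda>N. \<Sum>k. T k * x k ^ N / (1 - x k)) \<longlonglongrightarrow> 0"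
  proof (rule Lim_null_comparison)
    show "\<forall>\<^sub>F N in sequentially. norm (\<Sum>k. T k * x k ^ N / (1 - x k)) \<le> r ^ N * (suminf T / (1 - r))"
      using b3 by (intro always_eventually) simp
    have "(\<lambda>N. r ^ N * (suminf T / (1 - r))) \<longlonglongrightarrow> 0 * (suminf T / (1 - r))"
      using r r0 by (intro tendsto_mult tendsto_const LIMSEQ_power_zero) auto
    then show "(\<lambda>N. r ^ N * (suminf T / (1 - r))) \<longlonglongrightarrow> 0" by simp
  qed
  from tendsto_diff[OF tendsto_const[of "\<Sum>k. T k / (1 - x k)"] this]
  show "(\<lambda>n. \<Sum>k. T k * x k ^ n) sums (\<Sum>k. T k / (1 - x k))"
    unfolding sums_def part by simp
qed

context steklov
begin

abbreviation ell :: "real \<Rightarrow> real" where "ell \<equiv> segpot (\<lambda>_. 1)"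

lemma bdd_ell: "bdd_borel ell" by (rule bdd_borel_segpot[OF bdd_borel_const])

lemma ip_ell_trace: "ip ell (trace (Suc k)) = 2 * pi * far (Suc k) / \<mu> (Suc k)"
  using ip_segpot_trace[OF bdd_borel_const[of 1], of k] mean_trace[of k] by (simp add: ip_one(2))

lemma second_sum: "(\<lambda>k. (far (Suc k))\<^sup>2 / (\<mu> (Suc k))\<^sup>2) sums ((21 - 2 * pi\<^sup>2) / (18 * pi\<^sup>2))"
proof -
  have "(\<lambda>k. ip ell (trace (Suc k)) * ip ell (trace (Suc k))) sums (14 / 3 - 4 * pi\<^sup>2 / 9)"
    using parseval_Suc[OF bdd_ell bdd_ell] segpot_one_integrals(2) by (simp add: power2_eq_square)
  from sums_mult[OF this, of "1 / (4 * pi\<^sup>2)"]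
  have "(\<lambda>k. 1 / (4 * pi\<^sup>2) * (ip ell (trace (Suc k)) * ip ell (trace (Suc k)))) sums (1 / (4 * pi\<^sup>2) * (14 / 3 - 4 * pi\<^sup>2 / 9))" .
  moreover have "1 / (4 * pi\<^sup>2) * (ip ell (trace (Suc k)) * ip ell (trace (Suc k))) = (far (Suc k))\<^sup>2 / (\<mu> (Suc k))\<^sup>2" for k
    unfolding ip_ell_trace using mu_pos[of k] by (simp add: field_simps power2_eq_square)
  moreover have "1 / (4 * pi\<^sup>2) * (14 / 3 - 4 * pi\<^sup>2 / 9) = (21 - 2 * pi\<^sup>2) / (18 * pi\<^sup>2)"
    by (simp add: field_simps)
  ultimately show ?thesis by simp
qed

text \<open>In the limit \<open>\<langle>K \<omega>, e\<^sub>k\<rangle> = - ln 2 \<integral> e\<^sub>k = 0\<close>, so that \<open>ip_segpot_trace\<close> gives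
  \<open>\<langle>\<omega>, e\<^sub>k\<rangle> = \<Psi>\<^sub>k(\<infinity>)\<close>.\<close>

lemma ip_arcsine_cut_trace: "(\<lambda>n. ip (arcsine_cut n) (trace (Suc k))) \<longlonglongrightarrow> far (Suc k)"
proof -
  have m: "\<mu> (Suc k) \<noteq> 0" using mu_pos[of k] by simp
  have "(\<lambda>n. ip (segpot (arcsine_cut n)) (trace (Suc k))) \<longlonglongrightarrow> - ln 2 * integral\<^sup>L seg (trace (Suc k))"
    by (rule ip_segpot_arcsine_cut[OF bdd_trace])
  then have "(\<lambda>n. far (Suc k) * integral\<^sup>L seg (arcsine_cut n) - \<mu> (Suc k) / pi * ip (segpot (arcsine_cut n)) (trace (Suc k)))
      \<longlonglongrightarrow> far (Suc k) * 1 - \<mu> (Suc k) / pi * 0"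
    by (intro tendsto_diff tendsto_mult tendsto_const arcsine_cut_integral) (simp add: mean_trace)
  moreover have "far (Suc k) * integral\<^sup>L seg (arcsine_cut n) - \<mu> (Suc k) / pi * ip (segpot (arcsine_cut n)) (trace (Suc k))
      = ip (arcsine_cut n) (trace (Suc k))" for n
    unfolding ip_segpot_trace[OF bdd_borel_arcsine_cut] using m by simp
  ultimately show ?thesis by simp
qed

text \<open>Let \<open>d\<^sub>n\<^sub>k\<close> be the coefficients of the truncated arcsine density. Parseval's identity evaluates both
  \<open>P\<^sub>n = \<Sum> c\<^sub>k d\<^sub>n\<^sub>k / \<mu>\<^sub>k\<close> and the energy \<open>Q\<^sub>n = \<Sum> d\<^sub>n\<^sub>k\<^sup>2 / \<mu>\<^sub>k\<close>, and both tend to the same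
  limit \<open>E\<close>. As \<open>d\<^sub>n\<^sub>k\<close> tends to \<open>c\<^sub>k\<close>, partial sums of \<open>S = \<Sum> c\<^sub>k\<^sup>2 / \<mu>\<^sub>k\<close> are at most \<open>E\<close>.
  In the other direction \<open>2 c\<^sub>k d\<^sub>n\<^sub>k \<le> c\<^sub>k\<^sup>2 + d\<^sub>n\<^sub>k\<^sup>2\<close> gives \<open>2 P\<^sub>n \<le> S + Q\<^sub>n\<close>, hence \<open>E \<le> S\<close>.\<close>

lemma first_sum: "(\<lambda>k. (far (Suc k))\<^sup>2 / \<mu> (Suc k)) sums ((3 - 4 * ln 2) / (2 * pi))"
proof -
  define E where "E = (3 - 4 * ln 2) / (2 * pi)"
  define a where "a n = integral\<^sup>L seg (arcsine_cut n)" for n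
  define d where "d n k = ip (arcsine_cut n) (trace (Suc k))" for n k
  define P where "P n = (ip (segpot (arcsine_cut n)) (\<lambda>_. 1) - a n * (4 * ln 2 - 6) / 2) / (2 * pi)" for n
  define Q where "Q n = a n * P n - (ip (segpot (arcsine_cut n)) (arcsine_cut n) - ip (segpot (arcsine_cut n)) (\<lambda>_. 1) * a n / 2) / pi" for n
  have m: "\<mu> (Suc k) > 0" for k by (rule mu_pos)
  have a: "a \<longlonglongrightarrow> 1" unfolding a_def by (rule arcsine_cut_integral)
  have k1: "(\<lambda>n. ip (segpot (arcsine_cut n)) (\<lambda>_. 1)) \<longlonglongrightarrow> - 2 * ln 2"
    using ip_segpot_arcsine_cut[OF bdd_borel_const[of 1]] by (simp add: integral_seg_const mult.commute)
  have "P \<longlonglongrightarrow> (- 2 * ln 2 - 1 * (4 * ln 2 - 6) / 2) / (2 * pi)"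
    unfolding P_def by (intro tendsto_intros k1 a) auto
  also have "(- 2 * ln 2 - 1 * (4 * ln 2 - 6) / 2) / (2 * pi) = E" by (simp add: E_def field_simps)
  finally have P: "P \<longlonglongrightarrow> E" .
  have "Q \<longlonglongrightarrow> 1 * E - (- ln 2 - (- 2 * ln 2) * 1 / 2) / pi"
    unfolding Q_def by (intro tendsto_intros k1 a P ip_segpot_arcsine_cut_self) auto
  then have Q: "Q \<longlonglongrightarrow> E" by simp
  have Ps: "(\<lambda>k. far (Suc k) * d n k / \<mu> (Suc k)) sums P n" for n
  proof -
    have "ip ell (arcsine_cut n) = ip (segpot (arcsine_cut n)) (\<lambda>_. 1)"
      using segpot_symmetric[OF bdd_borel_const bdd_borel_arcsine_cut, of 1 n] ip_commute by metis
    then have "(\<lambda>k. ip ell (trace (Suc k)) * d n k) sums (ip (segpot (arcsine_cut n)) (\<lambda>_. 1) - (4 * ln 2 - 6) * a n / 2)"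
      using parseval_Suc[OF bdd_ell bdd_borel_arcsine_cut[of n]] segpot_one_integrals(1) by (simp add: d_def a_def)
    from sums_divide[OF this, of "2 * pi"] show ?thesis
      unfolding ip_ell_trace P_def by (simp add: mult_ac)
  qed
  have Qs: "(\<lambda>k. (d n k)\<^sup>2 / \<mu> (Suc k)) sums Q n" for n
  proof -
    have "(\<lambda>k. ip (segpot (arcsine_cut n)) (trace (Suc k)) * d n k)
        sums (ip (segpot (arcsine_cut n)) (arcsine_cut n) - ip (segpot (arcsine_cut n)) (\<lambda>_. 1) * a n / 2)"
      using parseval_Suc[OF bdd_borel_segpot[OF bdd_borel_arcsine_cut] bdd_borel_arcsine_cut, of n n]
      by (simp add: d_def a_def ip_one(1))
    from sums_diff[OF sums_mult[OF Ps[of n], of "a n"] sums_divide[OF this, of pi]]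
    have "(\<lambda>k. a n * (far (Suc k) * d n k / \<mu> (Suc k)) - ip (segpot (arcsine_cut n)) (trace (Suc k)) * d n k / pi) sums Q n"
      unfolding Q_def .
    moreover have "a n * (far (Suc k) * d n k / \<mu> (Suc k)) - ip (segpot (arcsine_cut n)) (trace (Suc k)) * d n k / pi
        = (d n k)\<^sup>2 / \<mu> (Suc k)" for k
      unfolding ip_segpot_trace[OF bdd_borel_arcsine_cut] a_def[symmetric] d_def[symmetric]
      using m[of k] by (simp add: field_simps power2_eq_square)
    ultimately show ?thesis by simp
  qed
  have nn: "x\<^sup>2 / \<mu> (Suc k) \<ge> 0" for x k using m[of k] by simp
  have partial: "(\<Sum>k<M. (far (Suc k))\<^sup>2 / \<mu> (Suc k)) \<le> E" for M
  proof (rule LIMSEQ_le[OF _ Q])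
    show "(\<lambda>n. \<Sum>k<M. (d n k)\<^sup>2 / \<mu> (Suc k)) \<longlonglongrightarrow> (\<Sum>k<M. (far (Suc k))\<^sup>2 / \<mu> (Suc k))"
      unfolding d_def by (intro tendsto_intros ip_arcsine_cut_trace) (use m in \<open>auto simp: less_imp_neq[symmetric]\<close>)
    show "\<exists>N. \<forall>n\<ge>N. (\<Sum>k<M. (d n k)\<^sup>2 / \<mu> (Suc k)) \<le> Q n"
      using sum_le_suminf[OF sums_summable[OF Qs]] nn sums_unique[OF Qs] by auto
  qed
  have sm: "summable (\<lambda>k. (far (Suc k))\<^sup>2 / \<mu> (Suc k))"
    by (rule summableI_nonneg_bounded[of _ E]) (use nn partial in auto)
  define S where "S = (\<Sum>k. (far (Suc k))\<^sup>2 / \<mu> (Suc k))"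
  have S: "(\<lambda>k. (far (Suc k))\<^sup>2 / \<mu> (Suc k)) sums S" unfolding S_def using sm by (rule summable_sums)
  have "S \<le> E" unfolding S_def by (rule suminf_le_const[OF sm]) (rule partial)
  moreover have "E \<le> S"
  proof -
    have "P n \<le> (S + Q n) / 2" for n
    proof (rule sums_le[OF _ Ps sums_divide[OF sums_add[OF S Qs]]])
      fix k
      have "2 * (far (Suc k) * d n k) \<le> (far (Suc k))\<^sup>2 + (d n k)\<^sup>2"
        using sum_squares_bound[of "far (Suc k)" "d n k"] by simp
      then show "far (Suc k) * d n k / \<mu> (Suc k) \<le> ((far (Suc k))\<^sup>2 / \<mu> (Suc k) + (d n k)\<^sup>2 / \<mu> (Suc k)) / 2"
        using m[of k] by (simp add: field_simps)
    qed
    moreover have "(\<lambda>n. (S + Q n) / 2) \<longlonglongrightarrow> (S + E) / 2" by (intro tendsto_intros Q) auto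
    ultimately have "E \<le> (S + E) / 2" using LIMSEQ_le[OF P] by blast
    then show ?thesis by simp
  qed
  ultimately show ?thesis using S by (simp add: E_def)
qed

lemma mu_ge: "\<mu> (Suc k) \<ge> \<mu> 1"
  using system by (intro monoD[of \<mu>]) (auto simp: steklov_neumann_system_def)

text \<open>Testing the equation for the boundary values with \<open>e\<^sub>k\<close> gives their coefficients; testing it with
  \<open>1\<close> expresses \<open>A\<close> by the pairing with \<open>K 1\<close>, which Parseval's identity evaluates. In
  particular every Green's function has the same constant.\<close>

lemma robin_constant_formula:
  assumes g: "robin_green \<nu> g" and lim: "((\<lambda>y. g y - ln (norm y)) \<longlongrightarrow> A) infinity_in_half_plane"
    and \<nu>: "\<nu> \<noteq> 0" "\<bar>\<nu>\<bar> < \<mu> 1"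
  shows "A = pi / (2 * \<nu>) + (3 / 2 - ln 2) - \<nu> * pi * (\<Sum>k. (far (Suc k))\<^sup>2 / (\<mu> (Suc k) * (\<mu> (Suc k) + \<nu>)))"
    and "summable (\<lambda>k. (far (Suc k))\<^sup>2 / (\<mu> (Suc k) * (\<mu> (Suc k) + \<nu>)))"
proof -
  define f where "f x = g (x, 0)" for x
  have "mixed_solution (- \<nu>) g" "(\<lambda>y. g y - 1 * ln (norm y)) \<in> O[infinity_in_half_plane](\<lambda>_. 1)"
    using g by (auto simp: robin_green_def)
  from mixed_solution_representation[OF this] obtain A' where
    cf: "continuous_on UNIV f" and mass: "- \<nu> / pi * integral\<^sup>L seg f = - 1"
    and feq: "\<And>x. \<bar>x\<bar> < 1 \<Longrightarrow> f x = A' - (- \<nu>) / pi * logpot f (x, 0)"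
    and lim': "((\<lambda>y. g y - 1 * ln (norm y)) \<longlongrightarrow> A') infinity_in_half_plane"
    unfolding f_def[abs_def] by blast
  have "A = A'" using tendsto_unique[OF infinity_in_half_plane_neq_bot lim] lim' by simp
  then have feq: "f x = A + \<nu> / pi * segpot f x" if "x \<in> {-1<..<1}" for x
    using feq[of x] that by (simp add: segpot_def abs_less_iff)
  have bf: "bdd_borel f" by (rule bdd_borel_continuous[OF cf])
  note bs = bdd_borel_segpot[OF bf]
  have mf: "integral\<^sup>L seg f = pi / \<nu>" using mass \<nu> by (simp add: field_simps)
  have ipf: "ip f h = A * integral\<^sup>L seg h + \<nu> / pi * ip (segpot f) h" if "bdd_borel h" for h
  proof -
    have "ip f h = ip (\<lambda>x. A + \<nu> / pi * segpot f x) h" by (rule ip_cong_seg) (rule feq)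
    also have "\<dots> = ip (\<lambda>_. A) h + \<nu> / pi * ip (segpot f) h"
      by (subst ip_add[OF bdd_borel_const bdd_borel_cmult[OF bs] that]) (simp only: ip_cmult)
    finally show ?thesis by (simp add: ip_def[of "\<lambda>_. A"])
  qed
  have m: "\<mu> (Suc k) > 0" "\<mu> (Suc k) + \<nu> > 0" for k using mu_pos[of k] mu_ge[of k] \<nu>(2) by linarith+
  have fk: "ip f (trace (Suc k)) = pi * far (Suc k) / (\<mu> (Suc k) + \<nu>)" for k
  proof -
    have "ip f (trace (Suc k)) = \<nu> / pi * (pi / \<mu> (Suc k) * (far (Suc k) * (pi / \<nu>) - ip f (trace (Suc k))))"
      using ipf[OF bdd_trace[of "Suc k"]] by (simp add: mean_trace ip_segpot_trace[OF bf] mf)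
    also have "\<dots> = (far (Suc k) * pi - \<nu> * ip f (trace (Suc k))) / \<mu> (Suc k)"
      using m[of k] \<nu>(1) by (simp add: field_simps)
    finally have "ip f (trace (Suc k)) * (\<mu> (Suc k) + \<nu>) = pi * far (Suc k)"
      using m[of k] by (simp add: field_simps)
    then show ?thesis using m[of k] by (simp add: field_simps)
  qed
  have "pi / \<nu> = 2 * A + \<nu> / pi * ip f ell"
  proof -
    have "ip f (\<lambda>_. 1) = A * 2 + \<nu> / pi * ip (segpot f) (\<lambda>_. 1)"
      using ipf[OF bdd_borel_const[of 1]] by (simp add: integral_seg_const)
    then show ?thesis using segpot_symmetric[OF bf bdd_borel_const[of 1]] by (simp add: ip_one(1) mf)
  qed
  then have fl: "ip f ell = pi / \<nu> * (pi / \<nu> - 2 * A)" using \<nu>(1) by (simp add: field_simps)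
  have "(\<lambda>k. ip f (trace (Suc k)) * ip ell (trace (Suc k))) sums (ip f ell - pi / \<nu> * (4 * ln 2 - 6) / 2)"
    using parseval_Suc[OF bf bdd_ell] segpot_one_integrals(1) mf by simp
  from sums_mult[OF this, of "1 / (2 * pi\<^sup>2)"]
  have "(\<lambda>k. 1 / (2 * pi\<^sup>2) * (ip f (trace (Suc k)) * ip ell (trace (Suc k)))) sums (1 / (2 * pi\<^sup>2) * (ip f ell - pi / \<nu> * (4 * ln 2 - 6) / 2))" .
  moreover have "1 / (2 * pi\<^sup>2) * (ip f (trace (Suc k)) * ip ell (trace (Suc k))) = (far (Suc k))\<^sup>2 / (\<mu> (Suc k) * (\<mu> (Suc k) + \<nu>))" for k
    unfolding fk ip_ell_trace using m[of k] by (simp add: field_simps power2_eq_square)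
  ultimately have s: "(\<lambda>k. (far (Suc k))\<^sup>2 / (\<mu> (Suc k) * (\<mu> (Suc k) + \<nu>))) sums (1 / (2 * pi\<^sup>2) * (ip f ell - pi / \<nu> * (4 * ln 2 - 6) / 2))"
    by simp
  then show "summable (\<lambda>k. (far (Suc k))\<^sup>2 / (\<mu> (Suc k) * (\<mu> (Suc k) + \<nu>)))" by (rule sums_summable)
  show "A = pi / (2 * \<nu>) + (3 / 2 - ln 2) - \<nu> * pi * (\<Sum>k. (far (Suc k))\<^sup>2 / (\<mu> (Suc k) * (\<mu> (Suc k) + \<nu>)))"
    unfolding sums_unique[OF s, symmetric] fl using \<nu>(1) by (simp add: field_simps power2_eq_square)
qed

lemma robin_constant_eq:
  assumes \<nu>: "\<nu> \<noteq> 0" "\<bar>\<nu>\<bar> < \<mu> 1" "\<bar>\<nu>\<bar> \<le> 1 / 50"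
  shows "robin_constant \<nu> = pi / (2 * \<nu>) + (3 / 2 - ln 2) - \<nu> * pi * (\<Sum>k. (far (Suc k))\<^sup>2 / (\<mu> (Suc k) * (\<mu> (Suc k) + \<nu>)))"
    (is "_ = ?R")
proof -
  obtain g A where g: "robin_green \<nu> g" "((\<lambda>y. g y - ln (norm y)) \<longlongrightarrow> A) infinity_in_half_plane"
    using robin_green_exists[OF \<nu>(1,3)] by blast
  show ?thesis unfolding robin_constant_def
  proof (rule the_equality)
    show "\<exists>g. robin_green \<nu> g \<and> ((\<lambda>y. g y - ln (norm y)) \<longlongrightarrow> ?R) infinity_in_half_plane"
      using g robin_constant_formula(1)[OF g \<nu>(1,2)] by blast
    show "A = ?R" if "\<exists>g. robin_green \<nu> g \<and> ((\<lambda>y. g y - ln (norm y)) \<longlongrightarrow> A) infinity_in_half_plane" for A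
      using that robin_constant_formula(1)[OF _ _ \<nu>(1,2)] by blast
  qed
qed

text \<open>An antisymmetric function has the limits \<open>c\<close> and \<open>- c\<close> along reflected points.\<close>

lemma far_odd: "odd k \<Longrightarrow> far k = 0"
proof -
  assume k: "odd k"
  define R where "R = (\<lambda>y :: real \<times> real. (- fst y, snd y))"
  have anti: "\<Psi> k (R y) = - \<Psi> k y" if "snd y \<ge> 0" for y
    using system k that by (auto simp: steklov_neumann_system_def closed_half_plane_def R_def)
  have "filterlim R infinity_in_half_plane infinity_in_half_plane"
    unfolding filterlim_iff
  proof (intro allI impI)
    fix P assume "eventually P infinity_in_half_plane"
    then obtain b where "\<forall>y. norm y \<ge> b \<and> snd y \<ge> 0 \<longrightarrow> P y"
      unfolding eventually_infinity_in_half_plane by blast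
    moreover have "norm (R y) = norm y" "snd (R y) = snd y" for y
      by (simp_all add: R_def norm_prod_def)
    ultimately have "\<forall>y. norm y \<ge> b \<and> snd y \<ge> 0 \<longrightarrow> P (R y)" by metis
    then show "\<forall>\<^sub>F y in infinity_in_half_plane. P (R y)"
      unfolding eventually_infinity_in_half_plane by blast
  qed
  from filterlim_compose[OF eigen(4)[of k] this]
  have "((\<lambda>y. \<Psi> k (R y)) \<longlongrightarrow> far k) infinity_in_half_plane" .
  moreover have "((\<lambda>y. - \<Psi> k y) \<longlongrightarrow> - far k) infinity_in_half_plane" by (intro tendsto_minus eigen(4))
  moreover have "\<forall>\<^sub>F y in infinity_in_half_plane. - \<Psi> k y = \<Psi> k (R y)"
    unfolding eventually_infinity_in_half_plane using anti by auto
  ultimately have "((\<lambda>y. \<Psi> k (R y)) \<longlongrightarrow> - far k) infinity_in_half_plane"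
    by (simp add: tendsto_cong)
  with \<open>((\<lambda>y. \<Psi> k (R y)) \<longlongrightarrow> far k) infinity_in_half_plane\<close>
  have "far k = - far k" using tendsto_unique[OF infinity_in_half_plane_neq_bot] by blast
  then show ?thesis by simp
qed

lemma sums_even_iff:
  "(\<lambda>k. (far (2 * Suc k))\<^sup>2 * h (2 * Suc k)) sums s \<longleftrightarrow> (\<lambda>k. (far (Suc k))\<^sup>2 * h (Suc k)) sums s"
proof -
  have "strict_mono (\<lambda>k::nat. 2 * k + 1)" by (auto simp: strict_mono_def)
  moreover have "(far (Suc n))\<^sup>2 * h (Suc n) = 0" if "n \<notin> range (\<lambda>k. 2 * k + 1)" for n
  proof -
    have "even n" using that by (metis oddE rangeI)
    then show ?thesis using far_odd[of "Suc n"] by simp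
  qed
  ultimately show ?thesis
    using sums_mono_reindex[of "\<lambda>k. 2 * k + 1" "\<lambda>n. (far (Suc n))\<^sup>2 * h (Suc n)" s] by simp
qed

lemma even_sums: "(\<lambda>k. coeff_summand \<mu> \<Psi> 1 (Suc k)) sums ((3 - 4 * ln 2) / (2 * pi))"
  "(\<lambda>k. coeff_summand \<mu> \<Psi> 2 (Suc k)) sums ((21 - 2 * pi\<^sup>2) / (18 * pi\<^sup>2))"
  using first_sum second_sum sums_even_iff[of "\<lambda>k. 1 / \<mu> k"] sums_even_iff[of "\<lambda>k. 1 / (\<mu> k)\<^sup>2"]
  by (simp_all add: coeff_summand_def far_def)

lemma coeff_summand_nonneg: "coeff_summand \<mu> \<Psi> n (Suc k) \<ge> 0"
  using mu_pos[of "2 * k + 1"] by (simp add: coeff_summand_def)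

lemma coeff_summand_Suc:
  "coeff_summand \<mu> \<Psi> (Suc n) (Suc k) = coeff_summand \<mu> \<Psi> 1 (Suc k) * (1 / \<mu> (2 * Suc k)) ^ n"
  by (simp add: coeff_summand_def power_divide field_simps)

lemma coeff_summable: "summable (\<lambda>k. coeff_summand \<mu> \<Psi> (Suc n) (Suc k))"
proof (rule summable_comparison_test'[of "\<lambda>k. coeff_summand \<mu> \<Psi> 1 (Suc k) * (1 / \<mu> 1) ^ n" 0])
  show "summable (\<lambda>k. coeff_summand \<mu> \<Psi> 1 (Suc k) * (1 / \<mu> 1) ^ n)"
    by (rule summable_mult2[OF sums_summable[OF even_sums(1)]])
  show "norm (coeff_summand \<mu> \<Psi> (Suc n) (Suc k)) \<le> coeff_summand \<mu> \<Psi> 1 (Suc k) * (1 / \<mu> 1) ^ n" for k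
  proof -
    have "(1 / \<mu> (2 * Suc k)) ^ n \<le> (1 / \<mu> 1) ^ n"
      using mu_ge[of "2 * k + 1"] mu_pos[of 0] mu_pos[of "2 * k + 1"] by (intro power_mono divide_left_mono mult_pos_pos) auto
    then have "coeff_summand \<mu> \<Psi> (Suc n) (Suc k) \<le> coeff_summand \<mu> \<Psi> 1 (Suc k) * (1 / \<mu> 1) ^ n"
      unfolding coeff_summand_Suc[of n] by (intro mult_left_mono coeff_summand_nonneg)
    then show ?thesis using coeff_summand_nonneg[of "Suc n" k] by simp
  qed
qed

lemma expansion:
  assumes \<nu>: "\<nu> \<noteq> 0" "\<bar>\<nu>\<bar> < \<mu> 1" "\<bar>\<nu>\<bar> \<le> 1 / 50"
  shows "(\<lambda>n. (- \<nu>) ^ n * robin_coeff \<mu> \<Psi> (n + 1)) sums (robin_constant \<nu> - pi / (2 * \<nu>))"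
proof -
  define T where "T k = coeff_summand \<mu> \<Psi> 1 (Suc k)" for k
  define x where "x k = - \<nu> / \<mu> (2 * Suc k)" for k
  define r where "r = \<bar>\<nu>\<bar> / \<mu> 1"
  have m1: "\<mu> 1 > 0" using mu_pos[of 0] by simp
  have m: "\<mu> (2 * Suc k) \<ge> \<mu> 1" "\<mu> (2 * Suc k) > 0" "\<mu> (2 * Suc k) + \<nu> > 0" for k
    using mu_ge[of "2 * k + 1"] mu_pos[of "2 * k + 1"] \<nu>(2) by auto
  have r: "r < 1" using \<nu>(2) m1 by (simp add: r_def)
  have x: "\<bar>x k\<bar> \<le> r" for k
    unfolding x_def r_def abs_divide abs_minus_cancel using m[of k] m1 by (intro frac_le) auto
  have T: "summable T" "\<And>k. T k \<ge> 0"
    unfolding T_def using sums_summable[OF even_sums(1)] coeff_summand_nonneg by auto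
  note geo = sums_power_suminf[OF T x r]
  have trm: "(- \<nu>) ^ n * robin_coeff \<mu> \<Psi> (n + 1) = (if n = 0 then ln 2 else 0) + pi * (\<Sum>k. T k * x k ^ n)" for n
  proof -
    have e: "(- \<nu>) ^ n * coeff_summand \<mu> \<Psi> (n + 1) (Suc k) = T k * x k ^ n" for k
    proof -
      have "(- \<nu>) ^ n * (1 / \<mu> (2 * Suc k)) ^ n = x k ^ n"
        unfolding x_def power_mult_distrib[symmetric] by simp
      then show ?thesis
        unfolding T_def Suc_eq_plus1[symmetric] coeff_summand_Suc[of n k] by (metis mult.left_commute)
    qed
    have "summable (\<lambda>k. coeff_summand \<mu> \<Psi> (n + 1) (Suc k))"
      using coeff_summable[of n] by simp
    from suminf_mult[OF this, of "(- \<nu>) ^ n"]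
    have "(- \<nu>) ^ n * (\<Sum>k. coeff_summand \<mu> \<Psi> (n + 1) (Suc k)) = (\<Sum>k. T k * x k ^ n)"
      unfolding e by simp
    then show ?thesis
      unfolding robin_coeff_def distrib_left mult.left_commute[of _ pi] by simp
  qed
  have "(\<lambda>n. (if n = 0 then ln 2 else 0) + pi * (\<Sum>k. T k * x k ^ n)) sums (ln 2 + pi * (\<Sum>k. T k / (1 - x k)))"
    by (intro sums_add sums_mult geo(3) sums_single)
  then have s: "(\<lambda>n. (- \<nu>) ^ n * robin_coeff \<mu> \<Psi> (n + 1)) sums (ln 2 + pi * (\<Sum>k. T k / (1 - x k)))"
    by (simp only: trm)
  obtain g A where g: "robin_green \<nu> g" "((\<lambda>y. g y - ln (norm y)) \<longlongrightarrow> A) infinity_in_half_plane"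
    using robin_green_exists[OF \<nu>(1,3)] by blast
  define Z where "Z = (\<Sum>k. (far (Suc k))\<^sup>2 / (\<mu> (Suc k) * (\<mu> (Suc k) + \<nu>)))"
  have "(\<lambda>k. (far (Suc k))\<^sup>2 * (1 / (\<mu> (Suc k) * (\<mu> (Suc k) + \<nu>)))) sums Z"
    unfolding Z_def using summable_sums[OF robin_constant_formula(2)[OF g \<nu>(1,2)]] by simp
  then have "(\<lambda>k. (far (2 * Suc k))\<^sup>2 * (1 / (\<mu> (2 * Suc k) * (\<mu> (2 * Suc k) + \<nu>)))) sums Z"
    by (subst sums_even_iff[of "\<lambda>k. 1 / (\<mu> k * (\<mu> k + \<nu>))"])
  from sums_diff[OF even_sums(1) sums_mult[OF this, of \<nu>]]
  have "(\<lambda>k. T k - \<nu> * ((far (2 * Suc k))\<^sup>2 * (1 / (\<mu> (2 * Suc k) * (\<mu> (2 * Suc k) + \<nu>))))) sums ((3 - 4 * ln 2) / (2 * pi) - \<nu> * Z)"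
    unfolding T_def .
  moreover have "T k - \<nu> * ((far (2 * Suc k))\<^sup>2 * (1 / (\<mu> (2 * Suc k) * (\<mu> (2 * Suc k) + \<nu>)))) = T k / (1 - x k)" for k
  proof -
    define M where "M = \<mu> (2 * Suc k)"
    have M: "M > 0" "M + \<nu> > 0" using m[of k] by (auto simp: M_def)
    have Tk: "T k = (far (2 * Suc k))\<^sup>2 / M" by (simp add: T_def coeff_summand_def M_def far_def)
    have xk: "1 - x k = (M + \<nu>) / M" unfolding x_def M_def[symmetric] using M by (simp add: field_simps)
    have "q / M - \<nu> * (q * (1 / (M * (M + \<nu>)))) = q / M / ((M + \<nu>) / M)" for q
    proof -
      have "q / M = q * (M + \<nu>) / (M * (M + \<nu>))" using M by simp
      then have "q / M - \<nu> * (q * (1 / (M * (M + \<nu>)))) = (q * (M + \<nu>) - \<nu> * q) / (M * (M + \<nu>))"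
        by (simp add: diff_divide_distrib)
      also have "q * (M + \<nu>) - \<nu> * q = q * M" by (simp add: algebra_simps)
      finally show ?thesis using M by simp
    qed
    then show ?thesis unfolding Tk xk M_def[symmetric] .
  qed
  ultimately have "(\<lambda>k. T k / (1 - x k)) sums ((3 - 4 * ln 2) / (2 * pi) - \<nu> * Z)" by simp
  then have "(\<Sum>k. T k / (1 - x k)) = (3 - 4 * ln 2) / (2 * pi) - \<nu> * Z"
    by (rule sums_unique[symmetric])
  then have "ln 2 + pi * (\<Sum>k. T k / (1 - x k)) = robin_constant \<nu> - pi / (2 * \<nu>)"
    unfolding robin_constant_eq[OF \<nu>] Z_def[symmetric] by (simp add: field_simps)
  then show ?thesis using s by simp
qed

end


theorem mainTheorem2:
  fixes \<mu> :: "nat \<Rightarrow> real" and \<Psi> :: "nat \<Rightarrow> real \<times> real \<Rightarrow> real"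
  assumes "steklov_neumann_system \<mu> \<Psi>"
  shows "(\<forall>n\<ge>1. summable (\<lambda>k. coeff_summand \<mu> \<Psi> n (Suc k))) \<and>
    (\<exists>\<delta>>0. \<forall>\<nu>::real. 0 < \<bar>\<nu>\<bar> \<and> \<bar>\<nu>\<bar> < \<delta> \<longrightarrow>
        (\<lambda>n. (- \<nu>) ^ n * robin_coeff \<mu> \<Psi> (n + 1)) sums (robin_constant \<nu> - pi / (2 * \<nu>))) \<and>
    robin_coeff \<mu> \<Psi> 1 = 3 / 2 - ln 2 \<and>
    robin_coeff \<mu> \<Psi> 2 = (21 - 2 * pi\<^sup>2) / (18 * pi)"
proof -
  interpret steklov \<mu> \<Psi> by unfold_locales (rule assms)
  show ?thesis
  proof (intro conjI)
    show "\<forall>n\<ge>1. summable (\<lambda>k. coeff_summand \<mu> \<Psi> n (Suc k))"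
    proof (intro allI impI)
      fix n :: nat assume "n \<ge> 1"
      then obtain j where "n = Suc j" by (cases n) auto
      then show "summable (\<lambda>k. coeff_summand \<mu> \<Psi> n (Suc k))" using coeff_summable by simp
    qed
    show "\<exists>\<delta>>0. \<forall>\<nu>::real. 0 < \<bar>\<nu>\<bar> \<and> \<bar>\<nu>\<bar> < \<delta> \<longrightarrow>
        (\<lambda>n. (- \<nu>) ^ n * robin_coeff \<mu> \<Psi> (n + 1)) sums (robin_constant \<nu> - pi / (2 * \<nu>))"
      by (rule exI[of _ "min (\<mu> 1) (1 / 50)"]) (use mu_pos[of 0] expansion in auto)
    show "robin_coeff \<mu> \<Psi> 1 = 3 / 2 - ln 2"
      unfolding robin_coeff_def sums_unique[OF even_sums(1), symmetric] by (simp add: field_simps)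
    show "robin_coeff \<mu> \<Psi> 2 = (21 - 2 * pi\<^sup>2) / (18 * pi)"
      unfolding robin_coeff_def sums_unique[OF even_sums(2), symmetric] by (simp add: field_simps power2_eq_square)
  qed
qed

end
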